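(* Let $K$ be a field (with the standing assumption on $\mathrm{char}(K)$ given in the context) and let $I\subset S=K[x_1,\dots,x_n]$ be a nonzero squarefree monomial ideal equigenerated in degree $d$ (i.e. all monomials in its minimal monomial generating set have degree $d$). If $d\in\{0,1,2,n-2,n-1,n\}$, the following conditions are equivalent: (a) $I$ has linear resolution. (b) $I$ has linear quotients. (c) $I$ is vertex splittable. (d) $I$ has differential linear resolution.
   Context: $S=K[x_1,\dots,x_n]$ is the standard graded polynomial ring over the field $K$. For a homogeneous ideal $I\subset S$, the gradient ideal $\partial(I)$ is the ideal generated by all partial derivatives $\partial f/\partial x_i$ ($1\le i\le n$) of the elements $f$ of a minimal generating set of $I$; $\partial^0(I)=I$, $\partial^1(I)=\partial(I)$ and $\partial^\ell(I)=\partial(\partial^{\ell-1}(I))$ for $\ell>1$. For a monomial ideal $I$, $\mathcal{G}(I)$ denotes its minimal monomial generating set, and $\mathrm{supp}(u)=\{i: x_i \text{ divides } u\}$ for a monomial $u$. Standing assumption: $\mathrm{char}(K)=0$, or $\mathrm{char}(K)$ is large enough that for every monomial ideal $I$ under consideration $$\partial(I)=(u/x_i:\ u\in\mathcal{G}(I),\ i\in\mathrm{supp}(u)).$$ For a homogeneous ideal $I$, $\mathrm{reg}\,I=\max\{j-i:\ \dim_K\mathrm{Tor}^S_i(K,I)_j\neq 0\}$ is the Castelnuovo–Mumford regularity, and $\alpha(I)$ is the minimal degree of a minimal homogeneous generator of $I$. The ideal $I$ has linear resolution if all its minimal homogeneous generators have the same degree $d$ and $\mathrm{reg}\,I=d$.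 A homogeneous ideal $I$ has differential linear resolution if $\partial^\ell(I)$ has linear resolution for all $\ell=0,\dots,\alpha(I)$, that is, $\mathrm{reg}\,\partial^\ell(I)=\alpha(I)-\ell$ for all $\ell=0,\dots,\alpha(I)$. A monomial ideal $I$ has linear quotients if there is an order $u_1,\dots,u_m$ of $\mathcal{G}(I)$ such that $(u_1,\dots,u_{i-1}):(u_i)$ is generated by variables for all $i=2,\dots,m$. A monomial ideal $I\subset S$ is vertex splittable if it can be obtained by the following recursive procedure: (i) if $u$ is a monomial and $I=(u)$, $I=(0)$ or $I=S$, then $I$ is vertex splittable; (ii) if there exist a variable $x_i$ and vertex splittable ideals $I_1\subset S$ and $I_2\subset K[x_1,\dots,x_{i-1},x_{i+1},\dots,x_n]$ such that $I=x_iI_1+I_2$, $I_2\subseteq I_1$ and $\mathcal{G}(I)$ is the disjoint union of $\mathcal{G}(x_iI_1)$ and $\mathcal{G}(I_2)$, then $I$ is vertex splittable. (Ideals generated by monomials in a subset of the variables are identified with their extensions to $S$.) *)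

theory Defs
  imports
    "HOL-Library.Poly_Mapping"
    "HOL-Library.Function_Algebras"
    "HOL-Computational_Algebra.Computational_Algebra"
begin

section \<open>The polynomial ring and its ideals\<close>

text \<open>
  The polynomial ring in variables indexed by a finite type is the monoid algebra of the
  exponent vectors.  The library's order on finitely supported functions is lexicographic, so
  divisibility of monomials is spelled out below instead of being written as an inequality.
\<close>

type_synonym 'n monomial = "'n \<Rightarrow>\<^sub>0 nat"
type_synonym ('n, 'k) mpoly = "'n monomial \<Rightarrow>\<^sub>0 'k"

definition mon :: "'n monomial \<Rightarrow> ('n, 'k::field) mpoly" where
  "mon t = Poly_Mapping.single t 1"

definition var :: "'n \<Rightarrow> ('n, 'k::field) mpoly" where
  "var v = mon (Poly_Mapping.single v 1)"

definition mdeg :: "'n::finite monomial \<Rightarrow> nat" where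
  "mdeg t = (\<Sum>v\<in>UNIV. Poly_Mapping.lookup t v)"

definition mdvd :: "'n monomial \<Rightarrow> 'n monomial \<Rightarrow> bool" where
  "mdvd s t \<longleftrightarrow> (\<forall>v. Poly_Mapping.lookup s v \<le> Poly_Mapping.lookup t v)"

text \<open>The ideals of a commutative ring are its submodules as a module over itself.\<close>

interpretation ideal: module "(*) :: 'a::comm_ring_1 \<Rightarrow> 'a \<Rightarrow> 'a"
  by standard (simp_all add: algebra_simps)

declare ideal.scale_scale [simp del]

abbreviation is_ideal :: "'a::comm_ring_1 set \<Rightarrow> bool" where
  "is_ideal \<equiv> ideal.subspace"

abbreviation ideal_gen :: "'a::comm_ring_1 set \<Rightarrow> 'a set" where
  "ideal_gen \<equiv> ideal.span"

definition colon_ideal :: "'a::comm_ring_1 set \<Rightarrow> 'a set \<Rightarrow> 'a set" where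
  "colon_ideal I J = {f. \<forall>g\<in>J. f * g \<in> I}"

definition homogeneous :: "nat \<Rightarrow> ('n::finite, 'k::field) mpoly \<Rightarrow> bool" where
  "homogeneous d f \<longleftrightarrow> (\<forall>t\<in>Poly_Mapping.keys f. mdeg t = d)"

definition homogeneous_ideal :: "('n::finite, 'k::field) mpoly set \<Rightarrow> bool" where
  "homogeneous_ideal I \<longleftrightarrow> (\<exists>G. (\<forall>g\<in>G. \<exists>d. homogeneous d g) \<and> I = ideal_gen G)"

definition min_hom_gens ::
    "('n::finite, 'k::field) mpoly set \<Rightarrow> ('n, 'k) mpoly set \<Rightarrow> bool" where
  "min_hom_gens I G \<longleftrightarrow>
     (\<forall>g\<in>G. \<exists>d. homogeneous d g) \<and> ideal_gen G = I \<and> (\<forall>H. H \<subset> G \<longrightarrow> ideal_gen H \<noteq> I)"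

definition alpha :: "('n::finite, 'k::field) mpoly set \<Rightarrow> nat" where
  "alpha I = (LEAST d. \<exists>G. min_hom_gens I G \<and> (\<exists>g\<in>G. homogeneous d g))"


section \<open>Monomial ideals\<close>

definition monomial_ideal :: "('n, 'k::field) mpoly set \<Rightarrow> bool" where
  "monomial_ideal I \<longleftrightarrow> (\<exists>M. I = ideal_gen (mon ` M))"

text \<open>The set \<open>\<G>(I)\<close>; lemma \<open>min_mons_unique\<close> below shows that it is the unique minimal set
  of monomial generators of a monomial ideal.\<close>

definition min_mons :: "('n, 'k::field) mpoly set \<Rightarrow> 'n monomial set" where
  "min_mons I = {t. mon t \<in> I \<and> (\<forall>s. mon s \<in> I \<and> mdvd s t \<longrightarrow> s = t)}"

definition squarefree_monomial_ideal :: "('n, 'k::field) mpoly set \<Rightarrow> bool" where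
  "squarefree_monomial_ideal I \<longleftrightarrow>
     monomial_ideal I \<and> (\<forall>t\<in>min_mons I. \<forall>v. Poly_Mapping.lookup t v \<le> 1)"

definition equigenerated :: "nat \<Rightarrow> ('n::finite, 'k::field) mpoly set \<Rightarrow> bool" where
  "equigenerated d I \<longleftrightarrow> (\<forall>t\<in>min_mons I. mdeg t = d)"

definition has_linear_quotients :: "('n, 'k::field) mpoly set \<Rightarrow> bool" where
  "has_linear_quotients I \<longleftrightarrow>
     (\<exists>us. distinct us \<and> set us = min_mons I \<and>
        (\<forall>i. 1 \<le> i \<and> i < length us \<longrightarrow>
           (\<exists>V. colon_ideal (ideal_gen (mon ` set (take i us))) (ideal_gen {mon (us ! i)})
                  = ideal_gen (var ` V :: ('n, 'k) mpoly set))))"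

text \<open>
  \<open>vertex_splittable V I\<close> says that \<open>I\<close> is the extension to the whole ring of a vertex splittable
  ideal of the polynomial ring in the variables from \<open>V\<close>.
\<close>

inductive vertex_splittable :: "'n set \<Rightarrow> ('n, 'k::field) mpoly set \<Rightarrow> bool" where
  principal: "Poly_Mapping.keys u \<subseteq> V \<Longrightarrow> vertex_splittable V (ideal_gen {mon u})"
| zero: "vertex_splittable V {0}"
| whole: "vertex_splittable V UNIV"
| split: "vertex_splittable V I"
    if "x \<in> V" "vertex_splittable V I1" "vertex_splittable (V - {x}) I2"
      "I = {var x * f + g | f g. f \<in> I1 \<and> g \<in> I2}" "I2 \<subseteq> I1"
      "min_mons I = min_mons ((*) (var x) ` I1) \<union> min_mons I2"
      "min_mons ((*) (var x) ` I1) \<inter> min_mons I2 = {}"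


section \<open>Gradient ideals\<close>

definition partial_deriv :: "'n \<Rightarrow> ('n, 'k::field) mpoly \<Rightarrow> ('n, 'k) mpoly" where
  "partial_deriv v f = (\<Sum>t\<in>Poly_Mapping.keys f.
     Poly_Mapping.single (t - Poly_Mapping.single v 1)
       (of_nat (Poly_Mapping.lookup t v) * Poly_Mapping.lookup f t))"

text \<open>
  The minimal homogeneous generating set is chosen arbitrarily.  In characteristic zero, and in
  any characteristic for ideals generated in a single degree, the result does not depend on it.
\<close>

definition gradient_ideal :: "('n::finite, 'k::field) mpoly set \<Rightarrow> ('n, 'k) mpoly set" where
  "gradient_ideal I =
     ideal_gen {partial_deriv v f | v f. f \<in> (SOME G. min_hom_gens I G)}"


section \<open>Tor and regularity\<close>

text \<open>
  \<open>Tor\<^sub>i(K, I)\<close> is computed from the Koszul complex on the variables, a free resolution of \<open>K\<close>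
  (see lemma \<open>koszul_resolution\<close> below).  A chain of \<open>Koszul \<otimes> I\<close> is a family of elements of \<open>I\<close>,
  \<open>c F\<close> being the coefficient of the basis element \<open>e\<^sub>F\<close>, which has internal degree \<open>card F\<close>.
  The differential sends \<open>e\<^sub>F\<close> to the sum over \<open>v \<in> F\<close> of \<open>\<plusminus> x\<^sub>v\<close> times the basis element of
  \<open>F - {v}\<close>, the sign being given by the parity of the number of elements of \<open>F\<close> below \<open>v\<close>.
\<close>

type_synonym ('n, 'k) kchain = "'n set \<Rightarrow> ('n, 'k) mpoly"

definition koszul_chains ::
    "nat \<Rightarrow> nat \<Rightarrow> ('n::finite, 'k::field) mpoly set \<Rightarrow> ('n, 'k) kchain set" where
  "koszul_chains i j I = {c. \<forall>F. c F \<in> I \<and> (card F \<noteq> i \<longrightarrow> c F = 0) \<and>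
     (\<forall>t\<in>Poly_Mapping.keys (c F). mdeg t + i = j)}"

definition koszul_diff :: "('n::{finite,linorder}, 'k::field) kchain \<Rightarrow> ('n, 'k) kchain" where
  "koszul_diff c = (\<lambda>G. \<Sum>v\<in>- G. (- 1) ^ card {w\<in>G. w < v} * (var v * c (insert v G)))"

definition koszul_cycles ::
    "nat \<Rightarrow> nat \<Rightarrow> ('n::{finite,linorder}, 'k::field) mpoly set \<Rightarrow> ('n, 'k) kchain set" where
  "koszul_cycles i j I = {c \<in> koszul_chains i j I. koszul_diff c = 0}"

definition koszul_boundaries ::
    "nat \<Rightarrow> nat \<Rightarrow> ('n::{finite,linorder}, 'k::field) mpoly set \<Rightarrow> ('n, 'k) kchain set" where
  "koszul_boundaries i j I = koszul_diff ` koszul_chains (Suc i) j I"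

definition chain_scale :: "'k::field \<Rightarrow> ('n, 'k) kchain \<Rightarrow> ('n, 'k) kchain" where
  "chain_scale a c = (\<lambda>F. Poly_Mapping.single 0 a * c F)"

interpretation kchain: vector_space "chain_scale :: 'k::field \<Rightarrow> ('n, 'k) kchain \<Rightarrow> ('n, 'k) kchain"
proof
  fix a b :: 'k and c d :: "('n, 'k) kchain"
  show "chain_scale a (c + d) = chain_scale a c + chain_scale a d"
    by (simp add: chain_scale_def fun_eq_iff distrib_left)
  show "chain_scale (a + b) c = chain_scale a c + chain_scale b c"
    by (simp add: chain_scale_def fun_eq_iff single_add distrib_right)
  show "chain_scale a (chain_scale b c) = chain_scale (a * b) c"
    by (simp add: chain_scale_def fun_eq_iff mult_single flip: mult.assoc)
  show "chain_scale 1 c = c"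
    by (simp add: chain_scale_def fun_eq_iff)
qed

text \<open>The \<open>K\<close>-dimension of \<open>Tor\<^sub>i(K, I)\<^sub>j\<close>, as that of the quotient of cycles by boundaries
  (both are finite-dimensional).\<close>

definition tor_dim :: "nat \<Rightarrow> nat \<Rightarrow> ('n::{finite,linorder}, 'k::field) mpoly set \<Rightarrow> nat" where
  "tor_dim i j I = kchain.dim (koszul_cycles i j I) - kchain.dim (koszul_boundaries i j I)"

definition reg :: "('n::{finite,linorder}, 'k::field) mpoly set \<Rightarrow> int" where
  "reg I = Max {int j - int i | i j. tor_dim i j I \<noteq> 0}"

definition has_linear_resolution :: "('n::{finite,linorder}, 'k::field) mpoly set \<Rightarrow> bool" where
  "has_linear_resolution I \<longleftrightarrow> homogeneous_ideal I \<and>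
     (\<exists>d. (\<forall>G. min_hom_gens I G \<longrightarrow> (\<forall>g\<in>G. homogeneous d g)) \<and> reg I = int d)"

definition has_differential_linear_resolution ::
    "('n::{finite,linorder}, 'k::field) mpoly set \<Rightarrow> bool" where
  "has_differential_linear_resolution I \<longleftrightarrow>
     (\<forall>l\<le>alpha I. has_linear_resolution ((gradient_ideal ^^ l) I))"


section \<open>Uniqueness of the minimal monomial generators\<close>

lemma lookup_mon: "Poly_Mapping.lookup (mon t) a = (1 when t = a)"
  by (simp add: mon_def lookup_single)

lemma mdeg_add: "mdeg (s + t) = mdeg s + mdeg t"
  by (simp add: mdeg_def lookup_add sum.distrib)

lemma mdeg_single: "mdeg (Poly_Mapping.single (v :: 'n::finite) k) = k"
proof -
  have "mdeg (Poly_Mapping.single v k) = (\<Sum>w\<in>UNIV. if w = v then k else 0)"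
    unfolding mdeg_def by (rule sum.cong) (auto simp: lookup_single when_def)
  then show ?thesis by simp
qed

lemma mdvd_iff: "mdvd s t \<longleftrightarrow> (\<exists>r. t = s + r)"
proof
  assume "mdvd s t"
  then have "t = s + (t - s)"
    by (intro poly_mapping_eqI) (simp add: lookup_add lookup_minus mdvd_def)
  then show "\<exists>r. t = s + r" by blast
qed (auto simp: mdvd_def lookup_add)

lemma mpoly_sum_monomials:
  "p = (\<Sum>t\<in>Poly_Mapping.keys p. Poly_Mapping.single t (Poly_Mapping.lookup p t))"
proof (rule poly_mapping_eqI)
  fix a
  have "Poly_Mapping.lookup (\<Sum>t\<in>Poly_Mapping.keys p. Poly_Mapping.single t (Poly_Mapping.lookup p t)) a
    = (\<Sum>t\<in>Poly_Mapping.keys p. if t = a then Poly_Mapping.lookup p a else 0)"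
    by (simp add: lookup_sum lookup_single when_def cong: sum.cong if_cong)
  then show "Poly_Mapping.lookup p a =
     Poly_Mapping.lookup (\<Sum>t\<in>Poly_Mapping.keys p. Poly_Mapping.single t (Poly_Mapping.lookup p t)) a"
    by (simp add: in_keys_iff)
qed

lemma lookup_mon_times:
  fixes p :: "('n, 'k::field) mpoly"
  shows "Poly_Mapping.lookup (mon s * p) a =
    (if mdvd s a then Poly_Mapping.lookup p (a - s) else 0)"
proof -
  have "mon s * p = (\<Sum>t\<in>Poly_Mapping.keys p. Poly_Mapping.single (s + t) (Poly_Mapping.lookup p t))"
    by (subst mpoly_sum_monomials [of p]) (simp add: mon_def sum_distrib_left mult_single)
  then have *: "Poly_Mapping.lookup (mon s * p) a =
      (\<Sum>t\<in>Poly_Mapping.keys p. if s + t = a then Poly_Mapping.lookup p t else 0)"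
    by (simp add: lookup_sum lookup_single when_def)
  show ?thesis
  proof (cases "mdvd s a")
    case True
    then obtain r where r: "a = s + r" by (auto simp: mdvd_iff)
    show ?thesis using True * by (simp add: r in_keys_iff)
  next
    case False
    then show ?thesis unfolding * by (intro trans[OF sum.neutral]) (auto simp: mdvd_iff)
  qed
qed

lemma lookup_var_times:
  fixes p :: "('n, 'k::field) mpoly"
  shows "Poly_Mapping.lookup (var v * p) a =
    (if v \<in> Poly_Mapping.keys a then Poly_Mapping.lookup p (a - Poly_Mapping.single v 1) else 0)"
proof -
  have "mdvd (Poly_Mapping.single v 1) a \<longleftrightarrow> v \<in> Poly_Mapping.keys a"
    by (auto simp: mdvd_def lookup_single when_def in_keys_iff)
  then show ?thesis by (simp add: var_def lookup_mon_times)
qed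

lemma mon_times_mon: "mon s * mon t = (mon (s + t) :: ('n, 'k::field) mpoly)"
  by (simp add: mon_def mult_single)

lemma keys_ideal_gen_mon:
  fixes f :: "('n, 'k::field) mpoly"
  assumes "f \<in> ideal_gen (mon ` M)" "t \<in> Poly_Mapping.keys f"
  shows "\<exists>s\<in>M. mdvd s t"
  using assms
proof (induction arbitrary: t rule: ideal.span_induct_alt)
  case base
  then show ?case by simp
next
  case (step c x y)
  then obtain s where s: "s \<in> M" "x = mon s" by auto
  have "Poly_Mapping.lookup (mon s * c) t + Poly_Mapping.lookup y t \<noteq> 0"
    using step.prems s by (simp add: in_keys_iff lookup_add mult.commute)
  then consider "Poly_Mapping.lookup (mon s * c) t \<noteq> 0" | "Poly_Mapping.lookup y t \<noteq> 0"
    by fastforce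
  then show ?case
  proof cases
    case 1
    then show ?thesis using s by (auto simp: lookup_mon_times split: if_splits)
  next
    case 2
    then show ?thesis using step.IH by (simp add: in_keys_iff)
  qed
qed

lemma mon_in_ideal_gen_iff:
  "(mon t :: ('n, 'k::field) mpoly) \<in> ideal_gen (mon ` M) \<longleftrightarrow> (\<exists>s\<in>M. mdvd s t)"
proof
  assume "(mon t :: ('n, 'k) mpoly) \<in> ideal_gen (mon ` M)"
  moreover have "t \<in> Poly_Mapping.keys (mon t :: ('n, 'k) mpoly)"
    by (simp add: mon_def)
  ultimately show "\<exists>s\<in>M. mdvd s t" by (rule keys_ideal_gen_mon)
next
  assume "\<exists>s\<in>M. mdvd s t"
  then obtain s r where "s \<in> M" "t = s + r" by (auto simp: mdvd_iff)
  then show "(mon t :: ('n, 'k) mpoly) \<in> ideal_gen (mon ` M)"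
    by (metis add.commute ideal.span_base ideal.span_scale imageI mon_times_mon)
qed

lemma mdvd_refl: "mdvd t t"
  and mdvd_trans: "mdvd r s \<Longrightarrow> mdvd s t \<Longrightarrow> mdvd r t"
  and mdvd_antisym: "mdvd s t \<Longrightarrow> mdvd t s \<Longrightarrow> s = t"
  by (auto simp: mdvd_def intro: order_trans intro!: poly_mapping_eqI order_antisym)

lemma min_mons_dvd:
  fixes I :: "('n::finite, 'k::field) mpoly set"
  assumes "mon t \<in> I"
  shows "\<exists>s\<in>min_mons I. mdvd s t"
  using assms
proof (induction "mdeg t" arbitrary: t rule: less_induct)
  case less
  show ?case
  proof (cases "t \<in> min_mons I")
    case True
    then show ?thesis using mdvd_refl by blast
  next
    case False
    then obtain s where s: "mon s \<in> I" "mdvd s t" "s \<noteq> t"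
      using less.prems by (auto simp: min_mons_def)
    then obtain r where r: "t = s + r" by (auto simp: mdvd_iff)
    have "mdeg r \<noteq> 0"
    proof
      assume "mdeg r = 0"
      then have "r = 0" by (intro poly_mapping_eqI) (simp add: mdeg_def)
      then show False using r s by simp
    qed
    then have "mdeg s < mdeg t" by (simp add: r mdeg_add)
    then show ?thesis using less.hyps s mdvd_trans by blast
  qed
qed

lemma min_mons_unique:
  fixes I :: "('n::finite, 'k::field) mpoly set"
  assumes "monomial_ideal I"
  shows "ideal_gen (mon ` M) = I \<and> (\<forall>M'. M' \<subset> M \<longrightarrow> ideal_gen (mon ` M') \<noteq> I) \<longleftrightarrow> M = min_mons I"
proof -
  obtain N where N: "I = ideal_gen (mon ` N)" using assms by (auto simp: monomial_ideal_def)
  have gen: "ideal_gen (mon ` min_mons I) = I"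
  proof (rule ideal.span_subspace)
    show "mon ` min_mons I \<subseteq> I" by (auto simp: min_mons_def)
    show "is_ideal I" by (simp add: N)
    have "(mon ` N :: ('n, 'k) mpoly set) \<subseteq> ideal_gen (mon ` min_mons I)"
    proof
      fix f :: "('n, 'k) mpoly" assume "f \<in> mon ` N"
      then obtain t where "f = mon t" "mon t \<in> I" unfolding N using ideal.span_base by blast
      then show "f \<in> ideal_gen (mon ` min_mons I)"
        using min_mons_dvd mon_in_ideal_gen_iff by blast
    qed
    then show "I \<subseteq> ideal_gen (mon ` min_mons I)"
      unfolding N by (rule ideal.span_minimal) simp
  qed
  have sub: "min_mons I \<subseteq> M" if "ideal_gen (mon ` M) = I" for M
  proof
    fix t assume t: "t \<in> min_mons I"
    then have "(mon t :: ('n, 'k) mpoly) \<in> ideal_gen (mon ` M)" using that by (simp add: min_mons_def)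
    then obtain s where s: "s \<in> M" "mdvd s t" by (auto simp: mon_in_ideal_gen_iff)
    have "mon s \<in> I" using s(1) ideal.span_base that by blast
    then have "s = t" using t s by (auto simp: min_mons_def)
    then show "t \<in> M" using s by simp
  qed
  show ?thesis using gen sub by blast
qed

section \<open>Well-definedness of Tor\<close>

lemma koszul_diff_zero: "koszul_diff 0 = 0"
  by (simp add: koszul_diff_def fun_eq_iff)

lemma koszul_diff_add: "koszul_diff (c + d) = koszul_diff c + koszul_diff d"
  by (simp add: koszul_diff_def fun_eq_iff distrib_left sum.distrib)

lemma koszul_diff_scale: "koszul_diff (chain_scale a c) = chain_scale a (koszul_diff c)"
  by (simp add: koszul_diff_def fun_eq_iff chain_scale_def sum_distrib_left mult.left_commute)

lemma lookup_sign_times: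
  "Poly_Mapping.lookup ((- 1) ^ n * (p :: ('n, 'k::field) mpoly)) a = (- 1) ^ n * Poly_Mapping.lookup p a"
  by (induction n) (simp_all add: mult.assoc)

lemma lookup_koszul_diff:
  "Poly_Mapping.lookup (koszul_diff c G) a =
    (\<Sum>v\<in>Poly_Mapping.keys a - G. (- 1) ^ card {w\<in>G. w < v} *
       Poly_Mapping.lookup (c (insert v G)) (a - Poly_Mapping.single v 1))"
proof -
  have "Poly_Mapping.lookup (koszul_diff c G) a =
    (\<Sum>v\<in>- G. if v \<in> Poly_Mapping.keys a then (- 1) ^ card {w\<in>G. w < v} *
       Poly_Mapping.lookup (c (insert v G)) (a - Poly_Mapping.single v 1) else 0)"
    by (simp add: koszul_diff_def lookup_sum lookup_sign_times lookup_var_times if_distrib cong: if_cong)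
  also have "\<dots> = (\<Sum>v\<in>Poly_Mapping.keys a - G. (- 1) ^ card {w\<in>G. w < v} *
       Poly_Mapping.lookup (c (insert v G)) (a - Poly_Mapping.single v 1))"
    by (rule sum.mono_neutral_cong_right) auto
  finally show ?thesis .
qed

lemma koszul_diff_diff:
  fixes c :: "('n::{finite,linorder}, 'k::field) kchain"
  shows "koszul_diff (koszul_diff c) = 0"
proof
  fix G :: "'n set"
  let ?s = "\<lambda>v G. (- 1 :: ('n, 'k) mpoly) ^ card {w\<in>G. w < v}"
  let ?g = "\<lambda>v u. ?s v G * ?s u (insert v G) * (var v * var u * c (insert u (insert v G)))"
  have "koszul_diff (koszul_diff c) G = (\<Sum>v\<in>- G. \<Sum>u\<in>- insert v G. ?g v u)"
    by (simp add: koszul_diff_def sum_distrib_left mult.assoc mult.left_commute)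
  also have "\<dots> = (\<Sum>(v, u)\<in>Sigma (- G) (\<lambda>v. - insert v G). ?g v u)"
    by (rule sum.Sigma) auto
  also have "Sigma (- G) (\<lambda>v. - insert v G) = {(v, u). v \<notin> G \<and> u \<notin> G \<and> v < u} \<union> {(v, u). v \<notin> G \<and> u \<notin> G \<and> u < v}"
    by auto
  also have "(\<Sum>(v, u)\<in>\<dots>. ?g v u) =
     (\<Sum>(v, u)\<in>{(v, u). v \<notin> G \<and> u \<notin> G \<and> v < u}. ?g v u) + (\<Sum>(v, u)\<in>{(v, u). v \<notin> G \<and> u \<notin> G \<and> u < v}. ?g v u)"
    by (rule sum.union_disjoint) auto
  also have "(\<Sum>(v, u)\<in>{(v, u). v \<notin> G \<and> u \<notin> G \<and> u < v}. ?g v u) =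
     (\<Sum>(v, u)\<in>{(v, u). v \<notin> G \<and> u \<notin> G \<and> v < u}. ?g u v)"
    by (rule sum.reindex_bij_witness[of _ "\<lambda>(v, u). (u, v)" "\<lambda>(v, u). (u, v)"]) auto
  also have "\<dots> = (\<Sum>(v, u)\<in>{(v, u). v \<notin> G \<and> u \<notin> G \<and> v < u}. - ?g v u)"
  proof (rule sum.cong [OF refl], clarify)
    fix v u assume vu: "v \<notin> G" "u \<notin> G" "v < u"
    have "{w \<in> insert v G. w < u} = insert v {w\<in>G. w < u}" using vu by auto
    then have 1: "?s u (insert v G) = - ?s u G" using vu by simp
    have "{w \<in> insert u G. w < v} = {w\<in>G. w < v}" using vu by auto
    then have 2: "?s v (insert u G) = ?s v G" by simp
    show "?g u v = - ?g v u"
      unfolding 1 2 by (simp add: insert_commute mult.commute mult.left_commute)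
  qed
  finally show "koszul_diff (koszul_diff c) G = 0 G" by (simp add: sum_negf split_def)
qed

lemma koszul_diff_chains:
  fixes c :: "('n::{finite,linorder}, 'k::field) kchain"
  assumes "is_ideal I" "c \<in> koszul_chains (Suc i) j I"
  shows "koszul_diff c \<in> koszul_chains i j I"
  unfolding koszul_chains_def
proof (clarify, intro conjI ballI impI)
  fix G
  have c: "c F \<in> I" "card F \<noteq> Suc i \<Longrightarrow> c F = 0" "t \<in> Poly_Mapping.keys (c F) \<Longrightarrow> mdeg t + Suc i = j"
    for F t using assms(2) by (auto simp: koszul_chains_def)
  show "koszul_diff c G \<in> I" unfolding koszul_diff_def
    by (intro ideal.subspace_sum [OF assms(1)] ideal.subspace_scale [OF assms(1)] c)
  show "koszul_diff c G = 0" if "card G \<noteq> i"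
    unfolding koszul_diff_def using that by (intro sum.neutral) (auto simp: c)
  fix t assume "t \<in> Poly_Mapping.keys (koszul_diff c G)"
  then have "Poly_Mapping.lookup (koszul_diff c G) t \<noteq> 0" by (simp add: in_keys_iff)
  then obtain v where v: "v \<in> Poly_Mapping.keys t"
    "Poly_Mapping.lookup (c (insert v G)) (t - Poly_Mapping.single v 1) \<noteq> 0"
    unfolding lookup_koszul_diff by (metis (no_types, lifting) DiffD1 mult_zero_right sum.neutral)
  have "t = (t - Poly_Mapping.single v 1) + Poly_Mapping.single v 1"
    using v(1) by (intro poly_mapping_eqI) (auto simp: lookup_add lookup_minus lookup_single when_def in_keys_iff)
  then have "mdeg t = Suc (mdeg (t - Poly_Mapping.single v 1))"
    by (metis mdeg_add mdeg_single Suc_eq_plus1)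
  then show "mdeg t + i = j" using c(3)[of "t - Poly_Mapping.single v 1" "insert v G"] v(2)
    by (simp add: in_keys_iff)
qed

lemma subspace_koszul_chains:
  assumes "is_ideal I"
  shows "kchain.subspace (koszul_chains i j I)"
proof (rule kchain.subspaceI)
  show "0 \<in> koszul_chains i j I"
    using ideal.subspace_0[OF assms] by (simp add: koszul_chains_def)
  fix c d assume "c \<in> koszul_chains i j I" "d \<in> koszul_chains i j I"
  then show "c + d \<in> koszul_chains i j I"
    using keys_add[of "c _" "d _"] ideal.subspace_add[OF assms] by (fastforce simp: koszul_chains_def)
next
  fix c a assume c: "c \<in> koszul_chains i j I"
  have "Poly_Mapping.single 0 a * p = Poly_Mapping.map ((*) a) p" for p :: "('a,'b) mpoly"
    by (simp add: mult_map_scale_conv_mult)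
  then have "Poly_Mapping.keys (Poly_Mapping.single 0 a * p) \<subseteq> Poly_Mapping.keys p" for p :: "('a,'b) mpoly"
    by (auto simp: in_keys_iff Poly_Mapping.map.rep_eq when_def)
  then show "chain_scale a c \<in> koszul_chains i j I"
    using c ideal.subspace_scale[OF assms] unfolding koszul_chains_def chain_scale_def by fastforce
qed

lemma subspace_koszul_cycles:
  assumes "is_ideal I"
  shows "kchain.subspace (koszul_cycles i j I)"
  using subspace_koszul_chains[OF assms, of i j] unfolding koszul_cycles_def kchain.subspace_def
  by (auto simp: koszul_diff_zero koszul_diff_add koszul_diff_scale)

lemma subspace_koszul_boundaries:
  assumes "is_ideal I"
  shows "kchain.subspace (koszul_boundaries i j I)"
  using subspace_koszul_chains[OF assms, of "Suc i" j] unfolding koszul_boundaries_def kchain.subspace_def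
  by (auto simp flip: koszul_diff_add koszul_diff_scale) (metis image_eqI koszul_diff_zero)

lemma koszul_boundaries_subset_cycles:
  "is_ideal I \<Longrightarrow> koszul_boundaries i j I \<subseteq> koszul_cycles i j I"
  by (auto simp: koszul_boundaries_def koszul_cycles_def koszul_diff_diff koszul_diff_chains)

lemma finite_monomials_mdeg: "finite {t :: 'n::finite monomial. mdeg t \<le> j}"
proof (rule finite_imageD)
  have "Poly_Mapping.lookup ` {t :: 'n monomial. mdeg t \<le> j} \<subseteq> Pi\<^sub>E UNIV (\<lambda>_. {..j})"
  proof (clarsimp simp: PiE_def)
    fix t :: "'n monomial" and v assume "mdeg t \<le> j"
    moreover have "Poly_Mapping.lookup t v \<le> mdeg t"
      unfolding mdeg_def by (rule member_le_sum) auto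
    ultimately show "Poly_Mapping.lookup t v \<le> j" by simp
  qed
  then show "finite (Poly_Mapping.lookup ` {t :: 'n monomial. mdeg t \<le> j})"
    by (rule finite_subset) (simp add: finite_PiE)
qed (simp add: inj_on_def)

lemma sum_fun_apply: "sum f A x = (\<Sum>a\<in>A. f a x)"
  by (induction A rule: infinite_finite_induct) auto

lemma koszul_chains_finite_dim:
  fixes I :: "('n::finite, 'k::field) mpoly set"
  shows "\<exists>W. finite W \<and> koszul_chains i j I \<subseteq> kchain.span W"
proof -
  define e :: "'n set \<Rightarrow> 'n monomial \<Rightarrow> ('n, 'k) kchain"
    where "e F t = (\<lambda>G. if G = F then mon t else 0)" for F t
  define W where "W = (\<Union>F. e F ` {t. mdeg t \<le> j})"
  have "c \<in> kchain.span W" if c: "c \<in> koszul_chains i j I" for c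
  proof -
    have W: "e F t \<in> kchain.span W" if "t \<in> Poly_Mapping.keys (c F)" for F t
    proof (rule kchain.span_base)
      have "mdeg t + i = j" using c that by (simp add: koszul_chains_def)
      then have "t \<in> {t. mdeg t \<le> j}" by simp
      then show "e F t \<in> W" unfolding W_def by blast
    qed
    have 1: "(\<Sum>t\<in>Poly_Mapping.keys (c F). chain_scale (Poly_Mapping.lookup (c F) t) (e F t) G)
        = (if F = G then c G else 0)" for F G
    proof (cases "F = G")
      case True
      then show ?thesis
        by (simp add: chain_scale_def e_def mon_def mult_single flip: mpoly_sum_monomials)
    next
      case False
      then have "e F t G = 0" for t by (simp add: e_def)
      then show ?thesis using False by (simp add: chain_scale_def)
    qed
    have "(\<Sum>F\<in>UNIV. \<Sum>t\<in>Poly_Mapping.keys (c F). chain_scale (Poly_Mapping.lookup (c F) t) (e F t)) G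
        = c G" for G
      by (simp only: sum_fun_apply 1) simp
    then have "(\<Sum>F\<in>UNIV. \<Sum>t\<in>Poly_Mapping.keys (c F). chain_scale (Poly_Mapping.lookup (c F) t) (e F t)) = c"
      by (rule ext)
    moreover have "(\<Sum>F\<in>UNIV. \<Sum>t\<in>Poly_Mapping.keys (c F). chain_scale (Poly_Mapping.lookup (c F) t) (e F t))
        \<in> kchain.span W"
      by (intro kchain.span_sum kchain.span_scale W)
    ultimately show ?thesis by (simp only:)
  qed
  moreover have "finite W" by (simp add: W_def finite_monomials_mdeg)
  ultimately show ?thesis by blast
qed

lemma tor_dim_eq_0_iff:
  fixes I :: "('n::{finite,linorder}, 'k::field) mpoly set"
  assumes "is_ideal I"
  shows "tor_dim i j I = 0 \<longleftrightarrow> koszul_cycles i j I = koszul_boundaries i j I"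
proof
  assume "koszul_cycles i j I = koszul_boundaries i j I"
  then show "tor_dim i j I = 0" by (simp add: tor_dim_def)
next
  let ?Z = "koszul_cycles i j I" and ?B = "koszul_boundaries i j I"
  assume "tor_dim i j I = 0"
  then have le: "kchain.dim ?Z \<le> kchain.dim ?B" by (simp add: tor_dim_def)
  obtain W where W: "finite W" "koszul_chains i j I \<subseteq> kchain.span W"
    using koszul_chains_finite_dim by blast
  have ZW: "?Z \<subseteq> kchain.span W" using W by (auto simp: koszul_cycles_def)
  obtain b where b: "b \<subseteq> ?B" "kchain.independent b" "?B \<subseteq> kchain.span b" "card b = kchain.dim ?B"
    using kchain.basis_exists by blast
  have bZ: "b \<subseteq> ?Z" using b koszul_boundaries_subset_cycles[OF assms] by blast
  obtain z where z: "b \<subseteq> z" "z \<subseteq> ?Z" "kchain.independent z" "?Z \<subseteq> kchain.span z"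
    using kchain.maximal_independent_subset_extend[OF bZ b(2)] by blast
  have "card z = kchain.dim ?Z" using z by (intro kchain.basis_card_eq_dim)
  moreover have "finite z"
    using z ZW W(1) by (meson kchain.independent_span_bound order_trans)
  ultimately have "b = z" using le b(4) z(1) by (metis card_seteq)
  then have "?Z \<subseteq> kchain.span ?B" using z(4) b(1) kchain.span_mono by blast
  moreover have "kchain.span ?B = ?B"
    using subspace_koszul_boundaries[OF assms] by (simp only: kchain.span_eq_iff)
  ultimately show "?Z = ?B"
    using koszul_boundaries_subset_cycles[OF assms, of i j] by simp
qed


text \<open>
  A contracting homotopy in all nonzero multidegrees: it sends \<open>x\<^sup>a e\<^sub>F\<close> to
  \<open>(x\<^sup>a / x\<^sub>m) e\<^bsub>F \<union> {m}\<^esub>\<close> if the least element \<open>m\<close> of the union of \<open>F\<close> with the support of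
  \<open>a\<close> is not in \<open>F\<close>, and to zero otherwise.
\<close>

definition koszul_homotopy :: "('n::{finite,linorder}, 'k::field) kchain \<Rightarrow> ('n, 'k) kchain" where
  "koszul_homotopy c = (\<lambda>F. Abs_poly_mapping (\<lambda>a.
     if F \<noteq> {} \<and> (\<forall>w\<in>Poly_Mapping.keys a. Min F \<le> w)
     then Poly_Mapping.lookup (c (F - {Min F})) (a + Poly_Mapping.single (Min F) 1) else 0))"

lemma lookup_koszul_homotopy:
  "Poly_Mapping.lookup (koszul_homotopy c F) a =
    (if F \<noteq> {} \<and> (\<forall>w\<in>Poly_Mapping.keys a. Min F \<le> w)
     then Poly_Mapping.lookup (c (F - {Min F})) (a + Poly_Mapping.single (Min F) 1) else 0)"
proof -
  let ?p = "c (F - {Min F})" and ?x = "Poly_Mapping.single (Min F) (1::nat)"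
  have "finite ((\<lambda>a. a + ?x) -` Poly_Mapping.keys ?p)"
    by (rule finite_vimageI) (auto intro: injI)
  then have "finite {a. (if F \<noteq> {} \<and> (\<forall>w\<in>Poly_Mapping.keys a. Min F \<le> w)
     then Poly_Mapping.lookup ?p (a + ?x) else 0) \<noteq> 0}"
    by (rule finite_subset[rotated]) (auto simp: in_keys_iff split: if_splits)
  then show ?thesis
    unfolding koszul_homotopy_def by (subst lookup_Abs_poly_mapping) auto
qed

lemma keys_minus_single_insert:
  "v \<in> Poly_Mapping.keys a \<Longrightarrow>
    insert v (Poly_Mapping.keys (a - Poly_Mapping.single v (1::nat))) = Poly_Mapping.keys a"
  by (auto simp: in_keys_iff lookup_minus lookup_single when_def split: if_splits)

lemma minus_single_add:
  fixes a :: "'n monomial"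
  assumes "v \<in> Poly_Mapping.keys a"
  shows "a - Poly_Mapping.single v 1 + Poly_Mapping.single u 1 = a + Poly_Mapping.single u 1 - Poly_Mapping.single v 1"
  using assms
  by (intro poly_mapping_eqI) (auto simp: in_keys_iff lookup_add lookup_minus lookup_single when_def)

lemma koszul_homotopy:
  fixes c :: "('n::{finite,linorder}, 'k::field) kchain"
  assumes ne: "Poly_Mapping.keys a \<union> G \<noteq> {}"
  shows "Poly_Mapping.lookup (koszul_diff (koszul_homotopy c) G) a +
    Poly_Mapping.lookup (koszul_homotopy (koszul_diff c) G) a = Poly_Mapping.lookup (c G) a"
proof -
  define m where "m = Min (Poly_Mapping.keys a \<union> G)"
  have fin: "finite (Poly_Mapping.keys a \<union> G)" by simp
  have m_in: "m \<in> Poly_Mapping.keys a \<union> G" unfolding m_def using Min_in[OF fin ne] .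
  have m_le: "m \<le> w" if "w \<in> Poly_Mapping.keys a \<union> G" for w
    unfolding m_def using Min_le[OF fin that] .
  let ?s = "\<lambda>v G. (- 1 :: 'k) ^ card {w\<in>G. w < v}"
  let ?x = "\<lambda>v. Poly_Mapping.single v (1::nat)"
  let ?L = "Poly_Mapping.lookup" and ?K = "Poly_Mapping.keys"
  have cond: "(\<forall>w\<in>?K (a - ?x v). Min (insert v G) \<le> w) \<longleftrightarrow> m \<in> insert v G"
    (is "?l \<longleftrightarrow> ?r") if v: "v \<in> ?K a" for v
  proof -
    have un: "?K (a - ?x v) \<union> insert v G = ?K a \<union> G"
      using keys_minus_single_insert[OF v] v by blast
    have Mi: "Min (insert v G) \<in> insert v G" by (intro Min_in) auto
    have mle: "m \<le> Min (insert v G)" using Mi un m_le by blast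
    show ?thesis
    proof
      assume ?l
      moreover have "\<forall>w\<in>insert v G. Min (insert v G) \<le> w" by (auto intro: Min_le)
      ultimately have "\<forall>w\<in>?K a \<union> G. Min (insert v G) \<le> w" using un by blast
      then have "Min (insert v G) = m" using m_in mle by (meson order_antisym)
      then show ?r using Mi by simp
    next
      assume ?r
      then have "Min (insert v G) \<le> m" by (intro Min_le) auto
      moreover have "m \<le> w" if "w \<in> ?K (a - ?x v)" for w
        using that m_le[of w] un by blast
      ultimately show ?l by (meson order_trans)
    qed
  qed
  have dh: "?L (koszul_diff (koszul_homotopy c) G) a = (\<Sum>v\<in>?K a - G. ?s v G *
     (if m \<in> insert v G then ?L (c (insert v G - {m})) (a - ?x v + ?x m) else 0))"
    unfolding lookup_koszul_diff
  proof (rule sum.cong [OF refl])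
    fix v assume v: "v \<in> ?K a - G"
    have "Min (insert v G) = m" if "m \<in> insert v G"
      using v that m_le by (intro Min_eqI) auto
    then show "?s v G * ?L (koszul_homotopy c (insert v G)) (a - ?x v) = ?s v G *
     (if m \<in> insert v G then ?L (c (insert v G - {m})) (a - ?x v + ?x m) else 0)"
      using v cond[of v] by (simp add: lookup_koszul_homotopy)
  qed
  show ?thesis
  proof (cases "m \<in> G")
    case False
    then have mk: "m \<in> ?K a" using m_in by blast
    have "?L (koszul_homotopy (koszul_diff c) G) a = 0"
    proof (cases "G = {}")
      case True
      then show ?thesis by (simp add: lookup_koszul_homotopy)
    next
      case ne: False
      then have "Min G \<in> G" by (intro Min_in) auto
      then have "m < Min G" using False m_le by (metis UnCI order_le_imp_less_or_eq)
      then show ?thesis using mk by (auto simp: lookup_koszul_homotopy)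
    qed
    moreover have "?L (koszul_diff (koszul_homotopy c) G) a = ?L (c G) a"
    proof -
      have "?L (koszul_diff (koszul_homotopy c) G) a = (\<Sum>v\<in>?K a - G. if v = m then
        ?s m G * ?L (c (insert m G - {m})) (a - ?x m + ?x m) else 0)"
        unfolding dh using False by (intro sum.cong) auto
      also have "\<dots> = ?s m G * ?L (c (insert m G - {m})) (a - ?x m + ?x m)"
        using mk False by simp
      also have "{w\<in>G. w < m} = {}" using m_le by force
      also have "a - ?x m + ?x m = a" using minus_single_add[OF mk, of m] by simp
      finally show ?thesis using False by simp
    qed
    ultimately show ?thesis by simp
  next
    case True
    then have MG: "Min G = m" using m_le by (intro Min_eqI) auto
    let ?G = "G - {m}"
    have ins: "insert m ?G = G" using True by blast
    have K: "?K (a + ?x m) - ?G = insert m (?K a - G)"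
      using True by (auto simp: in_keys_iff lookup_add lookup_single when_def)
    have "?L (koszul_homotopy (koszul_diff c) G) a = ?L (koszul_diff c ?G) (a + ?x m)"
      using True MG m_le by (auto simp: lookup_koszul_homotopy)
    also have "\<dots> = ?s m ?G * ?L (c (insert m ?G)) (a + ?x m - ?x m) +
      (\<Sum>v\<in>?K a - G. ?s v ?G * ?L (c (insert v ?G)) (a + ?x m - ?x v))"
      unfolding lookup_koszul_diff K using True by (subst sum.insert) auto
    also have "{w\<in>?G. w < m} = {}" using m_le by force
    also have "(\<Sum>v\<in>?K a - G. ?s v ?G * ?L (c (insert v ?G)) (a + ?x m - ?x v)) =
      - ?L (koszul_diff (koszul_homotopy c) G) a"
      unfolding dh sum_negf [symmetric]
    proof (rule sum.cong [OF refl])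
      fix v assume v: "v \<in> ?K a - G"
      then have "m < v" using True m_le by (metis DiffD1 DiffD2 UnCI order_le_imp_less_or_eq)
      then have "{w\<in>G. w < v} = insert m {w\<in>?G. w < v}" using True by auto
      then have "?s v G = - ?s v ?G" by simp
      moreover have "insert v G - {m} = insert v ?G" using \<open>m < v\<close> by auto
      ultimately show "?s v ?G * ?L (c (insert v ?G)) (a + ?x m - ?x v) = - (?s v G *
        (if m \<in> insert v G then ?L (c (insert v G - {m})) (a - ?x v + ?x m) else 0))"
        using True v minus_single_add[of v a m] by simp
    qed
    finally show ?thesis using ins by simp
  qed
qed

lemma koszul_homotopy_chains:
  assumes "c \<in> koszul_chains i j UNIV"
  shows "koszul_homotopy c \<in> koszul_chains (Suc i) j UNIV"
  unfolding koszul_chains_def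
proof (clarify, intro conjI ballI impI UNIV_I)
  fix F
  have *: "card F = Suc i \<and> mdeg t + Suc i = j" if "Poly_Mapping.lookup (koszul_homotopy c F) t \<noteq> 0" for t
  proof -
    have F: "F \<noteq> {}" and nz: "Poly_Mapping.lookup (c (F - {Min F})) (t + Poly_Mapping.single (Min F) 1) \<noteq> 0"
      using that by (auto simp: lookup_koszul_homotopy split: if_splits)
    have "c (F - {Min F}) \<noteq> 0" using nz by auto
    then have "card (F - {Min F}) = i" using assms by (auto simp: koszul_chains_def)
    moreover have "mdeg (t + Poly_Mapping.single (Min F) 1) + i = j"
      using assms nz by (auto simp: koszul_chains_def in_keys_iff)
    ultimately show ?thesis
      using F card_Suc_Diff1[of F "Min F"] Min_in[of F] by (simp add: mdeg_add mdeg_single)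
  qed
  show "koszul_homotopy c F = 0" if "card F \<noteq> Suc i"
    using * that by (intro poly_mapping_eqI) auto
  show "mdeg t + Suc i = j" if "t \<in> Poly_Mapping.keys (koszul_homotopy c F)" for t
    using * that by (simp add: in_keys_iff)
qed

text \<open>
  With coefficients in the whole ring, the Koszul complex is exact except in homological and
  internal degree zero, where its homology is \<open>K\<close>.
\<close>

lemma koszul_resolution:
  "koszul_cycles i j (UNIV :: ('n::{finite,linorder}, 'k::field) mpoly set) =
    (if i = 0 \<and> j = 0 then range (\<lambda>a F. if F = {} then Poly_Mapping.single 0 a else 0)
     else koszul_boundaries i j UNIV)"
  "koszul_boundaries 0 0 (UNIV :: ('n::{finite,linorder}, 'k::field) mpoly set) = {0}"
proof -
  show "koszul_boundaries 0 0 (UNIV :: ('n, 'k) mpoly set) = {0}"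
  proof -
    have "koszul_chains (Suc 0) 0 (UNIV :: ('n, 'k) mpoly set) = {0}"
      by (auto simp: koszul_chains_def fun_eq_iff)
    then show ?thesis by (simp add: koszul_boundaries_def koszul_diff_zero)
  qed
  show "koszul_cycles i j (UNIV :: ('n, 'k) mpoly set) =
    (if i = 0 \<and> j = 0 then range (\<lambda>a F. if F = {} then Poly_Mapping.single 0 a else 0)
     else koszul_boundaries i j UNIV)"
  proof (cases "i = 0 \<and> j = 0")
    case True
    have "c \<in> range (\<lambda>a F. if F = {} then Poly_Mapping.single 0 a else 0)"
      if "c \<in> koszul_cycles 0 0 UNIV" for c :: "('n, 'k) kchain"
    proof (intro image_eqI ext)
      have c: "F \<noteq> {} \<Longrightarrow> c F = 0" "\<forall>t\<in>Poly_Mapping.keys (c F). mdeg t = 0" for F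
        using that by (auto simp: koszul_cycles_def koszul_chains_def)
      have "Poly_Mapping.lookup (c {}) t = 0" if "t \<noteq> 0" for t
      proof -
        have "mdeg t \<noteq> 0" using that by (auto simp: mdeg_def poly_mapping_eq_iff fun_eq_iff)
        then show ?thesis using c(2) by (metis in_keys_iff)
      qed
      then show "c F = (if F = {} then Poly_Mapping.single 0 (Poly_Mapping.lookup (c {}) 0) else 0)" for F
        using c(1) by (auto intro!: poly_mapping_eqI simp: lookup_single when_def)
    qed simp
    moreover have "(\<lambda>F. if F = {} then Poly_Mapping.single 0 a else 0) \<in> koszul_cycles 0 0 (UNIV :: ('n, 'k) mpoly set)"
      for a :: 'k
      by (auto simp: koszul_cycles_def koszul_chains_def koszul_diff_def fun_eq_iff mdeg_def split: if_splits)
    ultimately show ?thesis using True by auto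
  next
    case False
    have "c \<in> koszul_boundaries i j UNIV" if c: "c \<in> koszul_cycles i j UNIV" for c :: "('n, 'k) kchain"
      unfolding koszul_boundaries_def
    proof (intro image_eqI ext poly_mapping_eqI)
      show "koszul_homotopy c \<in> koszul_chains (Suc i) j UNIV"
        using c by (intro koszul_homotopy_chains) (simp add: koszul_cycles_def)
      fix G a
      show "Poly_Mapping.lookup (c G) a = Poly_Mapping.lookup (koszul_diff (koszul_homotopy c) G) a"
      proof (cases "Poly_Mapping.keys a \<union> G = {}")
        case True
        then have "mdeg a = 0" "card G = 0" by (auto simp: mdeg_def in_keys_iff)
        then have "Poly_Mapping.lookup (c G) a = 0"
        proof -
          have "c G \<noteq> 0 \<longrightarrow> card G = i" "Poly_Mapping.lookup (c G) a \<noteq> 0 \<longrightarrow> mdeg a + i = j"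
            using c by (auto simp: koszul_cycles_def koszul_chains_def in_keys_iff)
          then show ?thesis using False \<open>mdeg a = 0\<close> \<open>card G = 0\<close> by auto
        qed
        then show ?thesis using True by (simp add: lookup_koszul_diff)
      next
        case False
        have "koszul_diff c = 0" using c by (simp add: koszul_cycles_def)
        then have "Poly_Mapping.lookup (koszul_homotopy (koszul_diff c) G) a = 0"
          by (simp add: lookup_koszul_homotopy)
        then show ?thesis using koszul_homotopy[OF False, of c] by simp
      qed
    qed
    then show ?thesis using False koszul_boundaries_subset_cycles[OF ideal.subspace_UNIV] by auto
  qed
qed

end

theory Submission
  imports Defs
begin

text \<open>
  An ideal generated by squarefree monomials of degree \<open>d\<close> is given by a family \<open>\<G>\<close> of sets of \<open>d\<close>
  variables, the supports of its generators, and its gradient ideals belong in the same way to the iterated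
  shadows of \<open>\<G>\<close> (\<open>gradient_power_face_ideal\<close>).

  Tor is computed one multidegree at a time.  In each of them the Koszul complex is the chain complex
  of a simplicial complex, which is a cone unless the multidegree is squarefree.  So \<open>I\<close> has linear
  resolution if and only if, for every set \<open>W\<close> of variables, the complex of the subsets of \<open>W\<close> whose complement
  in \<open>W\<close> contains a generator is exact in all positions below \<open>card W - d\<close>
  (\<open>has_linear_resolution_face_ideal_iff\<close>).  All topological arguments below take place in these complexes.

  Vertex splittable ideals have linear quotients: list the generators divisible by the splitting variable first.
  Ideals with linear quotients have linear resolution: each new generator in the list adds an interval of
  faces, which can be collapsed unless it is a single face of the top size.  An ideal with differential
  linear resolution has linear resolution, as it is its own gradient ideal of order zero.  What remains
  is that for the given degrees a linear resolution of \<open>I\<close> makes \<open>I\<close> and all its gradient ideals vertex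
  splittable (\<open>vertex_splittable_shadows\<close>); being vertex splittable, they have linear resolution.

  Gradient ideals generated by variables are harmless.  If \<open>d = 2\<close>, then \<open>\<G>\<close> is a graph.  Linear resolution excludes
  induced cycles of length four or more from the complementary graph, so this graph is chordal and has simplicial vertices, and
  splitting at such vertices one after the other is possible (\<open>vertex_splittable_edge_ideal\<close>).  If \<open>d\<close> is at
  least \<open>n - 2\<close>, then the complements of the generators have at most two elements, and the complements
  belonging to the gradient ideals are the larger sets that contain one of them.  The only case in which this
  is restrictive is \<open>d = n - 2\<close>, where the complements form a graph, and linear resolution means that this graph
  is connected.  Then the gradient ideals can be split at a vertex that does not disconnect the graph
  (\<open>vertex_splittable_complements_connected\<close>).
\<close>

section \<open>Squarefree monomials and families of sets\<close>

lemma single_eq_scale_mon: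
  "Poly_Mapping.single t (a :: 'k::field) = Poly_Mapping.single 0 a * mon t"
  by (simp add: mon_def mult_single)

lemma in_ideal_gen_mon_iff:
  fixes f :: "('n, 'k::field) mpoly"
  shows "f \<in> ideal_gen (mon ` M) \<longleftrightarrow> (\<forall>t\<in>Poly_Mapping.keys f. \<exists>s\<in>M. mdvd s t)"
proof
  assume *: "\<forall>t\<in>Poly_Mapping.keys f. \<exists>s\<in>M. mdvd s t"
  have "(\<Sum>t\<in>Poly_Mapping.keys f. Poly_Mapping.single t (Poly_Mapping.lookup f t)) \<in> ideal_gen (mon ` M)"
    by (subst single_eq_scale_mon)
      (intro ideal.span_sum ideal.span_scale, use * in \<open>simp add: mon_in_ideal_gen_iff\<close>)
  then show "f \<in> ideal_gen (mon ` M)" by (simp flip: mpoly_sum_monomials)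
qed (use keys_ideal_gen_mon in blast)

lemma in_monomial_ideal_iff:
  assumes "monomial_ideal I"
  shows "f \<in> I \<longleftrightarrow> (\<forall>t\<in>Poly_Mapping.keys f. mon t \<in> I)"
proof -
  obtain M where "I = ideal_gen (mon ` M)" using assms by (auto simp: monomial_ideal_def)
  then show ?thesis by (simp add: in_ideal_gen_mon_iff[of f] mon_in_ideal_gen_iff)
qed

lemma monomial_ideal_ideal_gen [simp]: "monomial_ideal (ideal_gen (mon ` M))"
  by (auto simp: monomial_ideal_def)

lemma is_ideal_monomial_ideal: "monomial_ideal I \<Longrightarrow> is_ideal I"
  by (auto simp: monomial_ideal_def)

lemma ideal_gen_min_mons:
  fixes I :: "('n::finite, 'k::field) mpoly set"
  assumes "monomial_ideal I"
  shows "ideal_gen (mon ` min_mons I) = I"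
  using min_mons_unique[OF assms, of "min_mons I"] by blast

lemma lookup_single_times:
  "Poly_Mapping.lookup (Poly_Mapping.single 0 a * (p :: ('n, 'k::field) mpoly)) t = a * Poly_Mapping.lookup p t"
proof -
  have "Poly_Mapping.single 0 a * p = Poly_Mapping.map ((*) a) p"
    by (simp add: mult_map_scale_conv_mult)
  then show ?thesis by (simp add: Poly_Mapping.map.rep_eq when_def)
qed

definition sqf :: "'n::finite set \<Rightarrow> 'n monomial" where
  "sqf F = (\<Sum>v\<in>F. Poly_Mapping.single v 1)"

lemma lookup_sqf [simp]: "Poly_Mapping.lookup (sqf F) v = (if v \<in> F then 1 else 0)"
  by (simp add: sqf_def lookup_sum lookup_single when_def)

lemma keys_sqf [simp]: "Poly_Mapping.keys (sqf F) = F"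
  by (auto simp: in_keys_iff split: if_splits)

lemma sqf_eq_iff [simp]: "sqf F = sqf G \<longleftrightarrow> F = G"
  by (metis keys_sqf)

lemma sqf_insert: "v \<notin> F \<Longrightarrow> sqf (insert v F) = Poly_Mapping.single v 1 + sqf F"
  by (simp add: sqf_def)

lemma mdeg_sqf [simp]: "mdeg (sqf F) = card F"
  by (simp add: mdeg_def sum.If_cases)

lemma mdvd_sqf: "mdvd (sqf F) t \<longleftrightarrow> F \<subseteq> Poly_Mapping.keys t"
  by (auto simp: mdvd_def in_keys_iff Suc_le_eq)

lemma squarefree_eq_sqf: "\<forall>v. Poly_Mapping.lookup t v \<le> 1 \<Longrightarrow> t = sqf (Poly_Mapping.keys t)"
  by (intro poly_mapping_eqI) (auto simp: in_keys_iff le_Suc_eq, metis not_gr_zero)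

lemma sqf_diff_single: "sqf F - Poly_Mapping.single v 1 = sqf (F - {v})"
  by (intro poly_mapping_eqI) (auto simp: lookup_minus lookup_single when_def)

text \<open>
  The edge ideal convention: the sets are the supports of the generators, so the quotient ring is the
  Stanley--Reisner ring of the complex of those sets that contain no member of \<open>\<G>\<close>.
\<close>

definition face_ideal :: "'n::finite set set \<Rightarrow> ('n, 'k::field) mpoly set" where
  "face_ideal \<G> = ideal_gen (mon ` sqf ` \<G>)"

definition uniform :: "nat \<Rightarrow> 'n::finite set set \<Rightarrow> bool" where
  "uniform d \<G> \<longleftrightarrow> (\<forall>A\<in>\<G>. card A = d)"

lemma mon_in_face_ideal:
  "(mon t :: ('n::finite, 'k::field) mpoly) \<in> face_ideal \<G> \<longleftrightarrow> (\<exists>A\<in>\<G>. A \<subseteq> Poly_Mapping.keys t)"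
  by (simp add: face_ideal_def mon_in_ideal_gen_iff mdvd_sqf)

lemma in_face_ideal:
  "(f :: ('n::finite, 'k::field) mpoly) \<in> face_ideal \<G> \<longleftrightarrow>
     (\<forall>t\<in>Poly_Mapping.keys f. \<exists>A\<in>\<G>. A \<subseteq> Poly_Mapping.keys t)"
  by (simp add: face_ideal_def in_ideal_gen_mon_iff mdvd_sqf)

lemma monomial_face_ideal [simp]: "monomial_ideal (face_ideal \<G>)"
  by (simp add: face_ideal_def)

lemma is_ideal_face_ideal [simp]: "is_ideal (face_ideal \<G>)"
  by (simp add: is_ideal_monomial_ideal)

text \<open>
  Sets of equal size are incomparable, so no generator is redundant.
\<close>

lemma min_mons_face_ideal:
  assumes "uniform d \<G>"
  shows "min_mons (face_ideal \<G> :: ('n::finite, 'k::field) mpoly set) = sqf ` \<G>"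
proof (intro set_eqI iffI)
  fix t assume t: "t \<in> min_mons (face_ideal \<G> :: ('n, 'k) mpoly set)"
  then obtain A where A: "A \<in> \<G>" "A \<subseteq> Poly_Mapping.keys t"
    by (auto simp: min_mons_def mon_in_face_ideal)
  then have "(mon (sqf A) :: ('n, 'k) mpoly) \<in> face_ideal \<G>" "mdvd (sqf A) t"
    by (auto simp: mon_in_face_ideal mdvd_sqf)
  then have "sqf A = t" using t by (auto simp: min_mons_def)
  then show "t \<in> sqf ` \<G>" using A by blast
next
  fix t assume "t \<in> sqf ` \<G>"
  then obtain A where A: "A \<in> \<G>" "t = sqf A" by blast
  have "s = t" if s: "mon s \<in> (face_ideal \<G> :: ('n, 'k) mpoly set)" "mdvd s t" for s
  proof -
    obtain B where B: "B \<in> \<G>" "B \<subseteq> Poly_Mapping.keys s" using s by (auto simp: mon_in_face_ideal)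
    have le: "Poly_Mapping.lookup s v \<le> (if v \<in> A then 1 else 0)" for v
      using s A by (auto simp: mdvd_def)
    have "Poly_Mapping.keys s \<subseteq> A"
    proof
      fix v assume "v \<in> Poly_Mapping.keys s"
      then show "v \<in> A" using le[of v] by (simp add: in_keys_iff split: if_splits)
    qed
    then have "B = A" using B A assms by (metis card_subset_eq finite order_trans uniform_def)
    then have "Poly_Mapping.keys s = A" using \<open>Poly_Mapping.keys s \<subseteq> A\<close> B by blast
    moreover have "s = sqf (Poly_Mapping.keys s)"
      using le by (intro squarefree_eq_sqf) (metis One_nat_def le_SucI le_zero_eq order_refl)
    ultimately show ?thesis using A by simp
  qed
  then show "t \<in> min_mons (face_ideal \<G> :: ('n, 'k) mpoly set)"
    using A by (auto simp: min_mons_def mon_in_face_ideal)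
qed

lemma squarefree_monomial_idealE:
  fixes I :: "('n::finite, 'k::field) mpoly set"
  assumes "squarefree_monomial_ideal I" "equigenerated d I"
  obtains \<G> where "uniform d \<G>" "I = face_ideal \<G>"
proof
  let ?G = "Poly_Mapping.keys ` min_mons I"
  have s: "sqf (Poly_Mapping.keys t) = t" if "t \<in> min_mons I" for t
    using assms(1) that squarefree_eq_sqf[of t] by (auto simp: squarefree_monomial_ideal_def)
  then have "sqf ` ?G = min_mons I" by force
  then show "I = face_ideal ?G"
    using ideal_gen_min_mons[of I] assms(1)
    by (simp add: face_ideal_def squarefree_monomial_ideal_def)
  show "uniform d ?G"
    using assms(2) s unfolding uniform_def equigenerated_def by (metis imageE mdeg_sqf)
qed


section \<open>Gradient ideals of squarefree monomial ideals\<close>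

definition shadow :: "'n set set \<Rightarrow> 'n set set" where
  "shadow \<G> = {A - {v} | A v. A \<in> \<G> \<and> v \<in> A}"

lemma lookup_partial_deriv:
  "Poly_Mapping.lookup (partial_deriv v f) a =
    of_nat (Suc (Poly_Mapping.lookup a v)) * Poly_Mapping.lookup f (a + Poly_Mapping.single v 1)"
proof -
  let ?x = "Poly_Mapping.single v (1::nat)"
  have "(of_nat (Poly_Mapping.lookup t v) * Poly_Mapping.lookup f t when t - ?x = a)
    = (if t = a + ?x then of_nat (Suc (Poly_Mapping.lookup a v)) * Poly_Mapping.lookup f (a + ?x) else 0)" for t
  proof (cases "Poly_Mapping.lookup t v = 0")
    case True
    then show ?thesis by (auto simp: lookup_add)
  next
    case False
    then have "t - ?x + ?x = t"
      by (intro poly_mapping_eqI) (auto simp: lookup_add lookup_minus lookup_single when_def)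
    then have "t - ?x = a \<longleftrightarrow> t = a + ?x" by auto
    then show ?thesis by (auto simp: lookup_add)
  qed
  then show ?thesis
    by (simp add: partial_deriv_def lookup_sum lookup_single in_keys_iff)
qed

lemma partial_deriv_zero: "partial_deriv v 0 = 0"
  by (rule poly_mapping_eqI) (simp add: lookup_partial_deriv)

lemma partial_deriv_add: "partial_deriv v (f + g) = partial_deriv v f + partial_deriv v g"
  by (rule poly_mapping_eqI) (simp add: lookup_partial_deriv lookup_add distrib_left)

lemma partial_deriv_scale:
  fixes f :: "('n, 'k::field) mpoly"
  shows "partial_deriv v (Poly_Mapping.single 0 a * f) = Poly_Mapping.single 0 a * partial_deriv v f"
  by (rule poly_mapping_eqI) (simp add: lookup_partial_deriv lookup_single_times mult.left_commute)

lemma partial_deriv_mon_sqf: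
  "partial_deriv v (mon (sqf A) :: ('n::finite, 'k::field) mpoly) = (if v \<in> A then mon (sqf (A - {v})) else 0)"
  by (simp add: partial_deriv_def mon_def flip: sqf_diff_single)

lemma mdeg_0_iff: "mdeg t = 0 \<longleftrightarrow> t = 0"
  by (auto simp: mdeg_def poly_mapping_eq_iff fun_eq_iff)

text \<open>
  No term of \<open>x\<close> has degree below \<open>d\<close>, so a term of degree \<open>d\<close> in \<open>c * x\<close> can only come from the constant
  term of \<open>c\<close>.
\<close>

lemma lookup_times_lowest:
  fixes c x :: "('n::finite, 'k::field) mpoly"
  assumes x: "\<And>s. s \<in> Poly_Mapping.keys x \<Longrightarrow> d \<le> mdeg s" and t: "mdeg t = d"
  shows "Poly_Mapping.lookup (c * x) t = Poly_Mapping.lookup c 0 * Poly_Mapping.lookup x t"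
proof -
  have 1: "Poly_Mapping.lookup (Poly_Mapping.single s a * x) t = (if s = 0 then a * Poly_Mapping.lookup x t else 0)" for s a
  proof -
    have "Poly_Mapping.lookup (Poly_Mapping.single s a * x) t = a * Poly_Mapping.lookup (mon s * x) t"
      by (subst single_eq_scale_mon) (simp add: lookup_single_times mult.assoc)
    also have "Poly_Mapping.lookup (mon s * x) t = (if s = 0 then Poly_Mapping.lookup x t else 0)"
    proof (cases "mdvd s t \<and> s \<noteq> 0")
      case True
      then obtain r where r: "t = s + r" by (auto simp: mdvd_iff)
      have "mdeg s \<noteq> 0" using True by (simp add: mdeg_0_iff)
      then have "mdeg r < d" using r t by (auto simp: mdeg_add)
      then have "r \<notin> Poly_Mapping.keys x" using x by (meson not_le)
      then show ?thesis using True r by (simp add: lookup_mon_times in_keys_iff)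
    qed (auto simp: lookup_mon_times mdvd_def)
    finally show ?thesis by simp
  qed
  have "Poly_Mapping.lookup (c * x) t =
     Poly_Mapping.lookup ((\<Sum>s\<in>Poly_Mapping.keys c. Poly_Mapping.single s (Poly_Mapping.lookup c s)) * x) t"
    by (simp flip: mpoly_sum_monomials)
  also have "\<dots> = Poly_Mapping.lookup c 0 * Poly_Mapping.lookup x t"
    by (simp add: sum_distrib_right lookup_sum 1 in_keys_iff)
  finally show ?thesis .
qed

text \<open>
  Truncating a polynomial combination of such generators to degree \<open>d\<close> leaves a \<open>K\<close>-linear
  combination of the generators of degree \<open>d\<close>.  So a \<open>K\<close>-linear property of the latter passes to
  every form of degree \<open>d\<close> in the ideal.
\<close>

lemma lowest_degree_induct [consumes 3, case_names zero add]:
  fixes f :: "('n::finite, 'k::field) mpoly"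
  assumes f: "f \<in> ideal_gen G" "homogeneous d f"
    and "\<forall>g\<in>G. (\<exists>e. homogeneous e g) \<and> (\<forall>s\<in>Poly_Mapping.keys g. d \<le> mdeg s)"
    and zero: "P 0"
    and add: "\<And>a g h. g \<in> G \<Longrightarrow> homogeneous d g \<Longrightarrow> P h \<Longrightarrow> P (Poly_Mapping.single 0 a * g + h)"
  shows "P f"
proof -
  have G: "(\<exists>e. homogeneous e g) \<and> (\<forall>s\<in>Poly_Mapping.keys g. d \<le> mdeg s)" if "g \<in> G" for g
    using assms(3) that by blast
  define Q where "Q f \<longleftrightarrow> (\<exists>h. P h \<and> homogeneous d h \<and>
     (\<forall>t. mdeg t = d \<longrightarrow> Poly_Mapping.lookup h t = Poly_Mapping.lookup f t))" for f :: "('n, 'k) mpoly"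
  have "Q f" using f(1)
  proof (induction rule: ideal.span_induct_alt)
    case base
    then show ?case unfolding Q_def using zero by (intro exI[of _ 0]) (simp add: homogeneous_def)
  next
    case (step c x y)
    then obtain h where h: "P h" "homogeneous d h"
      "\<And>t. mdeg t = d \<Longrightarrow> Poly_Mapping.lookup h t = Poly_Mapping.lookup y t" unfolding Q_def by blast
    have l: "Poly_Mapping.lookup (c * x) t = Poly_Mapping.lookup c 0 * Poly_Mapping.lookup x t" if "mdeg t = d" for t
      using that G[OF step.hyps(1)] by (intro lookup_times_lowest) auto
    show ?case
    proof (cases "homogeneous d x")
      case True
      let ?h = "Poly_Mapping.single 0 (Poly_Mapping.lookup c 0) * x + h"
      have "homogeneous d ?h"
        using True h(2) unfolding homogeneous_def
        by (auto simp: in_keys_iff lookup_add lookup_single_times)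
      then show ?thesis unfolding Q_def using add[OF step.hyps(1) True h(1)]
        by (intro exI[of _ ?h]) (simp add: h(3) l lookup_add lookup_single_times)
    next
      case False
      have "Poly_Mapping.lookup x t = 0" if "mdeg t = d" for t
        using G[OF step.hyps(1)] False that unfolding homogeneous_def by (metis in_keys_iff)
      then show ?thesis unfolding Q_def using h by (intro exI[of _ h]) (simp add: l lookup_add)
    qed
  qed
  then obtain h where h: "P h" "homogeneous d h"
      "\<And>t. mdeg t = d \<Longrightarrow> Poly_Mapping.lookup h t = Poly_Mapping.lookup f t" unfolding Q_def by blast
  have "h = f"
  proof (rule poly_mapping_eqI)
    fix t show "Poly_Mapping.lookup h t = Poly_Mapping.lookup f t"
      using h f(2) by (metis homogeneous_def in_keys_iff)
  qed
  then show ?thesis using h by simp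
qed

lemma mdeg_face_ideal:
  assumes "uniform d \<G>" "f \<in> face_ideal \<G>" "t \<in> Poly_Mapping.keys f"
  shows "d \<le> mdeg t"
proof -
  obtain A where A: "A \<in> \<G>" "A \<subseteq> Poly_Mapping.keys t" using assms by (auto simp: in_face_ideal)
  then obtain r where "t = sqf A + r" by (metis mdvd_sqf mdvd_iff)
  then show ?thesis using A assms(1) by (simp add: mdeg_add uniform_def)
qed

lemma homogeneous_mon_sqf: "homogeneous d (mon (sqf A) :: ('n::finite, 'k::field) mpoly) \<longleftrightarrow> card A = d"
  by (auto simp: homogeneous_def mon_def)

text \<open>
  The generators of degree \<open>d\<close> already yield every form of degree \<open>d\<close> in the ideal, in particular
  the squarefree monomials that generate it, and minimality excludes all further generators.
\<close>

lemma min_hom_gens_face_ideal: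
  assumes u: "uniform d \<G>" and G: "min_hom_gens (face_ideal \<G> :: ('n::finite, 'k::field) mpoly set) G"
  shows "\<forall>g\<in>G. homogeneous d g \<and> g \<noteq> 0"
proof -
  let ?G = "{g \<in> G. homogeneous d g \<and> g \<noteq> 0}"
  have GI: "ideal_gen G = (face_ideal \<G> :: ('n, 'k) mpoly set)" using G by (simp add: min_hom_gens_def)
  have deg: "\<forall>g\<in>G. (\<exists>e. homogeneous e g) \<and> (\<forall>s\<in>Poly_Mapping.keys g. d \<le> mdeg s)"
  proof
    fix g assume "g \<in> G"
    then have "g \<in> face_ideal \<G>" using GI ideal.span_base by blast
    then show "(\<exists>e. homogeneous e g) \<and> (\<forall>s\<in>Poly_Mapping.keys g. d \<le> mdeg s)"
      using G \<open>g \<in> G\<close> mdeg_face_ideal[OF u] unfolding min_hom_gens_def by blast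
  qed
  have "ideal_gen ?G = (face_ideal \<G> :: ('n, 'k) mpoly set)"
  proof
    show "ideal_gen ?G \<subseteq> (face_ideal \<G> :: ('n, 'k) mpoly set)"
      unfolding GI[symmetric] by (rule ideal.span_mono) auto
    have "mon (sqf A) \<in> ideal_gen ?G" if "A \<in> \<G>" for A
    proof -
      have "mon (sqf A) \<in> ideal_gen G" unfolding GI mon_in_face_ideal using that by auto
      moreover have "homogeneous d (mon (sqf A) :: ('n, 'k) mpoly)"
        using that u by (simp add: homogeneous_mon_sqf uniform_def)
      ultimately show ?thesis using deg
      proof (induction rule: lowest_degree_induct)
        case zero
        show ?case by (rule ideal.span_zero)
      next
        case (add a g h)
        have "g \<in> ideal_gen ?G"
          using add(1,2) by (cases "g = 0") (simp_all add: ideal.span_zero ideal.span_base)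
        then show ?case using add(3) by (intro ideal.span_add ideal.span_scale)
      qed
    qed
    then show "(face_ideal \<G> :: ('n, 'k) mpoly set) \<subseteq> ideal_gen ?G"
      unfolding face_ideal_def by (intro ideal.span_minimal) auto
  qed
  then have "\<not> ?G \<subset> G" using G unfolding min_hom_gens_def by blast
  then show ?thesis by blast
qed

lemma min_hom_gens_mon:
  assumes u: "uniform d \<G>"
  shows "min_hom_gens (face_ideal \<G> :: ('n::finite, 'k::field) mpoly set) (mon ` sqf ` \<G>)"
  unfolding min_hom_gens_def
proof (intro conjI allI impI)
  show "\<forall>g\<in>mon ` sqf ` \<G>. \<exists>d. homogeneous d (g :: ('n, 'k) mpoly)"
    by (auto simp: homogeneous_mon_sqf)
  show "ideal_gen (mon ` sqf ` \<G>) = (face_ideal \<G> :: ('n, 'k) mpoly set)"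
    by (simp add: face_ideal_def)
  fix H :: "('n, 'k) mpoly set"
  assume H: "H \<subset> mon ` sqf ` \<G>"
  define M where "M = {t \<in> sqf ` \<G>. (mon t :: ('n, 'k) mpoly) \<in> H}"
  have "H = mon ` M" using H unfolding M_def by blast
  moreover have "M \<subset> sqf ` \<G>" using H unfolding M_def by blast
  moreover have "sqf ` \<G> = min_mons (face_ideal \<G> :: ('n, 'k) mpoly set)"
    using min_mons_face_ideal[OF u] by metis
  ultimately show "ideal_gen H \<noteq> face_ideal \<G>"
    using min_mons_unique[of "face_ideal \<G> :: ('n, 'k) mpoly set" "sqf ` \<G>"] by auto
qed

lemma alpha_face_ideal:
  assumes u: "uniform d \<G>" and ne: "\<G> \<noteq> {}"
  shows "alpha (face_ideal \<G> :: ('n::finite, 'k::field) mpoly set) = d"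
  unfolding alpha_def
proof (rule Least_equality)
  show "\<exists>G. min_hom_gens (face_ideal \<G> :: ('n, 'k) mpoly set) G \<and> (\<exists>g\<in>G. homogeneous d g)"
  proof (intro exI conjI)
    show "min_hom_gens (face_ideal \<G> :: ('n, 'k) mpoly set) (mon ` sqf ` \<G>)"
      by (rule min_hom_gens_mon[OF u])
    show "\<exists>g\<in>mon ` sqf ` \<G>. homogeneous d (g :: ('n, 'k) mpoly)"
      using ne u by (auto simp: homogeneous_mon_sqf uniform_def)
  qed
next
  fix e assume "\<exists>G. min_hom_gens (face_ideal \<G> :: ('n, 'k) mpoly set) G \<and> (\<exists>g\<in>G. homogeneous e g)"
  then obtain G and g :: "('n, 'k) mpoly" where "min_hom_gens (face_ideal \<G>) G" "g \<in> G" "homogeneous e g" by blast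
  then have g: "homogeneous d g" "g \<noteq> 0" using min_hom_gens_face_ideal[OF u] by auto
  then obtain t where "t \<in> Poly_Mapping.keys g" by fastforce
  then show "d \<le> e" using g \<open>homogeneous e g\<close> by (auto simp: homogeneous_def)
qed

text \<open>
  Every minimal homogeneous generating set spans the same space of forms of degree \<open>d\<close> as the
  squarefree monomial generators, and differentiation is \<open>K\<close>-linear; hence the arbitrary choice in
  \<open>gradient_ideal\<close> does not influence the ideal.
\<close>

lemma gradient_face_ideal:
  assumes u: "uniform d \<G>"
  shows "gradient_ideal (face_ideal \<G> :: ('n::finite, 'k::field) mpoly set) = face_ideal (shadow \<G>)"
proof -
  define G where "G = (SOME G. min_hom_gens (face_ideal \<G> :: ('n, 'k) mpoly set) G)"
  have G: "min_hom_gens (face_ideal \<G> :: ('n, 'k) mpoly set) G"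
    unfolding G_def using min_hom_gens_mon[OF u] by (rule someI)
  have hom: "\<And>g. g \<in> G \<Longrightarrow> homogeneous d g" using min_hom_gens_face_ideal[OF u G] by blast
  have GI: "ideal_gen G = (face_ideal \<G> :: ('n, 'k) mpoly set)" using G by (simp add: min_hom_gens_def)
  let ?D = "{partial_deriv v f | v f. f \<in> G}"
  have "ideal_gen ?D = (face_ideal (shadow \<G>) :: ('n, 'k) mpoly set)"
  proof
    show "ideal_gen ?D \<subseteq> (face_ideal (shadow \<G>) :: ('n, 'k) mpoly set)"
    proof (rule ideal.span_minimal)
      show "?D \<subseteq> face_ideal (shadow \<G>)"
      proof clarify
        fix v f assume f: "f \<in> G"
        show "partial_deriv v f \<in> face_ideal (shadow \<G>)"
          unfolding in_face_ideal
        proof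
          let ?x = "Poly_Mapping.single v (1::nat)"
          fix a assume "a \<in> Poly_Mapping.keys (partial_deriv v f)"
          then have a: "a + ?x \<in> Poly_Mapping.keys f"
            by (auto simp: in_keys_iff lookup_partial_deriv)
          have "f \<in> face_ideal \<G>" using f GI ideal.span_base by blast
          then obtain A where A: "A \<in> \<G>" "A \<subseteq> Poly_Mapping.keys (a + ?x)"
            using a by (auto simp: in_face_ideal)
          then obtain r where r: "a + ?x = sqf A + r" by (metis mdvd_sqf mdvd_iff)
          have "mdeg (a + ?x) = d" using hom[OF f] a by (simp add: homogeneous_def)
          then have "mdeg (sqf A) + mdeg r = d" unfolding r mdeg_add .
          then have "mdeg r = 0" using A(1) u by (simp add: uniform_def)
          then have eq: "a + ?x = sqf A" using r by (simp add: mdeg_0_iff)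
          then have "v \<in> A" by (metis lookup_add lookup_single_eq lookup_sqf add_is_0 one_neq_zero)
          moreover have "a = sqf (A - {v})" using eq by (metis add_diff_cancel_right' sqf_diff_single)
          ultimately show "\<exists>B\<in>shadow \<G>. B \<subseteq> Poly_Mapping.keys a"
            using A(1) by (auto simp: shadow_def)
        qed
      qed
    qed simp
    have "mon (sqf (A - {v})) \<in> ideal_gen ?D" if A: "A \<in> \<G>" "v \<in> A" for A v
    proof -
      have "mon (sqf A) \<in> ideal_gen G" unfolding GI mon_in_face_ideal using A by auto
      moreover have "homogeneous d (mon (sqf A) :: ('n, 'k) mpoly)"
        using A u by (simp add: homogeneous_mon_sqf uniform_def)
      moreover have "\<forall>g\<in>G. (\<exists>e. homogeneous e g) \<and> (\<forall>s\<in>Poly_Mapping.keys g. d \<le> mdeg s)"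
        using hom by (fastforce simp: homogeneous_def)
      ultimately have "partial_deriv v (mon (sqf A)) \<in> ideal_gen ?D"
      proof (induction rule: lowest_degree_induct)
        case zero
        show ?case by (simp add: partial_deriv_zero ideal.span_zero)
      next
        case (add a g h)
        have "partial_deriv v g \<in> ideal_gen ?D" using add(1) by (intro ideal.span_base) blast
        then show ?case
          unfolding partial_deriv_add partial_deriv_scale using add(3)
          by (intro ideal.span_add ideal.span_scale)
      qed
      then show ?thesis using A by (simp add: partial_deriv_mon_sqf)
    qed
    then show "(face_ideal (shadow \<G>) :: ('n, 'k) mpoly set) \<subseteq> ideal_gen ?D"
      unfolding face_ideal_def by (intro ideal.span_minimal) (auto simp: shadow_def)
  qed
  then show ?thesis by (simp add: gradient_ideal_def G_def)
qed

text \<open>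
  The \<open>l\<close>-fold iterated shadow of a \<open>d\<close>-uniform family.  The equation \<open>card B + l = d\<close> avoids
  truncated subtraction, so that the family is empty for \<open>l > d\<close>.
\<close>

definition shadows :: "nat \<Rightarrow> nat \<Rightarrow> 'n::finite set set \<Rightarrow> 'n set set" where
  "shadows d l \<G> = {B. card B + l = d \<and> (\<exists>A\<in>\<G>. B \<subseteq> A)}"

lemma uniform_shadows: "uniform (d - l) (shadows d l \<G>)"
  by (auto simp: uniform_def shadows_def)

lemma shadows_0: "uniform d \<G> \<Longrightarrow> shadows d 0 \<G> = \<G>"
  by (auto simp: uniform_def shadows_def) (metis card_subset_eq finite)

lemma shadow_shadows:
  assumes u: "uniform d \<G>" and l: "l < d"
  shows "shadow (shadows d l \<G>) = shadows d (Suc l) \<G>"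
proof (intro set_eqI iffI)
  fix B assume "B \<in> shadow (shadows d l \<G>)"
  then obtain A v where A: "A \<in> shadows d l \<G>" "v \<in> A" "B = A - {v}" by (auto simp: shadow_def)
  then have "Suc (card B) = card A" by (metis card_Suc_Diff1 finite)
  then show "B \<in> shadows d (Suc l) \<G>" using A by (auto simp: shadows_def)
next
  fix B assume "B \<in> shadows d (Suc l) \<G>"
  then obtain A where A: "A \<in> \<G>" "B \<subseteq> A" "card B + Suc l = d" by (auto simp: shadows_def)
  then have "card B < card A" using u by (auto simp: uniform_def)
  then obtain v where v: "v \<in> A" "v \<notin> B" using A by (metis less_irrefl subsetI subset_antisym)
  have "insert v B \<in> shadows d l \<G>" using A v by (auto simp: shadows_def)
  then show "B \<in> shadow (shadows d l \<G>)"
    unfolding shadow_def using v by (intro CollectI exI[of _ "insert v B"] exI[of _ v]) auto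
qed

lemma gradient_power_face_ideal:
  assumes u: "uniform d \<G>" and l: "l \<le> d"
  shows "(gradient_ideal ^^ l) (face_ideal \<G> :: ('n::finite, 'k::field) mpoly set) = face_ideal (shadows d l \<G>)"
  using l
proof (induction l)
  case 0
  then show ?case by (simp add: shadows_0[OF u])
next
  case (Suc l)
  then show ?case
    by (simp add: gradient_face_ideal[OF uniform_shadows] shadow_shadows[OF u])
qed

section \<open>Multigraded strands of the Koszul complex\<close>

text \<open>
  The boundary map of the augmented simplicial chain complex on sets of variables, with the signs of
  \<open>koszul_diff\<close>.  The empty face sits in position 0, a face with \<open>i\<close> elements in position \<open>i\<close>.
\<close>

definition sbd :: "('n::{finite,linorder} set \<Rightarrow> 'k::field) \<Rightarrow> 'n set \<Rightarrow> 'k" where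
  "sbd \<phi> G = (\<Sum>v\<in>- G. (- 1) ^ card {w\<in>G. w < v} * \<phi> (insert v G))"

definition face_chains :: "'n set set \<Rightarrow> nat \<Rightarrow> ('n set \<Rightarrow> 'k::zero) set" where
  "face_chains \<Gamma> i = {\<phi>. \<forall>F. \<phi> F \<noteq> 0 \<longrightarrow> F \<in> \<Gamma> \<and> card F = i}"

text \<open>
  The vanishing of the reduced homology in dimension \<open>i - 1\<close>.  The type argument carries the field of
  coefficients, which occurs neither in the complex nor in the position.
\<close>

definition exact_at :: "'k::field itself \<Rightarrow> 'n::{finite,linorder} set set \<Rightarrow> nat \<Rightarrow> bool" where
  "exact_at _ \<Gamma> i \<longleftrightarrow> (\<forall>\<phi> :: 'n set \<Rightarrow> 'k. \<phi> \<in> face_chains \<Gamma> i \<longrightarrow> sbd \<phi> = 0 \<longrightarrow>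
     (\<exists>\<psi>\<in>face_chains \<Gamma> (Suc i). sbd \<psi> = \<phi>))"

definition down_closed :: "'n set set \<Rightarrow> bool" where
  "down_closed \<Gamma> \<longleftrightarrow> (\<forall>F\<in>\<Gamma>. \<forall>G. G \<subseteq> F \<longrightarrow> G \<in> \<Gamma>)"

text \<open>
  The part of a chain in multidegree \<open>b\<close>: the coefficient of \<open>x\<^sup>b / x\<^bsub>F\<^esub>\<close> at the basis element \<open>e\<^bsub>F\<^esub>\<close>.
\<close>

definition strand :: "'n::finite monomial \<Rightarrow> ('n, 'k::field) kchain \<Rightarrow> 'n set \<Rightarrow> 'k" where
  "strand b c F = (if F \<subseteq> Poly_Mapping.keys b then Poly_Mapping.lookup (c F) (b - sqf F) else 0)"

text \<open>
  Known as the upper Koszul simplicial complex of \<open>I\<close> in degree \<open>b\<close>.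
\<close>

definition upper_koszul :: "('n::finite, 'k::field) mpoly set \<Rightarrow> 'n monomial \<Rightarrow> 'n set set" where
  "upper_koszul I b = {F. F \<subseteq> Poly_Mapping.keys b \<and> mon (b - sqf F) \<in> I}"

text \<open>
  The Koszul differential moves a variable from the basis element to its coefficient, so it preserves
  the multidegree, where it acts as the simplicial boundary.
\<close>

lemma strand_koszul_diff:
  fixes c :: "('n::{finite,linorder}, 'k::field) kchain"
  shows "strand b (koszul_diff c) = sbd (strand b c)"
proof
  fix G :: "'n set"
  show "strand b (koszul_diff c) G = sbd (strand b c) G"
  proof (cases "G \<subseteq> Poly_Mapping.keys b")
    case True
    have eq: "b - sqf G - Poly_Mapping.single v 1 = b - sqf (insert v G)" if "v \<notin> G" for v
      using that by (intro poly_mapping_eqI) (auto simp: lookup_minus lookup_single when_def)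
    have iff: "v \<in> Poly_Mapping.keys (b - sqf G) \<longleftrightarrow> insert v G \<subseteq> Poly_Mapping.keys b" if "v \<notin> G" for v
      using that True by (auto simp: in_keys_iff lookup_minus)
    have "strand b (koszul_diff c) G = (\<Sum>v\<in>Poly_Mapping.keys (b - sqf G) - G. (- 1) ^ card {w\<in>G. w < v} *
       Poly_Mapping.lookup (c (insert v G)) (b - sqf G - Poly_Mapping.single v 1))"
      using True by (simp add: strand_def lookup_koszul_diff)
    also have "\<dots> = sbd (strand b c) G"
      unfolding sbd_def by (rule sum.mono_neutral_cong_left) (auto simp: strand_def iff eq[unfolded One_nat_def])
    finally show ?thesis .
  next
    case False
    then show ?thesis by (simp add: strand_def sbd_def)
  qed
qed

lemma sbd_0 [simp]: "sbd 0 = 0"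
  by (simp add: sbd_def fun_eq_iff)

lemma sbd_add: "sbd (\<phi> + \<psi>) = sbd \<phi> + sbd \<psi>"
  by (simp add: sbd_def fun_eq_iff distrib_left sum.distrib)

lemma sbd_diff: "sbd (\<phi> - \<psi>) = sbd \<phi> - sbd \<psi>"
  by (simp add: sbd_def fun_eq_iff right_diff_distrib sum_subtractf)

text \<open>
  The multidegree that contains every variable exactly once has room for every set of variables, so the
  identity is an instance of the one for the Koszul complex.
\<close>

lemma sbd_sbd: "sbd (sbd \<phi>) = (0 :: 'n::{finite,linorder} set \<Rightarrow> 'k::field)"
proof -
  define c :: "('n, 'k) kchain" where "c F = Poly_Mapping.single (sqf (- F)) (\<phi> F)" for F
  have "sqf UNIV - sqf F = sqf (- F)" for F :: "'n set"
    by (intro poly_mapping_eqI) (simp add: lookup_minus)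
  then have "strand (sqf UNIV) c = \<phi>" by (simp add: fun_eq_iff strand_def c_def)
  then have "sbd (sbd \<phi>) = strand (sqf UNIV) (koszul_diff (koszul_diff c))"
    by (simp add: strand_koszul_diff)
  also have "\<dots> = 0" by (simp add: koszul_diff_diff strand_def fun_eq_iff)
  finally show ?thesis .
qed

lemma strand_add_sqf: "strand (t + sqf F) c F = Poly_Mapping.lookup (c F) t"
  by (auto simp: strand_def in_keys_iff lookup_add)

lemma kchain_eq_iff_strands: "c = c' \<longleftrightarrow> (\<forall>b. strand b c = strand b c')"
proof
  assume "\<forall>b. strand b c = strand b c'"
  then show "c = c'" by (intro ext poly_mapping_eqI) (metis strand_add_sqf)
qed simp

lemma minus_sqf_add:
  assumes "F \<subseteq> Poly_Mapping.keys b"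
  shows "b - sqf F + sqf F = b"
proof (rule poly_mapping_eqI)
  fix v
  have "Poly_Mapping.lookup b v \<noteq> 0" if "v \<in> F" using assms that by (auto simp: in_keys_iff)
  then show "Poly_Mapping.lookup (b - sqf F + sqf F) v = Poly_Mapping.lookup b v"
    by (simp add: lookup_add lookup_minus)
qed

lemma koszul_chains_iff_strands:
  "c \<in> koszul_chains i j I \<longleftrightarrow>
    (\<forall>b. strand b c \<in> face_chains (upper_koszul I b) i \<and> (mdeg b \<noteq> j \<longrightarrow> strand b c = 0))"
  if I: "monomial_ideal (I :: ('n::finite, 'k::field) mpoly set)"
proof -
  have l: "c \<in> koszul_chains i j I \<longleftrightarrow>
    (\<forall>F t. Poly_Mapping.lookup (c F) t \<noteq> 0 \<longrightarrow> mon t \<in> I \<and> card F = i \<and> mdeg t + i = j)"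
    (is "_ \<longleftrightarrow> ?r")
  proof
    assume c: "c \<in> koszul_chains i j I"
    show ?r
    proof (intro allI impI)
      fix F t assume t: "Poly_Mapping.lookup (c F) t \<noteq> 0"
      then have "c F \<noteq> 0" "t \<in> Poly_Mapping.keys (c F)" by (auto simp: in_keys_iff)
      moreover have "c F \<in> I" "card F \<noteq> i \<longrightarrow> c F = 0" "\<forall>t\<in>Poly_Mapping.keys (c F). mdeg t + i = j"
        using c by (auto simp: koszul_chains_def)
      ultimately show "mon t \<in> I \<and> card F = i \<and> mdeg t + i = j"
        using in_monomial_ideal_iff[OF I, of "c F"] by blast
    qed
  next
    assume r: ?r
    show "c \<in> koszul_chains i j I"
      unfolding koszul_chains_def
    proof (intro CollectI allI conjI impI ballI)
      fix F
      show "c F \<in> I" using r in_monomial_ideal_iff[OF I, of "c F"] by (auto simp: in_keys_iff)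
      show "c F = 0" if "card F \<noteq> i"
        using r that by (intro poly_mapping_eqI) auto
      show "mdeg t + i = j" if "t \<in> Poly_Mapping.keys (c F)" for t
        using r that by (auto simp: in_keys_iff)
    qed
  qed
  show ?thesis
  proof
    assume "c \<in> koszul_chains i j I"
    then have *: "mon t \<in> I" "card F = i" "mdeg t + i = j" if "Poly_Mapping.lookup (c F) t \<noteq> 0" for F t
      using that unfolding l by blast+
    have "F \<in> upper_koszul I b \<and> card F = i \<and> mdeg b = j" if "strand b c F \<noteq> 0" for b F
    proof -
      have F: "F \<subseteq> Poly_Mapping.keys b" "Poly_Mapping.lookup (c F) (b - sqf F) \<noteq> 0"
        using that by (auto simp: strand_def split: if_splits)
      have "mdeg b = mdeg (b - sqf F) + card F"
        using minus_sqf_add[OF F(1)] by (metis mdeg_add mdeg_sqf)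
      then show ?thesis using F *[OF F(2)] by (simp add: upper_koszul_def)
    qed
    then show "\<forall>b. strand b c \<in> face_chains (upper_koszul I b) i \<and> (mdeg b \<noteq> j \<longrightarrow> strand b c = 0)"
      by (fastforce simp: face_chains_def fun_eq_iff)
  next
    assume r: "\<forall>b. strand b c \<in> face_chains (upper_koszul I b) i \<and> (mdeg b \<noteq> j \<longrightarrow> strand b c = 0)"
    have "mon t \<in> I \<and> card F = i \<and> mdeg t + i = j" if "Poly_Mapping.lookup (c F) t \<noteq> 0" for F t
    proof -
      have nz: "strand (t + sqf F) c F \<noteq> 0" using that by (simp add: strand_add_sqf)
      then have "F \<in> upper_koszul I (t + sqf F)" "card F = i" using r by (auto simp: face_chains_def)
      moreover have "mdeg (t + sqf F) = j" using nz r by (metis zero_fun_apply)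
      ultimately show ?thesis by (simp add: upper_koszul_def mdeg_add)
    qed
    then show "c \<in> koszul_chains i j I" unfolding l by blast
  qed
qed

text \<open>
  The strands of a chain can be prescribed independently of each other; fixing the total degree leaves
  only finitely many of them, as a polynomial requires.
\<close>

lemma ex_kchain_with_strands:
  fixes \<psi> :: "'n::finite monomial \<Rightarrow> 'n set \<Rightarrow> 'k::field"
  assumes deg: "\<And>b. mdeg b \<noteq> j \<Longrightarrow> \<psi> b = 0"
    and sub: "\<And>b F. \<psi> b F \<noteq> 0 \<Longrightarrow> F \<subseteq> Poly_Mapping.keys b"
  shows "\<exists>c. \<forall>b. strand b c = \<psi> b"
proof (intro exI allI)
  let ?T = "{t :: 'n monomial. mdeg t \<le> j}"
  define c :: "('n, 'k) kchain" where "c F = (\<Sum>t\<in>?T. Poly_Mapping.single t (\<psi> (t + sqf F) F))" for F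
  have c: "Poly_Mapping.lookup (c F) t = (if mdeg t \<le> j then \<psi> (t + sqf F) F else 0)" for F t
    using finite_monomials_mdeg[where 'n = 'n, of j]
    by (simp add: c_def lookup_sum lookup_single when_def)
  fix b
  show "strand b c = \<psi> b"
  proof
    fix F
    show "strand b c F = \<psi> b F"
    proof (cases "F \<subseteq> Poly_Mapping.keys b")
      case True
      have "mdeg b = mdeg (b - sqf F) + card F"
        using minus_sqf_add[OF True] by (metis mdeg_add mdeg_sqf)
      then show ?thesis using True deg[of b] by (auto simp: strand_def c minus_sqf_add)
    next
      case False
      then show ?thesis using sub[of b F] by (auto simp: strand_def)
    qed
  qed
qed

text \<open>
  A chain is determined by its strands, these can be chosen independently, and membership in a monomial
  ideal is decided term by term.  Hence the Koszul homology of \<open>I\<close> is the direct sum over the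
  multidegrees of the simplicial homology of the upper Koszul complexes.
\<close>

lemma tor_dim_eq_0_iff_exact:
  fixes I :: "('n::{finite,linorder}, 'k::field) mpoly set"
  assumes I: "monomial_ideal I"
  shows "tor_dim i j I = 0 \<longleftrightarrow> (\<forall>b. mdeg b = j \<longrightarrow> exact_at TYPE('k) (upper_koszul I b) i)"
  unfolding tor_dim_eq_0_iff[OF is_ideal_monomial_ideal[OF I]]
proof
  assume eq: "koszul_cycles i j I = koszul_boundaries i j I"
  show "\<forall>b. mdeg b = j \<longrightarrow> exact_at TYPE('k) (upper_koszul I b) i"
    unfolding exact_at_def
  proof (intro allI impI)
    fix b and \<phi> :: "'n set \<Rightarrow> 'k"
    assume b: "mdeg b = j" and \<phi>: "\<phi> \<in> face_chains (upper_koszul I b) i" "sbd \<phi> = 0"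
    define \<psi> where "\<psi> b' = (if b' = b then \<phi> else 0)" for b'
    have "\<exists>c. \<forall>b. strand b c = \<psi> b"
      using \<phi>(1) b by (intro ex_kchain_with_strands[of j])
        (auto simp: \<psi>_def face_chains_def upper_koszul_def split: if_splits)
    then obtain c where c: "\<And>b. strand b c = \<psi> b" by blast
    have "c \<in> koszul_chains i j I"
      unfolding koszul_chains_iff_strands[OF I] c using \<phi>(1) b by (auto simp: \<psi>_def face_chains_def)
    moreover have "koszul_diff c = 0"
      unfolding kchain_eq_iff_strands strand_koszul_diff c using \<phi>(2)
      by (simp add: \<psi>_def) (simp add: strand_def fun_eq_iff)
    ultimately have "c \<in> koszul_cycles i j I" by (simp add: koszul_cycles_def)
    then have "c \<in> koszul_boundaries i j I" using eq by blast
    then obtain c' where c': "c' \<in> koszul_chains (Suc i) j I" "c = koszul_diff c'"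
      by (auto simp: koszul_boundaries_def)
    show "\<exists>\<psi>\<in>face_chains (upper_koszul I b) (Suc i). sbd \<psi> = \<phi>"
    proof (intro bexI)
      show "sbd (strand b c') = \<phi>" using c[of b] c'(2) by (simp add: \<psi>_def strand_koszul_diff)
      show "strand b c' \<in> face_chains (upper_koszul I b) (Suc i)"
        using c'(1) unfolding koszul_chains_iff_strands[OF I] by blast
    qed
  qed
next
  assume ex: "\<forall>b. mdeg b = j \<longrightarrow> exact_at TYPE('k) (upper_koszul I b) i"
  have "c \<in> koszul_boundaries i j I" if "c \<in> koszul_cycles i j I" for c
  proof -
    have c: "strand b c \<in> face_chains (upper_koszul I b) i" "mdeg b \<noteq> j \<longrightarrow> strand b c = 0"
      "sbd (strand b c) = 0" for b
      using that unfolding koszul_cycles_def koszul_chains_iff_strands[OF I]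
      by (auto simp flip: strand_koszul_diff) (simp add: strand_def fun_eq_iff)
    have "\<exists>\<psi>. \<psi> \<in> face_chains (upper_koszul I b) (Suc i) \<and> sbd \<psi> = strand b c \<and> (mdeg b \<noteq> j \<longrightarrow> \<psi> = 0)" for b
    proof (cases "mdeg b = j")
      case True
      then show ?thesis using ex c unfolding exact_at_def by blast
    next
      case False
      then show ?thesis using c(2) by (intro exI[of _ 0]) (simp add: face_chains_def)
    qed
    then obtain \<psi> where \<psi>: "\<And>b. \<psi> b \<in> face_chains (upper_koszul I b) (Suc i)"
      "\<And>b. sbd (\<psi> b) = strand b c" "\<And>b. mdeg b \<noteq> j \<Longrightarrow> \<psi> b = 0" by metis
    have "\<exists>c'. \<forall>b. strand b c' = \<psi> b"
      using \<psi>(1,3) by (intro ex_kchain_with_strands[of j]) (auto simp: face_chains_def upper_koszul_def)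
    then obtain c' where c': "\<And>b. strand b c' = \<psi> b" by blast
    have "c' \<in> koszul_chains (Suc i) j I"
      unfolding koszul_chains_iff_strands[OF I] c' using \<psi> by blast
    moreover have "koszul_diff c' = c"
      unfolding kchain_eq_iff_strands strand_koszul_diff c' by (simp add: \<psi>)
    ultimately show ?thesis by (auto simp: koszul_boundaries_def)
  qed
  then show "koszul_cycles i j I = koszul_boundaries i j I"
    using koszul_boundaries_subset_cycles[OF is_ideal_monomial_ideal[OF I]] by blast
qed


section \<open>Exactness by collapsing\<close>

lemma sbd_nonzeroE:
  assumes "sbd \<phi> G \<noteq> 0"
  obtains v where "v \<notin> G" "\<phi> (insert v G) \<noteq> 0"
proof -
  have "\<exists>v\<in>- G. (- 1) ^ card {w\<in>G. w < v} * \<phi> (insert v G) \<noteq> 0"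
    using assms unfolding sbd_def by (meson sum.neutral)
  then show ?thesis using that by auto
qed

lemma sbd_face_chains:
  assumes "down_closed \<Gamma>" "\<psi> \<in> face_chains \<Gamma> (Suc i)"
  shows "sbd \<psi> \<in> face_chains \<Gamma> i"
  unfolding face_chains_def
proof (intro CollectI allI impI)
  fix G assume "sbd \<psi> G \<noteq> 0"
  then obtain v where v: "v \<notin> G" "\<psi> (insert v G) \<noteq> 0" by (rule sbd_nonzeroE)
  then have "insert v G \<in> \<Gamma>" "card (insert v G) = Suc i" using assms(2) by (auto simp: face_chains_def)
  then show "G \<in> \<Gamma> \<and> card G = i" using v(1) assms(1) by (auto simp: down_closed_def)
qed

lemma face_chains_add:
  "\<phi> \<in> face_chains \<Gamma> i \<Longrightarrow> \<psi> \<in> face_chains \<Gamma> i \<Longrightarrow> \<phi> + \<psi> \<in> face_chains \<Gamma> i"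
  for \<phi> :: "_ \<Rightarrow> 'k::field"
  unfolding face_chains_def mem_Collect_eq plus_fun_apply by (metis add.right_neutral)

lemma face_chains_diff:
  "\<phi> \<in> face_chains \<Gamma> i \<Longrightarrow> \<psi> \<in> face_chains \<Gamma> i \<Longrightarrow> \<phi> - \<psi> \<in> face_chains \<Gamma> i"
  for \<phi> :: "_ \<Rightarrow> 'k::field"
  unfolding face_chains_def mem_Collect_eq minus_apply by (metis diff_zero)

lemma sbd_single_term:
  assumes "m \<notin> G" "\<And>v. v \<notin> G \<Longrightarrow> v \<noteq> m \<Longrightarrow> \<phi> (insert v G) = 0"
  shows "sbd \<phi> G = (- 1) ^ card {w\<in>G. w < m} * \<phi> (insert m G)"
proof -
  have "sbd \<phi> G = (\<Sum>v\<in>{m}. (- 1) ^ card {w\<in>G. w < v} * \<phi> (insert v G))"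
    unfolding sbd_def using assms by (intro sum.mono_neutral_right) auto
  then show ?thesis by simp
qed

text \<open>
  The faces outside \<open>\<Gamma>'\<close> come in pairs \<open>F\<close>, \<open>insert m F\<close>, so the relative chain complex of
  \<open>\<Gamma>\<close> modulo \<open>\<Gamma>'\<close> is acyclic and a cycle of \<open>\<Gamma>\<close> is homologous to one of \<open>\<Gamma>'\<close>.
\<close>

lemma exact_at_collapse:
  fixes \<Gamma> :: "'n::{finite,linorder} set set"
  assumes sub: "\<Gamma>' \<subseteq> \<Gamma>" and dc: "down_closed \<Gamma>" "down_closed \<Gamma>'"
    and toggle: "\<And>F. m \<notin> F \<Longrightarrow> F \<in> \<Gamma> - \<Gamma>' \<longleftrightarrow> insert m F \<in> \<Gamma> - \<Gamma>'"
    and ex: "exact_at TYPE('k::field) \<Gamma>' i"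
  shows "exact_at TYPE('k) \<Gamma> i"
  unfolding exact_at_def
proof (intro allI impI)
  fix \<phi> :: "'n set \<Rightarrow> 'k"
  assume \<phi>: "\<phi> \<in> face_chains \<Gamma> i" "sbd \<phi> = 0"
  \<comment> \<open>Subtracting the boundary of \<open>\<psi>\<close> clears the new faces without \<open>m\<close>; the cycle condition then
    forces the coefficients of the new faces with \<open>m\<close> to vanish as well.\<close>
  define \<psi> where "\<psi> F = (if F \<in> \<Gamma> - \<Gamma>' \<and> m \<in> F
    then (- 1) ^ card {w\<in>F - {m}. w < m} * \<phi> (F - {m}) else 0)" for F
  have \<psi>: "\<psi> \<in> face_chains \<Gamma> (Suc i)"
    using \<phi>(1) unfolding face_chains_def \<psi>_def
    by (auto split: if_splits) (metis card_Suc_Diff1 finite)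
  define \<phi>' where "\<phi>' = \<phi> - sbd \<psi>"
  have cyc: "sbd \<phi>' = 0" by (simp add: \<phi>'_def sbd_diff \<phi> sbd_sbd)
  have \<phi>': "\<phi>' \<in> face_chains \<Gamma> i"
    unfolding \<phi>'_def by (intro face_chains_diff \<phi> sbd_face_chains dc \<psi>)
  have 1: "\<phi>' G = 0" if G: "G \<in> \<Gamma> - \<Gamma>'" "m \<notin> G" for G
  proof -
    have "sbd \<psi> G = (- 1) ^ card {w\<in>G. w < m} * \<psi> (insert m G)"
      using G by (intro sbd_single_term) (auto simp: \<psi>_def)
    also have "\<dots> = \<phi> G"
      using G toggle[OF G(2)] by (simp add: \<psi>_def flip: power_mult_distrib mult.assoc)
    finally show ?thesis by (simp add: \<phi>'_def)
  qed
  have 2: "\<phi>' G = 0" if G: "G \<in> \<Gamma> - \<Gamma>'" "m \<in> G" for G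
  proof -
    let ?H = "G - {m}"
    have ins: "insert m ?H = G" using G by blast
    have H: "?H \<in> \<Gamma> - \<Gamma>'" using toggle[of ?H] G ins by simp
    have "\<phi>' (insert v ?H) = 0" if v: "v \<notin> ?H" "v \<noteq> m" for v
    proof (cases "insert v ?H \<in> \<Gamma>")
      case True
      have "insert v ?H \<notin> \<Gamma>'" using H dc(2) unfolding down_closed_def by blast
      then show ?thesis using 1 True v by auto
    next
      case False
      then show ?thesis using \<phi>' by (auto simp: face_chains_def)
    qed
    then have "sbd \<phi>' ?H = (- 1) ^ card {w\<in>?H. w < m} * \<phi>' (insert m ?H)"
      by (intro sbd_single_term) auto
    then show ?thesis using cyc ins by simp
  qed
  have "\<phi>' \<in> face_chains \<Gamma>' i" using \<phi>' 1 2 unfolding face_chains_def by blast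
  then obtain \<theta> where \<theta>: "\<theta> \<in> face_chains \<Gamma>' (Suc i)" "sbd \<theta> = \<phi>'"
    using ex cyc unfolding exact_at_def by blast
  show "\<exists>\<psi>\<in>face_chains \<Gamma> (Suc i). sbd \<psi> = \<phi>"
  proof (intro bexI)
    show "sbd (\<psi> + \<theta>) = \<phi>" using \<theta>(2) by (simp add: sbd_add \<phi>'_def)
    have "\<theta> \<in> face_chains \<Gamma> (Suc i)" using \<theta>(1) sub unfolding face_chains_def by blast
    then show "\<psi> + \<theta> \<in> face_chains \<Gamma> (Suc i)" by (intro face_chains_add \<psi>)
  qed
qed

lemma exact_at_no_faces:
  assumes "\<And>F. F \<in> \<Gamma> \<Longrightarrow> card F \<noteq> i"
  shows "exact_at TYPE('k::field) \<Gamma> i"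
  unfolding exact_at_def
proof (intro allI impI)
  fix \<phi> :: "'a set \<Rightarrow> 'k" assume "\<phi> \<in> face_chains \<Gamma> i"
  then have "\<phi> = 0" using assms by (auto simp: face_chains_def fun_eq_iff)
  then show "\<exists>\<psi>\<in>face_chains \<Gamma> (Suc i). sbd \<psi> = \<phi>"
    by (intro bexI[of _ 0]) (auto simp: face_chains_def)
qed

lemma exact_at_cone:
  assumes "down_closed \<Gamma>" "\<And>F. F \<in> \<Gamma> \<Longrightarrow> insert m F \<in> \<Gamma>"
  shows "exact_at TYPE('k::field) \<Gamma> i"
proof (rule exact_at_collapse[where m = m and \<Gamma>' = "{}"])
  show "exact_at TYPE('k) {} i" by (rule exact_at_no_faces) simp
  show "F \<in> \<Gamma> - {} \<longleftrightarrow> insert m F \<in> \<Gamma> - {}" for F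
    using assms(1) assms(2)[of F] subset_insertI[of F m] unfolding down_closed_def by (metis Diff_empty)
qed (use assms in \<open>auto simp: down_closed_def\<close>)


section \<open>Linear resolutions of squarefree ideals\<close>

text \<open>
  The upper Koszul complex of \<open>face_ideal \<G>\<close> in the squarefree multidegree \<open>W\<close>.  Its faces are the
  complements in \<open>W\<close> of the sets that contain a member of \<open>\<G>\<close>, so it is the Alexander dual of the
  complex of those subsets of \<open>W\<close> that contain none.
\<close>

definition dual_complex :: "'n set set \<Rightarrow> 'n set \<Rightarrow> 'n set set" where
  "dual_complex \<G> W = {F. F \<subseteq> W \<and> (\<exists>A\<in>\<G>. A \<subseteq> W - F)}"

lemma down_closed_dual_complex: "down_closed (dual_complex \<G> W)"
  unfolding down_closed_def dual_complex_def by blast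

lemma upper_koszul_sqf:
  "upper_koszul (face_ideal \<G> :: ('n::finite, 'k::field) mpoly set) (sqf W) = dual_complex \<G> W"
proof -
  have "sqf W - sqf F = sqf (W - F)" for F
    by (intro poly_mapping_eqI) (simp add: lookup_minus)
  then show ?thesis unfolding upper_koszul_def dual_complex_def mon_in_face_ideal by simp
qed

text \<open>
  Membership in a squarefree ideal depends only on the support of a monomial.  Dividing once by a
  variable that occurs twice keeps the support, so the complex is a cone over that variable.
\<close>

lemma exact_at_not_squarefree:
  assumes "2 \<le> Poly_Mapping.lookup b v"
  shows "exact_at TYPE('k) (upper_koszul (face_ideal \<G> :: ('n::{finite,linorder}, 'k::field) mpoly set) b) i"
proof (rule exact_at_cone)
  have v: "v \<in> Poly_Mapping.keys b" using assms by (auto simp: in_keys_iff)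
  have keys: "Poly_Mapping.keys (b - sqf F) = {w. (if w \<in> F then 1 else 0) < Poly_Mapping.lookup b w}" for F
    by (rule set_eqI) (simp add: in_keys_iff lookup_minus, linarith)
  show "down_closed (upper_koszul (face_ideal \<G> :: ('n, 'k) mpoly set) b)"
    unfolding down_closed_def
  proof (intro ballI allI impI)
    fix F G assume F: "F \<in> upper_koszul (face_ideal \<G> :: ('n, 'k) mpoly set) b" and G: "G \<subseteq> F"
    have "Poly_Mapping.keys (b - sqf F) \<subseteq> Poly_Mapping.keys (b - sqf G)"
      unfolding keys using G by (auto split: if_splits)
    then show "G \<in> upper_koszul (face_ideal \<G> :: ('n, 'k) mpoly set) b"
      using F G unfolding upper_koszul_def mon_in_face_ideal mem_Collect_eq by (meson order_trans)
  qed
  fix F assume F: "F \<in> upper_koszul (face_ideal \<G> :: ('n, 'k) mpoly set) b"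
  have "Poly_Mapping.keys (b - sqf F) \<subseteq> Poly_Mapping.keys (b - sqf (insert v F))"
    unfolding keys using assms by (auto split: if_splits)
  then show "insert v F \<in> upper_koszul (face_ideal \<G> :: ('n, 'k) mpoly set) b"
    using F v unfolding upper_koszul_def mon_in_face_ideal mem_Collect_eq by (meson insert_subset order_trans)
qed

lemma tor_dim_face_ideal_eq_0_iff:
  "tor_dim i j (face_ideal \<G> :: ('n::{finite,linorder}, 'k::field) mpoly set) = 0 \<longleftrightarrow>
    (\<forall>W. card W = j \<longrightarrow> exact_at TYPE('k) (dual_complex \<G> W) i)"
  unfolding tor_dim_eq_0_iff_exact[OF monomial_face_ideal]
proof (intro iffI allI impI)
  fix W :: "'n set"
  assume "\<forall>b. mdeg b = j \<longrightarrow> exact_at TYPE('k) (upper_koszul (face_ideal \<G> :: ('n, 'k) mpoly set) b) i"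
    and "card W = j"
  then show "exact_at TYPE('k) (dual_complex \<G> W) i"
    by (metis mdeg_sqf upper_koszul_sqf)
next
  fix b :: "'n monomial"
  assume *: "\<forall>W. card W = j \<longrightarrow> exact_at TYPE('k) (dual_complex \<G> W) i" and b: "mdeg b = j"
  show "exact_at TYPE('k) (upper_koszul (face_ideal \<G> :: ('n, 'k) mpoly set) b) i"
  proof (cases "\<forall>v. Poly_Mapping.lookup b v \<le> 1")
    case True
    define W where "W = Poly_Mapping.keys b"
    have "b = sqf W" using squarefree_eq_sqf[OF True] by (simp add: W_def)
    then show ?thesis using * b by (simp add: upper_koszul_sqf)
  next
    case False
    then obtain v where "\<not> Poly_Mapping.lookup b v \<le> 1" by blast
    then have "2 \<le> Poly_Mapping.lookup b v" by linarith
    from exact_at_not_squarefree[OF this, of \<G> i, where 'k = 'k] show ?thesis .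
  qed
qed

text \<open>
  Only squarefree multidegrees contribute to Tor, so there are finitely many nonzero terms and the maximum
  that defines the regularity is attained.  It is at least \<open>d\<close>: a generator contributes to \<open>Tor\<^sub>0\<close> in
  degree \<open>d\<close>, and no face with \<open>i\<close> elements exists in a multidegree \<open>W\<close> with fewer than \<open>i + d\<close> elements.
\<close>

lemma has_linear_resolution_face_ideal_iff:
  assumes u: "uniform d \<G>" and ne: "\<G> \<noteq> {}"
  shows "has_linear_resolution (face_ideal \<G> :: ('n::{finite,linorder}, 'k::field) mpoly set) \<longleftrightarrow>
    (\<forall>W i. i + d < card W \<longrightarrow> exact_at TYPE('k) (dual_complex \<G> W) i)"
proof -
  let ?I = "face_ideal \<G> :: ('n, 'k) mpoly set"
  define T where "T = {int j - int i | i j. tor_dim i j ?I \<noteq> 0}"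
  have face: "card F + d \<le> card W" if F: "F \<in> dual_complex \<G> W" for F W
  proof -
    obtain A where A: "A \<in> \<G>" "A \<subseteq> W - F" "F \<subseteq> W" using F by (auto simp: dual_complex_def)
    then have "card A + card F \<le> card W"
      by (subst card_Un_disjoint[symmetric]) (auto intro: card_mono)
    then show ?thesis using A u by (simp add: uniform_def)
  qed
  have T: "i + d \<le> j \<and> j \<le> card (UNIV :: 'n set)" if nz: "tor_dim i j ?I \<noteq> 0" for i j
  proof -
    obtain W where W: "card W = j" "\<not> exact_at TYPE('k) (dual_complex \<G> W) i"
      using nz unfolding tor_dim_face_ideal_eq_0_iff by blast
    then obtain F where "F \<in> dual_complex \<G> W" "card F = i" using exact_at_no_faces by blast
    then show ?thesis using face W(1) by (metis card_mono finite subset_UNIV)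
  qed
  have "T \<subseteq> {0..int (card (UNIV :: 'n set))}" unfolding T_def using T by fastforce
  then have fin: "finite T" by (rule finite_subset) simp
  have dT: "int d \<in> T"
  proof -
    obtain A where A: "A \<in> \<G>" using ne by blast
    have "card A = d" using A u by (simp add: uniform_def)
    have faces: "F = {}" if "F \<in> dual_complex \<G> A" for F
      using face[OF that] \<open>card A = d\<close> by simp
    have empty: "{} \<in> dual_complex \<G> A" using A by (auto simp: dual_complex_def)
    define \<phi> :: "'n set \<Rightarrow> 'k" where "\<phi> F = (if F = {} then 1 else 0)" for F
    have "\<phi> \<in> face_chains (dual_complex \<G> A) 0" using empty by (simp add: \<phi>_def face_chains_def)
    moreover have "sbd \<phi> = 0" by (simp add: sbd_def \<phi>_def fun_eq_iff)
    moreover have "sbd \<psi> \<noteq> \<phi>" if "\<psi> \<in> face_chains (dual_complex \<G> A) (Suc 0)" for \<psi>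
    proof -
      have "\<psi> F = 0" for F
      proof (rule ccontr)
        assume "\<psi> F \<noteq> 0"
        then have "F \<in> dual_complex \<G> A" "card F = Suc 0" using that by (auto simp: face_chains_def)
        then show False using faces by fastforce
      qed
      then have "sbd \<psi> {} = 0" by (simp add: sbd_def)
      then show ?thesis by (metis \<phi>_def zero_neq_one)
    qed
    ultimately have "\<not> exact_at TYPE('k) (dual_complex \<G> A) 0" unfolding exact_at_def by blast
    then have "tor_dim 0 d ?I \<noteq> 0" unfolding tor_dim_face_ideal_eq_0_iff using \<open>card A = d\<close> by blast
    then show ?thesis unfolding T_def by force
  qed
  have "reg ?I = int d \<longleftrightarrow> (\<forall>x\<in>T. x \<le> int d)"
    unfolding reg_def T_def[symmetric] using Max_ge[OF fin] Max_eqI[OF fin _ dT] by auto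
  also have "\<dots> \<longleftrightarrow> (\<forall>i j. i + d < j \<longrightarrow> tor_dim i j ?I = 0)"
  proof
    assume le: "\<forall>x\<in>T. x \<le> int d"
    show "\<forall>i j. i + d < j \<longrightarrow> tor_dim i j ?I = 0"
    proof (intro allI impI, rule ccontr)
      fix i j assume "i + d < j" "tor_dim i j ?I \<noteq> 0"
      then have "int j - int i \<le> int d" using le unfolding T_def by blast
      then show False using \<open>i + d < j\<close> by linarith
    qed
  next
    assume z: "\<forall>i j. i + d < j \<longrightarrow> tor_dim i j ?I = 0"
    have "int j - int i \<le> int d" if "tor_dim i j ?I \<noteq> 0" for i j
    proof -
      have "\<not> i + d < j" using z[rule_format, of i j] that by metis
      then show ?thesis by linarith
    qed
    then show "\<forall>x\<in>T. x \<le> int d" unfolding T_def by blast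
  qed
  also have "\<dots> \<longleftrightarrow> (\<forall>W i. i + d < card W \<longrightarrow> exact_at TYPE('k) (dual_complex \<G> W) i)"
    unfolding tor_dim_face_ideal_eq_0_iff by blast
  finally have reg: "reg ?I = int d \<longleftrightarrow> (\<forall>W i. i + d < card W \<longrightarrow> exact_at TYPE('k) (dual_complex \<G> W) i)" .
  have "homogeneous_ideal ?I"
    unfolding homogeneous_ideal_def face_ideal_def
    by (intro exI[of _ "mon ` sqf ` \<G>"]) (auto simp: homogeneous_mon_sqf)
  moreover have "(\<forall>G. min_hom_gens ?I G \<longrightarrow> (\<forall>g\<in>G. homogeneous e g)) \<longleftrightarrow> e = d" for e
  proof
    assume *: "\<forall>G. min_hom_gens ?I G \<longrightarrow> (\<forall>g\<in>G. homogeneous e g)"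
    obtain A where A: "A \<in> \<G>" using ne by blast
    have "homogeneous e (mon (sqf A) :: ('n, 'k) mpoly)" using * min_hom_gens_mon[OF u] A by blast
    then show "e = d" using A u by (simp add: homogeneous_mon_sqf uniform_def)
  qed (use min_hom_gens_face_ideal[OF u] in blast)
  ultimately show ?thesis unfolding has_linear_resolution_def reg[symmetric] by simp
qed

section \<open>Linear quotients\<close>

text \<open>
  The ideal generated by \<open>M\<close>, divided by \<open>u\<close>, has the same monomials as the ideal generated by the
  variables in \<open>V\<close>.  For \<open>M = {}\<close> this holds with \<open>V = {}\<close>, so the first element of a sequence
  needs no special treatment.
\<close>

definition colon_by_variables :: "'n monomial set \<Rightarrow> 'n monomial \<Rightarrow> 'n set \<Rightarrow> bool" where
  "colon_by_variables M u V \<longleftrightarrow> (\<forall>t. (\<exists>s\<in>M. mdvd s (t + u)) \<longleftrightarrow> V \<inter> Poly_Mapping.keys t \<noteq> {})"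

lemma in_colon_ideal_mon:
  fixes f :: "('n, 'k::field) mpoly"
  shows "f \<in> colon_ideal (ideal_gen (mon ` M)) (ideal_gen {mon u}) \<longleftrightarrow>
    (\<forall>t\<in>Poly_Mapping.keys f. \<exists>s\<in>M. mdvd s (t + u))"
proof -
  have "f \<in> colon_ideal (ideal_gen (mon ` M)) (ideal_gen {mon u}) \<longleftrightarrow> mon u * f \<in> ideal_gen (mon ` M)"
  proof
    assume "f \<in> colon_ideal (ideal_gen (mon ` M)) (ideal_gen {mon u})"
    moreover have "mon u \<in> ideal_gen {mon u :: ('n, 'k) mpoly}" by (simp add: ideal.span_base)
    ultimately have "f * mon u \<in> ideal_gen (mon ` M)" unfolding colon_ideal_def by blast
    then show "mon u * f \<in> ideal_gen (mon ` M)" by (simp only: mult.commute)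
  next
    assume *: "mon u * f \<in> ideal_gen (mon ` M)"
    show "f \<in> colon_ideal (ideal_gen (mon ` M)) (ideal_gen {mon u})"
      unfolding colon_ideal_def ideal.span_singleton
    proof clarify
      fix k
      have "f * (k * mon u) = k * (mon u * f)" by (simp add: algebra_simps)
      then show "f * (k * mon u) \<in> ideal_gen (mon ` M)" using ideal.span_scale[OF *, of k] by (simp only:)
    qed
  qed
  also have "\<dots> \<longleftrightarrow> (\<forall>t\<in>Poly_Mapping.keys f. \<exists>s\<in>M. mdvd s (t + u))"
  proof -
    have "Poly_Mapping.keys (mon u * f) = (\<lambda>t. t + u) ` Poly_Mapping.keys f"
    proof (intro set_eqI iffI)
      fix a assume "a \<in> Poly_Mapping.keys (mon u * f)"
      then have "mdvd u a" "a - u \<in> Poly_Mapping.keys f"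
        by (auto simp: in_keys_iff lookup_mon_times split: if_splits)
      then show "a \<in> (\<lambda>t. t + u) ` Poly_Mapping.keys f"
        by (intro image_eqI[of _ _ "a - u"]) (auto simp: mdvd_iff add.commute)
    qed (auto simp: in_keys_iff lookup_mon_times mdvd_iff add.commute)
    then show ?thesis by (simp add: in_ideal_gen_mon_iff)
  qed
  finally show ?thesis .
qed

lemma in_ideal_gen_var:
  fixes f :: "('n, 'k::field) mpoly"
  shows "f \<in> ideal_gen (var ` V) \<longleftrightarrow> (\<forall>t\<in>Poly_Mapping.keys f. V \<inter> Poly_Mapping.keys t \<noteq> {})"
proof -
  have "var ` V = (mon ` (\<lambda>v. Poly_Mapping.single v 1) ` V :: ('n, 'k) mpoly set)"
    by (simp add: var_def image_image)
  moreover have "mdvd (Poly_Mapping.single v 1) t \<longleftrightarrow> v \<in> Poly_Mapping.keys t" for v :: 'n and t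
    by (auto simp: mdvd_def lookup_single when_def in_keys_iff)
  ultimately show ?thesis by (auto simp: in_ideal_gen_mon_iff)
qed

lemma colon_ideal_eq_ideal_gen_var_iff:
  "colon_ideal (ideal_gen (mon ` M)) (ideal_gen {mon u}) = (ideal_gen (var ` V) :: ('n, 'k::field) mpoly set)
    \<longleftrightarrow> colon_by_variables M u V"
  (is "?l \<longleftrightarrow> _")
proof
  assume ?l
  then have "(mon t :: ('n, 'k) mpoly) \<in> colon_ideal (ideal_gen (mon ` M)) (ideal_gen {mon u}) \<longleftrightarrow>
      (mon t :: ('n, 'k) mpoly) \<in> ideal_gen (var ` V)" for t by simp
  moreover have "Poly_Mapping.keys (mon t :: ('n, 'k) mpoly) = {t}" for t by (simp add: mon_def)
  ultimately show "colon_by_variables M u V"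
    unfolding in_colon_ideal_mon in_ideal_gen_var colon_by_variables_def by simp
next
  assume "colon_by_variables M u V"
  then show ?l unfolding set_eq_iff in_colon_ideal_mon in_ideal_gen_var colon_by_variables_def by simp
qed

lemma has_linear_quotients_iff:
  "has_linear_quotients (I :: ('n, 'k::field) mpoly set) \<longleftrightarrow> (\<exists>us. distinct us \<and> set us = min_mons I \<and>
    (\<forall>i<length us. \<exists>V. colon_by_variables (set (take i us)) (us ! i) V))"
proof -
  have "colon_by_variables {} u {}" for u :: "'n monomial" by (simp add: colon_by_variables_def)
  then have "(\<forall>i<length us. \<exists>V. colon_by_variables (set (take i us)) (us ! i) V) \<longleftrightarrow>
    (\<forall>i. 1 \<le> i \<and> i < length us \<longrightarrow> (\<exists>V. colon_by_variables (set (take i us)) (us ! i) V))" for us :: "'n monomial list"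
    by (metis One_nat_def Suc_leI not_gr_zero set_empty take_0)
  then show ?thesis
    unfolding has_linear_quotients_def colon_ideal_eq_ideal_gen_var_iff by presburger
qed

text \<open>
  The generator \<open>A\<close> adds to the dual complex of \<open>W\<close> the faces between \<open>V \<inter> (W - A)\<close> and \<open>W - A\<close>.
  If there is more than one of them, they can be paired by toggling an element of \<open>W - A\<close> outside \<open>V\<close>.
  Otherwise the only new face is \<open>W - A\<close> with \<open>card W - d\<close> elements, more than \<open>i\<close>, so the chains in
  position \<open>i\<close> remain the same.
\<close>

lemma exact_at_add_generator:
  assumes card: "card A = d"
    and V: "\<And>T. (\<exists>B\<in>\<G>. B \<subseteq> T \<union> A) \<longleftrightarrow> V \<inter> T \<noteq> {}"
    and ex: "exact_at TYPE('k::field) (dual_complex \<G> W) i"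
    and i: "i + d < card W"
  shows "exact_at TYPE('k) (dual_complex (insert A \<G>) W) i"
proof (cases "A \<subseteq> W")
  case False
  then have "dual_complex (insert A \<G>) W = dual_complex \<G> W" by (auto simp: dual_complex_def)
  then show ?thesis using ex by simp
next
  case True
  let ?\<Gamma> = "dual_complex (insert A \<G>) W" and ?\<Gamma>' = "dual_complex \<G> W"
  have sub: "?\<Gamma>' \<subseteq> ?\<Gamma>" by (auto simp: dual_complex_def)
  have new: "F \<in> ?\<Gamma> - ?\<Gamma>' \<longleftrightarrow> F \<subseteq> W - A \<and> V \<inter> (W - A) \<subseteq> F" for F
  proof (cases "F \<subseteq> W - A")
    case F: True
    then have "W - F = (W - F - A) \<union> A" using True by blast
    then have "(\<exists>B\<in>\<G>. B \<subseteq> W - F) \<longleftrightarrow> V \<inter> (W - F - A) \<noteq> {}" using V[of "W - F - A"] by simp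
    then show ?thesis using F True by (auto simp: dual_complex_def)
  next
    case False
    then show ?thesis using True by (auto simp: dual_complex_def)
  qed
  show ?thesis
  proof (cases "W - A \<subseteq> V")
    case False
    then obtain m where m: "m \<in> W - A" "m \<notin> V" by blast
    show ?thesis
    proof (rule exact_at_collapse[OF sub down_closed_dual_complex down_closed_dual_complex _ ex])
      show "F \<in> ?\<Gamma> - ?\<Gamma>' \<longleftrightarrow> insert m F \<in> ?\<Gamma> - ?\<Gamma>'" if "m \<notin> F" for F
        unfolding new using m that by blast
    qed
  next
    case VA: True
    have "card (W - A) + d = card W"
      using True card by (metis add.commute card_Diff_subset card_mono finite le_add_diff_inverse)
    then have "card (W - A) \<noteq> i" using i by simp
    have old: "F \<in> ?\<Gamma>'" if "F \<in> ?\<Gamma>" "card F = i" for F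
    proof (rule ccontr)
      assume "F \<notin> ?\<Gamma>'"
      then have "F = W - A" using new[of F] that(1) VA by blast
      then show False using that(2) \<open>card (W - A) \<noteq> i\<close> by simp
    qed
    show ?thesis
      unfolding exact_at_def
    proof (intro allI impI)
      fix \<phi> :: "'a set \<Rightarrow> 'k" assume \<phi>: "\<phi> \<in> face_chains ?\<Gamma> i" "sbd \<phi> = 0"
      then have "\<phi> \<in> face_chains ?\<Gamma>' i" using old unfolding face_chains_def by blast
      then obtain \<psi> where "\<psi> \<in> face_chains ?\<Gamma>' (Suc i)" "sbd \<psi> = \<phi>"
        using ex \<phi>(2) unfolding exact_at_def by blast
      then show "\<exists>\<psi>\<in>face_chains ?\<Gamma> (Suc i). sbd \<psi> = \<phi>"
        using sub unfolding face_chains_def by blast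
    qed
  qed
qed

text \<open>
  The ideal is built up one generator at a time, in the order of the linear quotients, starting with the
  zero ideal, whose dual complexes are empty.
\<close>

lemma linear_quotients_imp_linear_resolution:
  assumes u: "uniform d \<G>" and ne: "\<G> \<noteq> {}"
    and lq: "has_linear_quotients (face_ideal \<G> :: ('n::{finite,linorder}, 'k::field) mpoly set)"
  shows "has_linear_resolution (face_ideal \<G> :: ('n, 'k) mpoly set)"
proof -
  obtain us where us: "set us = sqf ` \<G>"
    "\<And>i. i < length us \<Longrightarrow> \<exists>V. colon_by_variables (set (take i us)) (us ! i) V"
    using lq unfolding has_linear_quotients_iff min_mons_face_ideal[OF u] by blast
  have keys: "Poly_Mapping.keys ` set us = \<G>" unfolding us(1) by (simp add: image_image)
  have exact: "exact_at TYPE('k) (dual_complex (Poly_Mapping.keys ` set (take k us)) W) i"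
    if "k \<le> length us" "i + d < card W" for k W i
    using that(1)
  proof (induction k)
    case 0
    show ?case by (rule exact_at_no_faces) (simp add: dual_complex_def)
  next
    case (Suc k)
    then have k: "k < length us" by simp
    obtain V where V: "colon_by_variables (set (take k us)) (us ! k) V" using us(2)[OF k] by blast
    obtain A where A: "A \<in> \<G>" "us ! k = sqf A" using us(1) k nth_mem by blast
    have sq: "\<exists>B. s = sqf B" if "s \<in> set (take k us)" for s
      using that us(1) by (metis imageE in_set_takeD)
    have colon: "(\<exists>B\<in>Poly_Mapping.keys ` set (take k us). B \<subseteq> T \<union> A) \<longleftrightarrow> V \<inter> T \<noteq> {}" for T
    proof -
      have "v \<in> Poly_Mapping.keys (sqf T + sqf A) \<longleftrightarrow> v \<in> T \<union> A" for v
        by (simp add: in_keys_iff lookup_add)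
      then have "Poly_Mapping.keys (sqf T + sqf A) = T \<union> A" by blast
      then have "mdvd s (sqf T + sqf A) \<longleftrightarrow> Poly_Mapping.keys s \<subseteq> T \<union> A" if "s \<in> set (take k us)" for s
        using sq[OF that] by (metis keys_sqf mdvd_sqf)
      then have "(\<exists>B\<in>Poly_Mapping.keys ` set (take k us). B \<subseteq> T \<union> A) \<longleftrightarrow>
        (\<exists>s\<in>set (take k us). mdvd s (sqf T + us ! k))" by (simp add: A(2))
      also have "\<dots> \<longleftrightarrow> V \<inter> Poly_Mapping.keys (sqf T) \<noteq> {}"
        using V unfolding colon_by_variables_def by (rule allE)
      finally show ?thesis by simp
    qed
    have "card A = d" using A u by (simp add: uniform_def)
    from exact_at_add_generator[OF this colon Suc.IH that(2)]
    have "exact_at TYPE('k) (dual_complex (insert A (Poly_Mapping.keys ` set (take k us))) W) i"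
      using k by simp
    moreover have "insert A (Poly_Mapping.keys ` set (take k us)) = Poly_Mapping.keys ` set (take (Suc k) us)"
      using k A by (simp add: take_Suc_conv_app_nth)
    ultimately show ?case by simp
  qed
  show ?thesis
    unfolding has_linear_resolution_face_ideal_iff[OF u ne]
    using exact[of "length us"] keys by simp
qed


section \<open>Vertex splittable ideals have linear quotients\<close>

lemma min_mons_ideal_gen_mon:
  "min_mons (ideal_gen {mon u} :: ('n, 'k::field) mpoly set) = {u}"
proof -
  have "(mon t :: ('n, 'k) mpoly) \<in> ideal_gen {mon u} \<longleftrightarrow> mdvd u t" for t
    using mon_in_ideal_gen_iff[of t "{u}"] by simp
  then have "t \<in> min_mons (ideal_gen {mon u} :: ('n, 'k) mpoly set) \<longleftrightarrow> t = u" for t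
    unfolding min_mons_def mem_Collect_eq using mdvd_refl[of u] mdvd_antisym by metis
  then show ?thesis by blast
qed

lemma ideal_gen_1: "ideal_gen {mon 0} = (UNIV :: ('n, 'k::field) mpoly set)"
proof -
  have "f \<in> ideal_gen {mon 0}" for f :: "('n, 'k) mpoly"
    using in_ideal_gen_mon_iff[of f "{0}"] by (simp add: mdvd_def)
  then show ?thesis by blast
qed

lemma mon_eq_var_times_iff:
  fixes f :: "('n, 'k::field) mpoly"
  shows "mon t = var x * f \<longleftrightarrow> x \<in> Poly_Mapping.keys t \<and> f = mon (t - Poly_Mapping.single x 1)"
proof
  let ?x = "Poly_Mapping.single x (1::nat)"
  assume eq: "mon t = var x * f"
  have "Poly_Mapping.lookup (var x * f) t = 1" unfolding eq[symmetric] by (simp add: lookup_mon)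
  then have x: "x \<in> Poly_Mapping.keys t" by (auto simp: lookup_var_times split: if_splits)
  have tx: "t - ?x + ?x = t"
    using minus_single_add[OF x, of x] by (metis add_diff_cancel_right')
  have "Poly_Mapping.lookup f a = Poly_Mapping.lookup (mon (t - ?x)) a" for a
  proof -
    have "x \<in> Poly_Mapping.keys (a + ?x)" by (simp add: in_keys_iff lookup_add)
    then have "Poly_Mapping.lookup f a = Poly_Mapping.lookup (mon t :: ('n, 'k) mpoly) (a + ?x)"
      unfolding eq lookup_var_times by simp
    also have "\<dots> = Poly_Mapping.lookup (mon (t - ?x)) a"
      using tx by (auto simp: lookup_mon when_def)
    finally show ?thesis .
  qed
  then show "x \<in> Poly_Mapping.keys t \<and> f = mon (t - ?x)" using x by (auto intro: poly_mapping_eqI)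
next
  let ?x = "Poly_Mapping.single x (1::nat)"
  assume *: "x \<in> Poly_Mapping.keys t \<and> f = mon (t - ?x)"
  then have "?x + (t - ?x) = t"
    using minus_single_add[of x t x] by (metis add_diff_cancel_right' add.commute)
  then show "mon t = var x * f" using * by (simp add: var_def mon_times_mon)
qed

lemma min_mons_var_times:
  "min_mons ((*) (var x) ` I :: ('n, 'k::field) mpoly set) = (+) (Poly_Mapping.single x 1) ` min_mons I"
proof -
  let ?x = "Poly_Mapping.single x (1::nat)"
  have keys: "x \<in> Poly_Mapping.keys (?x + t)" for t by (simp add: in_keys_iff lookup_add)
  have mem: "(mon t :: ('n, 'k) mpoly) \<in> (*) (var x) ` I \<longleftrightarrow> (\<exists>r. t = ?x + r \<and> mon r \<in> I)" for t
  proof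
    assume "(mon t :: ('n, 'k) mpoly) \<in> (*) (var x) ` I"
    then obtain f where f: "mon t = var x * f" "f \<in> I" by blast
    then have "x \<in> Poly_Mapping.keys t" "f = mon (t - ?x)" by (simp_all add: mon_eq_var_times_iff)
    moreover from this have "t = ?x + (t - ?x)"
      using minus_single_add[of x t x] by (metis add_diff_cancel_right' add.commute)
    ultimately show "\<exists>r. t = ?x + r \<and> mon r \<in> I" using f(2) by blast
  next
    assume "\<exists>r. t = ?x + r \<and> mon r \<in> I"
    then obtain r where "(mon t :: ('n, 'k) mpoly) = var x * mon r" "mon r \<in> I"
      by (auto simp: var_def mon_times_mon)
    then show "(mon t :: ('n, 'k) mpoly) \<in> (*) (var x) ` I" by blast
  qed
  have dvd: "mdvd (?x + s) (?x + t) \<longleftrightarrow> mdvd s t" for s t by (simp add: mdvd_def lookup_add)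
  have "?x + r \<in> min_mons ((*) (var x) ` I) \<longleftrightarrow> r \<in> min_mons I" for r
  proof
    assume r: "?x + r \<in> min_mons ((*) (var x) ` I)"
    have "s = r" if "mon s \<in> I" "mdvd s r" for s
    proof -
      have "(mon (?x + s) :: ('n, 'k) mpoly) \<in> (*) (var x) ` I" using mem that(1) by blast
      moreover have "mdvd (?x + s) (?x + r)" using that(2) by (simp only: dvd)
      ultimately have "?x + s = ?x + r" using r unfolding min_mons_def mem_Collect_eq by blast
      then show ?thesis by simp
    qed
    moreover have "mon r \<in> I"
    proof -
      have "(mon (?x + r) :: ('n, 'k) mpoly) \<in> (*) (var x) ` I" using r unfolding min_mons_def by blast
      then obtain q where "?x + r = ?x + q" "mon q \<in> I" unfolding mem by (elim exE conjE)
      then show ?thesis by simp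
    qed
    ultimately show "r \<in> min_mons I" unfolding min_mons_def by blast
  next
    assume r: "r \<in> min_mons I"
    have "s = ?x + r" if s: "(mon s :: ('n, 'k) mpoly) \<in> (*) (var x) ` I" "mdvd s (?x + r)" for s
    proof -
      obtain q where q: "s = ?x + q" "mon q \<in> I" using s(1) unfolding mem by (elim exE conjE)
      then have "mdvd q r" using s(2) by (simp only: dvd)
      then show ?thesis using r q unfolding min_mons_def by blast
    qed
    moreover have "(mon (?x + r) :: ('n, 'k) mpoly) \<in> (*) (var x) ` I"
      using r mem unfolding min_mons_def by blast
    ultimately show "?x + r \<in> min_mons ((*) (var x) ` I)" unfolding min_mons_def by blast
  qed
  moreover have "\<exists>r. t = ?x + r" if "t \<in> min_mons ((*) (var x) ` I)" for t
    using that unfolding min_mons_def mem by blast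
  ultimately show ?thesis by blast
qed

text \<open>
  For \<open>I = x I1 + I2\<close>, take the generators of \<open>I1\<close> times \<open>x\<close>, followed by those of \<open>I2\<close>.  Let \<open>v\<close> be a
  generator of \<open>I2\<close>.  It is not divisible by \<open>x\<close>, and it lies in \<open>I1\<close>, so \<open>x v\<close> is a multiple of one of the
  first generators.  Therefore the first block contributes exactly the variable \<open>x\<close> to the colon
  ideal at \<open>v\<close>.
\<close>

lemma vertex_splittable_imp_linear_quotients:
  fixes I :: "('n::finite, 'k::field) mpoly set"
  assumes "vertex_splittable V I"
  shows "(\<forall>t\<in>min_mons I. Poly_Mapping.keys t \<subseteq> V) \<and> has_linear_quotients I"
  using assms
proof induction
  case (principal u V)
  then show ?case
    unfolding has_linear_quotients_iff min_mons_ideal_gen_mon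
    by (intro conjI exI[of _ "[u]"]) (auto simp: colon_by_variables_def)
next
  case (zero V)
  have "(mon t :: ('n, 'k) mpoly) \<noteq> 0" for t
    by (metis lookup_mon lookup_zero when_simps(1) zero_neq_one)
  then have "min_mons {0 :: ('n, 'k) mpoly} = {}" by (simp add: min_mons_def)
  then show ?case
    unfolding has_linear_quotients_iff by (intro conjI exI[of _ "[]"]) auto
next
  case (whole V)
  then show ?case
    unfolding has_linear_quotients_iff ideal_gen_1[symmetric] min_mons_ideal_gen_mon
    by (intro conjI exI[of _ "[0]"]) (auto simp: colon_by_variables_def)
next
  case (split x V I1 I2 I)
  let ?x = "Poly_Mapping.single x (1::nat)"
  obtain us where us: "distinct us" "set us = min_mons I1"
    "\<And>i. i < length us \<Longrightarrow> \<exists>V. colon_by_variables (set (take i us)) (us ! i) V"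
    using split.IH unfolding has_linear_quotients_iff by blast
  obtain vs where vs: "distinct vs" "set vs = min_mons I2"
    "\<And>i. i < length vs \<Longrightarrow> \<exists>V. colon_by_variables (set (take i vs)) (vs ! i) V"
    using split.IH unfolding has_linear_quotients_iff by blast
  have I: "min_mons I = (+) ?x ` set us \<union> set vs" and disj: "(+) ?x ` set us \<inter> set vs = {}"
    using split.hyps us(2) vs(2) by (simp_all add: min_mons_var_times)
  let ?ws = "map ((+) ?x) us @ vs"
  have dvd: "mdvd (?x + s) (t + (?x + r)) \<longleftrightarrow> mdvd s (t + r)" for s t r
    by (simp add: mdvd_def lookup_add)
  have "\<exists>V. colon_by_variables (set (take i ?ws)) (?ws ! i) V" if i: "i < length ?ws" for i
  proof (cases "i < length us")
    case True
    then obtain V where "colon_by_variables (set (take i us)) (us ! i) V" using us(3) by blast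
    then have "colon_by_variables ((+) ?x ` set (take i us)) (?x + us ! i) V"
      by (simp add: colon_by_variables_def dvd[unfolded One_nat_def])
    then show ?thesis using True by (auto simp: nth_append take_map)
  next
    case False
    define j where "j = i - length us"
    have j: "i = length us + j" "j < length vs" using False i by (simp_all add: j_def)
    obtain V' where V': "colon_by_variables (set (take j vs)) (vs ! j) V'" using vs(3) j by blast
    have v: "vs ! j \<in> min_mons I2" using vs(2) j(2) nth_mem by blast
    then have x: "x \<notin> Poly_Mapping.keys (vs ! j)" using split.IH by blast
    have "mon (vs ! j) \<in> I1" using v split.hyps by (auto simp: min_mons_def)
    then obtain s where s: "s \<in> set us" "mdvd s (vs ! j)" using min_mons_dvd us(2) by blast
    have "(\<exists>r\<in>(+) ?x ` set us. mdvd r (t + vs ! j)) \<longleftrightarrow> x \<in> Poly_Mapping.keys t" for t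
    proof
      assume "\<exists>r\<in>(+) ?x ` set us. mdvd r (t + vs ! j)"
      then obtain r where "mdvd (?x + r) (t + vs ! j)" by blast
      then have "Poly_Mapping.lookup (?x + r) x \<le> Poly_Mapping.lookup (t + vs ! j) x"
        unfolding mdvd_def by blast
      then show "x \<in> Poly_Mapping.keys t" using x by (simp add: lookup_add in_keys_iff)
    next
      assume "x \<in> Poly_Mapping.keys t"
      then have "Poly_Mapping.lookup ?x v \<le> Poly_Mapping.lookup t v" for v
        by (auto simp: lookup_single when_def in_keys_iff)
      then have "mdvd (?x + s) (t + vs ! j)"
        using s(2) unfolding mdvd_def lookup_add by (meson add_mono)
      then show "\<exists>r\<in>(+) ?x ` set us. mdvd r (t + vs ! j)" using s(1) by blast
    qed
    then have "colon_by_variables ((+) ?x ` set us \<union> set (take j vs)) (vs ! j) (insert x V')"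
      using V' unfolding colon_by_variables_def by blast
    then show ?thesis using j by (auto simp: nth_append)
  qed
  moreover have "distinct ?ws" using us(1) vs(1) disj by (simp add: distinct_map)
  moreover have "Poly_Mapping.keys t \<subseteq> V" if "t \<in> min_mons I" for t
  proof -
    have "Poly_Mapping.keys (?x + r) \<subseteq> insert x (Poly_Mapping.keys r)" for r
      by (auto simp: in_keys_iff lookup_add lookup_single when_def split: if_splits)
    then show ?thesis using that split.IH split.hyps(1) unfolding I us(2) vs(2) by blast
  qed
  ultimately show ?case
    unfolding has_linear_quotients_iff I by (intro conjI exI[of _ ?ws]) auto
qed

section \<open>Splitting families of sets\<close>

lemma vertex_splittable_mono:
  assumes "vertex_splittable V I" "V \<subseteq> V'"
  shows "vertex_splittable V' I"
  using assms
proof (induction arbitrary: V')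
  case (principal u V)
  then show ?case by (intro vertex_splittable.principal) auto
next
  case (split x V I1 I2 I)
  have "vertex_splittable V' I1" by (rule split.IH(1)[OF split.prems])
  moreover have "vertex_splittable (V' - {x}) I2" by (rule split.IH(2)) (use split.prems in blast)
  moreover have "x \<in> V'" using split.hyps(1) split.prems by blast
  ultimately show ?case using split.hyps by (intro vertex_splittable.split[of x V' I1 I2 I])
qed (auto intro: vertex_splittable.intros)

lemma vertex_splittable_face_ideal_at_most_one:
  assumes "\<G> \<subseteq> {A}" "A \<subseteq> V"
  shows "vertex_splittable V (face_ideal \<G> :: ('n::finite, 'k::field) mpoly set)"
proof (cases "\<G> = {}")
  case True
  then show ?thesis using vertex_splittable.zero by (simp add: face_ideal_def)
next
  case False
  then have "\<G> = {A}" using assms(1) by blast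
  then show ?thesis using assms(2) vertex_splittable.principal[of "sqf A" V] by (simp add: face_ideal_def)
qed

lemma vertex_splittable_split_faces:
  fixes \<A> \<B> :: "'n::finite set set"
  assumes x: "x \<in> V" "\<And>A. A \<in> \<A> \<Longrightarrow> x \<notin> A" "\<And>B. B \<in> \<B> \<Longrightarrow> x \<notin> B"
    and u: "uniform e \<A>" "uniform (Suc e) \<B>"
    and vs: "vertex_splittable V (face_ideal \<A> :: ('n, 'k::field) mpoly set)"
      "vertex_splittable (V - {x}) (face_ideal \<B> :: ('n, 'k) mpoly set)"
    and sub: "\<And>B. B \<in> \<B> \<Longrightarrow> \<exists>A\<in>\<A>. A \<subseteq> B"
  shows "vertex_splittable V (face_ideal (insert x ` \<A> \<union> \<B>) :: ('n, 'k) mpoly set)"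
proof (rule vertex_splittable.split[OF x(1) vs])
  let ?I1 = "face_ideal \<A> :: ('n, 'k) mpoly set" and ?I2 = "face_ideal \<B> :: ('n, 'k) mpoly set"
  let ?I = "face_ideal (insert x ` \<A> \<union> \<B>) :: ('n, 'k) mpoly set"
  show I21: "?I2 \<subseteq> ?I1"
  proof
    fix f assume f: "f \<in> ?I2"
    show "f \<in> ?I1"
      unfolding in_face_ideal
    proof
      fix t assume "t \<in> Poly_Mapping.keys f"
      then obtain B where "B \<in> \<B>" "B \<subseteq> Poly_Mapping.keys t" using f unfolding in_face_ideal by blast
      then show "\<exists>A\<in>\<A>. A \<subseteq> Poly_Mapping.keys t" using sub by (meson order_trans)
    qed
  qed
  have "uniform (Suc e) (insert x ` \<A>)"
    using u(1) x(2) by (auto simp: uniform_def)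
  then have uI: "uniform (Suc e) (insert x ` \<A> \<union> \<B>)" using u(2) by (auto simp: uniform_def)
  have m1: "min_mons ((*) (var x) ` ?I1) = sqf ` insert x ` \<A>"
    unfolding min_mons_var_times min_mons_face_ideal[OF u(1)] image_image
    by (rule image_cong) (use x(2) in \<open>simp_all add: sqf_insert\<close>)
  show "min_mons ?I = min_mons ((*) (var x) ` ?I1) \<union> min_mons ?I2"
    unfolding m1 min_mons_face_ideal[OF uI] min_mons_face_ideal[OF u(2)] by (simp only: image_Un)
  show "min_mons ((*) (var x) ` ?I1) \<inter> min_mons ?I2 = {}"
    unfolding m1 min_mons_face_ideal[OF u(2)] using x(3)[of "insert x _"] by (auto simp: image_iff)
  let ?R = "{var x * f + g | f g. f \<in> ?I1 \<and> g \<in> ?I2}"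
  have xI: "var x * f \<in> ?I" if f: "f \<in> ?I1" for f
    unfolding in_face_ideal
  proof
    fix t assume "t \<in> Poly_Mapping.keys (var x * f)"
    then have t: "x \<in> Poly_Mapping.keys t" "t - Poly_Mapping.single x 1 \<in> Poly_Mapping.keys f"
      by (auto simp: in_keys_iff lookup_var_times split: if_splits)
    then obtain A where A: "A \<in> \<A>" "A \<subseteq> Poly_Mapping.keys (t - Poly_Mapping.single x 1)"
      using f unfolding in_face_ideal by blast
    then have "insert x A \<subseteq> Poly_Mapping.keys t"
      using keys_minus_single_insert[OF t(1)] by blast
    then show "\<exists>A\<in>insert x ` \<A> \<union> \<B>. A \<subseteq> Poly_Mapping.keys t" using A(1) by blast
  qed
  have I2I: "g \<in> ?I" if "g \<in> ?I2" for g
    using that unfolding in_face_ideal by blast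
  show "?I = ?R"
  proof
    show "?I \<subseteq> ?R"
      unfolding face_ideal_def[of "insert x ` \<A> \<union> \<B>"]
    proof (rule ideal.span_minimal)
      show "mon ` sqf ` (insert x ` \<A> \<union> \<B>) \<subseteq> ?R"
      proof
        fix p :: "('n, 'k) mpoly" assume "p \<in> mon ` sqf ` (insert x ` \<A> \<union> \<B>)"
        then consider A where "A \<in> \<A>" "p = mon (sqf (insert x A))" | B where "B \<in> \<B>" "p = mon (sqf B)"
          by auto
        then show "p \<in> ?R"
        proof cases
          case 1
          then have "p = var x * mon (sqf A) + 0"
            using x(2) by (simp add: sqf_insert var_def mon_times_mon)
          moreover have "mon (sqf A) \<in> ?I1" using 1(1) by (auto simp: mon_in_face_ideal)
          moreover have "0 \<in> ?I2" using ideal.subspace_0[OF is_ideal_face_ideal] .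
          ultimately show ?thesis by blast
        next
          case 2
          then have "p = var x * 0 + mon (sqf B)" by simp
          moreover have "mon (sqf B) \<in> ?I2" using 2(1) by (auto simp: mon_in_face_ideal)
          moreover have "0 \<in> ?I1" using ideal.subspace_0[OF is_ideal_face_ideal] .
          ultimately show ?thesis by blast
        qed
      qed
      show "is_ideal ?R"
      proof (rule ideal.subspaceI)
        have "(0 :: ('n, 'k) mpoly) = var x * 0 + 0" by simp
        then show "0 \<in> ?R" using ideal.subspace_0[OF is_ideal_face_ideal] by blast
      next
        fix p q assume "p \<in> ?R" "q \<in> ?R"
        then obtain f g f' g' where *: "p = var x * f + g" "f \<in> ?I1" "g \<in> ?I2"
          "q = var x * f' + g'" "f' \<in> ?I1" "g' \<in> ?I2" by blast
        then have "p + q = var x * (f + f') + (g + g')" by (simp add: algebra_simps)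
        moreover have "f + f' \<in> ?I1" "g + g' \<in> ?I2"
          using * by (simp_all add: ideal.subspace_add[OF is_ideal_face_ideal])
        ultimately show "p + q \<in> ?R" by blast
      next
        fix c p assume "p \<in> ?R"
        then obtain f g where *: "p = var x * f + g" "f \<in> ?I1" "g \<in> ?I2" by blast
        then have "c * p = var x * (c * f) + c * g" by (simp add: algebra_simps)
        moreover have "c * f \<in> ?I1" "c * g \<in> ?I2"
          using * by (simp_all add: ideal.subspace_scale[OF is_ideal_face_ideal])
        ultimately show "c * p \<in> ?R" by blast
      qed
    qed
    show "?R \<subseteq> ?I"
    proof clarify
      fix f g assume "f \<in> ?I1" "g \<in> ?I2"
      then show "var x * f + g \<in> ?I"
        by (intro ideal.subspace_add[OF is_ideal_face_ideal] xI I2I)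
    qed
  qed
qed

lemma vertex_splittable_variables:
  "vertex_splittable V (face_ideal ((\<lambda>y. {y}) ` B) :: ('n::finite, 'k::field) mpoly set)" if "B \<subseteq> V"
  using finite[of B] that
proof (induction B arbitrary: V rule: finite_induct)
  case empty
  show ?case by (rule vertex_splittable_face_ideal_at_most_one[where A = "{}"]) auto
next
  case (insert x B)
  have "vertex_splittable V (face_ideal (insert x ` {{}} \<union> (\<lambda>y. {y}) ` B) :: ('n, 'k) mpoly set)"
  proof (rule vertex_splittable_split_faces[where e = 0])
    show "vertex_splittable V (face_ideal {{}} :: ('n, 'k) mpoly set)"
      by (rule vertex_splittable_face_ideal_at_most_one[where A = "{}"]) auto
    show "vertex_splittable (V - {x}) (face_ideal ((\<lambda>y. {y}) ` B) :: ('n, 'k) mpoly set)"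
      by (rule insert.IH) (use insert in blast)
  qed (use insert in \<open>auto simp: uniform_def\<close>)
  then show ?case by simp
qed


section \<open>Families of complements\<close>

text \<open>
  For ideals generated in high degree the complements \<open>D\<close> of the generators are small and easier to
  describe.  Splitting off \<open>x\<close> separates the sets \<open>D\<close> without \<open>x\<close> from those that contain it.
\<close>

definition complements :: "'n set \<Rightarrow> nat \<Rightarrow> ('n set \<Rightarrow> bool) \<Rightarrow> 'n set set" where
  "complements V k P = (\<lambda>D. V - D) ` {D. D \<subseteq> V \<and> card D = k \<and> P D}"

lemma complements_cong:
  "(\<And>D. D \<subseteq> V \<Longrightarrow> card D = k \<Longrightarrow> P D \<longleftrightarrow> Q D) \<Longrightarrow> complements V k P = complements V k Q"
  unfolding complements_def by (intro image_cong Collect_cong) auto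

lemma uniform_complements:
  fixes V :: "'n::finite set"
  shows "uniform (card V - k) (complements V k P)"
  by (auto simp: uniform_def complements_def card_Diff_subset)

lemma vertex_splittable_complements_trivial:
  fixes V :: "'n::finite set"
  assumes "k = 0 \<or> card V \<le> k"
  shows "vertex_splittable V (face_ideal (complements V k P) :: ('n, 'k::field) mpoly set)"
proof (cases "k = 0")
  case True
  then show ?thesis
    by (intro vertex_splittable_face_ideal_at_most_one[where A = V]) (auto simp: complements_def)
next
  case False
  then have "card V \<le> k" using assms by simp
  then have "D = V" if "D \<subseteq> V" "card D = k" for D
    using that by (metis card_mono card_subset_eq finite le_antisym)
  then show ?thesis
    by (intro vertex_splittable_face_ideal_at_most_one[where A = "{}"]) (auto simp: complements_def)
qed

text \<open>
  A generator is divisible by \<open>x\<close> if its complement \<open>D\<close> avoids \<open>x\<close>.  As complementation reverses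
  inclusion, the containment between the two ideals of a splitting says that every \<open>D\<close> from the second
  family can be enlarged to a member of the first.
\<close>

lemma vertex_splittable_complements_split:
  fixes V :: "'n::finite set"
  assumes x: "x \<in> V" and k: "Suc k < card V"
    and del: "vertex_splittable (V - {x}) (face_ideal (complements (V - {x}) (Suc k) P) :: ('n, 'k::field) mpoly set)"
    and con: "vertex_splittable (V - {x}) (face_ideal (complements (V - {x}) k (\<lambda>D. P (insert x D))) :: ('n, 'k) mpoly set)"
    and ext: "\<And>D. D \<subseteq> V - {x} \<Longrightarrow> card D = k \<Longrightarrow> P (insert x D) \<Longrightarrow>
      \<exists>D'. D \<subseteq> D' \<and> D' \<subseteq> V - {x} \<and> card D' = Suc k \<and> P D'"
  shows "vertex_splittable V (face_ideal (complements V (Suc k) P) :: ('n, 'k) mpoly set)"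
proof -
  let ?A = "complements (V - {x}) (Suc k) P" and ?B = "complements (V - {x}) k (\<lambda>D. P (insert x D))"
  have cV: "card (V - {x}) = card V - 1" using x by simp
  have e: "card (V - {x}) - k = Suc (card (V - {x}) - Suc k)" using k cV by simp
  have "complements V (Suc k) P = insert x ` ?A \<union> ?B"
  proof (intro set_eqI iffI)
    fix A assume "A \<in> complements V (Suc k) P"
    then obtain D where D: "A = V - D" "D \<subseteq> V" "card D = Suc k" "P D" by (auto simp: complements_def)
    show "A \<in> insert x ` ?A \<union> ?B"
    proof (cases "x \<in> D")
      case True
      have "card (D - {x}) = k" using D True by simp
      moreover have "A = (V - {x}) - (D - {x})" using D True by blast
      moreover have "insert x (D - {x}) = D" using True by blast
      ultimately have "A \<in> ?B" unfolding complements_def using D by (intro image_eqI[of _ _ "D - {x}"]) auto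
      then show ?thesis ..
    next
      case False
      then have "V - {x} - D \<in> ?A" unfolding complements_def using D by blast
      moreover have "A = insert x (V - {x} - D)" using D False x by blast
      ultimately show ?thesis by blast
    qed
  next
    fix A assume "A \<in> insert x ` ?A \<union> ?B"
    then consider D where "A = insert x (V - {x} - D)" "D \<subseteq> V - {x}" "card D = Suc k" "P D"
      | D where "A = V - {x} - D" "D \<subseteq> V - {x}" "card D = k" "P (insert x D)"
      by (auto simp: complements_def)
    then show "A \<in> complements V (Suc k) P"
    proof cases
      case 1
      then have "A = V - D" using x by blast
      then show ?thesis unfolding complements_def using 1 by blast
    next
      case 2
      then have "A = V - insert x D" "insert x D \<subseteq> V" using x by blast+
      moreover have "card (insert x D) = Suc k" using 2 by (simp add: card_insert_if subset_Diff_insert)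
      ultimately show ?thesis unfolding complements_def using 2 by blast
    qed
  qed
  moreover have "vertex_splittable V (face_ideal (insert x ` ?A \<union> ?B) :: ('n, 'k) mpoly set)"
  proof (rule vertex_splittable_split_faces[OF x _ _ uniform_complements])
    show "uniform (Suc (card (V - {x}) - Suc k)) ?B" using uniform_complements[of "V - {x}" k] e by simp
    show "vertex_splittable V (face_ideal ?A :: ('n, 'k) mpoly set)"
      by (rule vertex_splittable_mono[OF del]) blast
    show "\<exists>A\<in>?A. A \<subseteq> B" if "B \<in> ?B" for B
    proof -
      obtain D where D: "B = V - {x} - D" "D \<subseteq> V - {x}" "card D = k" "P (insert x D)"
        using \<open>B \<in> ?B\<close> by (auto simp: complements_def)
      obtain D' where D': "D \<subseteq> D'" "D' \<subseteq> V - {x}" "card D' = Suc k" "P D'"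
        using ext[OF D(2-4)] by blast
      then have "V - {x} - D' \<in> ?A" unfolding complements_def by blast
      moreover have "V - {x} - D' \<subseteq> B" using D D' by blast
      ultimately show ?thesis by blast
    qed
  qed (use con in \<open>auto simp: complements_def\<close>)
  ultimately show ?thesis by simp
qed

lemma extend_by_one:
  fixes D U :: "'n::finite set"
  assumes "D \<subseteq> U" "card D = k" "k < card U"
  shows "\<exists>D'. D \<subseteq> D' \<and> D' \<subseteq> U \<and> card D' = Suc k"
proof -
  obtain y where y: "y \<in> U" "y \<notin> D" using assms by (metis less_irrefl subsetI subset_antisym)
  then show ?thesis using assms by (intro exI[of _ "insert y D"]) auto
qed

lemma extend_by_element:
  fixes D U :: "'n::finite set"
  assumes "D \<subseteq> U" "card D = k" "k < card U" "a \<in> U"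
  shows "\<exists>D'. D \<subseteq> D' \<and> D' \<subseteq> U \<and> card D' = Suc k \<and> a \<in> D'"
proof (cases "a \<in> D")
  case True
  then show ?thesis using extend_by_one[OF assms(1-3)] by blast
next
  case False
  then show ?thesis using assms by (intro exI[of _ "insert a D"]) auto
qed

lemma vertex_splittable_all_complements:
  fixes V :: "'n::finite set"
  shows "vertex_splittable V (face_ideal (complements V k (\<lambda>D. True)) :: ('n, 'k::field) mpoly set)"
proof (induction "card V" arbitrary: V k rule: less_induct)
  case less
  show ?case
  proof (cases "k = 0 \<or> card V \<le> k")
    case True
    then show ?thesis by (rule vertex_splittable_complements_trivial)
  next
    case False
    then obtain j where j: "k = Suc j" "Suc j < card V" by (metis not_le not0_implies_Suc)
    then obtain x where x: "x \<in> V" by fastforce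
    have lt: "card (V - {x}) < card V" by (rule card_Diff1_less[OF finite x])
    have c: "card (V - {x}) = card V - 1" using x by simp
    show ?thesis
      unfolding j(1)
    proof (rule vertex_splittable_complements_split[OF x j(2) less[OF lt] less[OF lt]])
      show "\<exists>D'. D \<subseteq> D' \<and> D' \<subseteq> V - {x} \<and> card D' = Suc j \<and> True"
        if "D \<subseteq> V - {x}" "card D = j" for D
        using extend_by_one[OF that] j c by auto
    qed
  qed
qed


section \<open>Connectivity and vertices that can be deleted\<close>

text \<open>
  Reachability from \<open>A\<close> inside \<open>N\<close>, expressed by cuts instead of paths: no proper subset of \<open>N\<close> that
  contains the part of \<open>A\<close> in \<open>N\<close> is closed under adjacency.
\<close>

definition reaches :: "('n \<Rightarrow> 'n \<Rightarrow> bool) \<Rightarrow> 'n set \<Rightarrow> 'n set \<Rightarrow> bool" where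
  "reaches adj A N \<longleftrightarrow> (\<forall>X. A \<inter> N \<subseteq> X \<longrightarrow> X \<subset> N \<longrightarrow> (\<exists>u\<in>X. \<exists>v\<in>N - X. adj u v))"

definition connected_on :: "('n \<Rightarrow> 'n \<Rightarrow> bool) \<Rightarrow> 'n set \<Rightarrow> bool" where
  "connected_on adj N \<longleftrightarrow> (\<forall>X. X \<noteq> {} \<longrightarrow> X \<subset> N \<longrightarrow> (\<exists>u\<in>X. \<exists>v\<in>N - X. adj u v))"

definition has_edge :: "('n \<Rightarrow> 'n \<Rightarrow> bool) \<Rightarrow> 'n set \<Rightarrow> bool" where
  "has_edge adj D \<longleftrightarrow> (\<exists>u\<in>D. \<exists>v\<in>D. adj u v)"

lemma reachesD:
  "reaches adj A N \<Longrightarrow> A \<inter> N \<subseteq> X \<Longrightarrow> X \<subset> N \<Longrightarrow> \<exists>u\<in>X. \<exists>v\<in>N - X. adj u v"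
  by (simp add: reaches_def)

lemma connected_onD:
  "connected_on adj N \<Longrightarrow> X \<noteq> {} \<Longrightarrow> X \<subset> N \<Longrightarrow> \<exists>u\<in>X. \<exists>v\<in>N - X. adj u v"
  by (simp add: connected_on_def)

lemma connected_on_imp_reaches:
  assumes "connected_on adj N" "A \<inter> N \<noteq> {}"
  shows "reaches adj A N"
  unfolding reaches_def
proof (intro allI impI)
  fix X assume X: "A \<inter> N \<subseteq> X" "X \<subset> N"
  then have "X \<noteq> {}" using assms(2) by blast
  then show "\<exists>u\<in>X. \<exists>v\<in>N - X. adj u v" using connected_onD[OF assms(1)] X(2) by blast
qed

lemma reaches_mono:
  assumes "reaches adj A N" "A \<inter> N \<subseteq> B"
  shows "reaches adj B N"
  unfolding reaches_def
proof (intro allI impI)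
  fix X assume X: "B \<inter> N \<subseteq> X" "X \<subset> N"
  then have "A \<inter> N \<subseteq> X" using assms(2) by blast
  then show "\<exists>u\<in>X. \<exists>v\<in>N - X. adj u v" by (rule reachesD[OF assms(1) _ X(2)])
qed

lemma connected_on_iff_reaches:
  assumes "symp adj" "a \<in> N"
  shows "connected_on adj N \<longleftrightarrow> reaches adj {a} N"
proof
  assume "connected_on adj N"
  then show "reaches adj {a} N" by (rule connected_on_imp_reaches) (use assms(2) in simp)
next
  assume r: "reaches adj {a} N"
  show "connected_on adj N"
    unfolding connected_on_def
  proof (intro allI impI)
    fix X assume X: "X \<noteq> {}" "X \<subset> N"
    show "\<exists>u\<in>X. \<exists>v\<in>N - X. adj u v"
    proof (cases "a \<in> X")
      case True
      then show ?thesis by (intro reachesD[OF r _ X(2)]) blast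
    next
      case False
      then have "{a} \<inter> N \<subseteq> N - X" "N - X \<subset> N" using X assms(2) by blast+
      from reachesD[OF r this] obtain u v where uv: "u \<in> N - X" "v \<in> N - (N - X)" "adj u v"
        by blast
      then have "adj v u" using assms(1) by (blast dest: sympD)
      then show ?thesis using uv by blast
    qed
  qed
qed

text \<open>
  A maximal proper subset of \<open>N\<close> that contains \<open>a\<close> and is reached from \<open>A\<close> within itself misses only one vertex:
  some vertex outside belongs to \<open>A\<close> or is adjacent to the subset, and adding it keeps the property.
\<close>

lemma reaches_delete_vertex:
  fixes N :: "'n::finite set"
  assumes r: "reaches adj A N" and a: "a \<in> A" "a \<in> N" and card: "2 \<le> card N"
  shows "\<exists>x\<in>N. x \<noteq> a \<and> reaches adj A (N - {x})"
proof -
  define \<U> where "\<U> = {U. a \<in> U \<and> U \<subset> N \<and> reaches adj A U}"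
  have "N \<noteq> {a}" using card by auto
  then have "{a} \<subset> N" using a by blast
  moreover have "reaches adj A {a}" using a(1) unfolding reaches_def by blast
  ultimately have "{a} \<in> \<U>" unfolding \<U>_def by blast
  then have "\<U> \<noteq> {}" by blast
  then obtain U where U: "U \<in> \<U>" "\<And>U'. U' \<in> \<U> \<Longrightarrow> U \<subseteq> U' \<Longrightarrow> U = U'"
    using finite_has_maximal[of \<U>] by auto
  then have U': "a \<in> U" "U \<subset> N" "reaches adj A U" by (auto simp: \<U>_def)
  obtain y where y: "y \<in> N" "y \<notin> U" "y \<in> A \<or> (\<exists>u\<in>U. adj u y)"
  proof (cases "A \<inter> N \<subseteq> U")
    case True
    from reachesD[OF r this U'(2)] show ?thesis using that by blast
  next
    case False
    then show ?thesis using that by blast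
  qed
  have "reaches adj A (insert y U)"
    unfolding reaches_def
  proof (intro allI impI)
    fix X assume X: "A \<inter> insert y U \<subseteq> X" "X \<subset> insert y U"
    show "\<exists>u\<in>X. \<exists>v\<in>insert y U - X. adj u v"
    proof (cases "U \<subseteq> X")
      case True
      then have "X = U" using X(2) by blast
      then show ?thesis using X(1) y by blast
    next
      case False
      then have "A \<inter> U \<subseteq> X \<inter> U" "X \<inter> U \<subset> U" using X by blast+
      from reachesD[OF U'(3) this] obtain u v where "u \<in> X \<inter> U" "v \<in> U - X \<inter> U" "adj u v" by blast
      then show ?thesis by blast
    qed
  qed
  then have "\<not> insert y U \<subset> N" using U(2)[of "insert y U"] U'(1) y(2) unfolding \<U>_def by blast
  then have "N - {y} = U" using y U'(2) by blast
  then show ?thesis using U' y by (intro bexI[of _ y]) auto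
qed


section \<open>Sets that contain an edge\<close>

text \<open>
  Vertices outside \<open>N\<close> are isolated and may be split off; if there are none, split off a vertex \<open>x\<close> whose
  removal leaves the remaining vertices reachable.  The sets \<open>D\<close> without \<open>x\<close> are of the same kind.  For those
  that contain \<open>x\<close>, the condition on \<open>D - {x}\<close> is void if \<open>x\<close> is in \<open>A\<close>; otherwise it is of the same
  kind, with the neighbours of \<open>x\<close> added to \<open>A\<close>.  In each case \<open>A - {x}\<close> is not empty, and one of its elements serves to
  enlarge sets as a splitting requires.
\<close>

lemma vertex_splittable_complements_reaches:
  fixes V :: "'n::finite set"
  assumes sym: "symp adj" and irr: "irreflp adj"
    and "A \<subseteq> N" "A \<noteq> {}" "N \<subseteq> V" "\<And>u v. u \<in> V \<Longrightarrow> v \<in> V \<Longrightarrow> adj u v \<Longrightarrow> u \<in> N" "reaches adj A N"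
  shows "vertex_splittable V
    (face_ideal (complements V k (\<lambda>D. D \<inter> A \<noteq> {} \<or> has_edge adj D)) :: ('n, 'k::field) mpoly set)"
  using assms(3-)
proof (induction "card V" arbitrary: V A N k rule: less_induct)
  case less
  show ?case
  proof (cases "k = 0 \<or> card V \<le> k")
    case True
    then show ?thesis by (rule vertex_splittable_complements_trivial)
  next
    case False
    then obtain j where j: "k = Suc j" "Suc j < card V" by (metis not_le not0_implies_Suc)
    obtain x where x: "x \<in> V" "A - {x} \<noteq> {}" "reaches adj (A - {x}) (N - {x})"
    proof (cases "V = N")
      case True
      obtain a where a: "a \<in> A" using less.prems by blast
      then obtain x where x: "x \<in> N" "x \<noteq> a" "reaches adj A (N - {x})"
        using reaches_delete_vertex[OF less.prems(5), of a] less.prems j True by auto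
      then have "reaches adj (A - {x}) (N - {x})" by (rule_tac reaches_mono) auto
      then show ?thesis using that[of x] x a True by blast
    next
      case False
      then obtain x where x: "x \<in> V" "x \<notin> N" using less.prems by blast
      then have "A - {x} = A" "N - {x} = N" using less.prems by blast+
      then show ?thesis using that[of x] x less.prems by simp
    qed
    have lt: "card (V - {x}) < card V" by (rule card_Diff1_less[OF finite x(1)])
    have c: "card (V - {x}) = card V - 1" using x(1) by simp
    let ?P = "\<lambda>D. D \<inter> A \<noteq> {} \<or> has_edge adj D"
    show ?thesis
      unfolding j(1)
    proof (rule vertex_splittable_complements_split[OF x(1) j(2)])
      have "complements (V - {x}) (Suc j) ?P =
          complements (V - {x}) (Suc j) (\<lambda>D. D \<inter> (A - {x}) \<noteq> {} \<or> has_edge adj D)"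
        by (rule complements_cong) blast
      moreover have "vertex_splittable (V - {x}) (face_ideal (complements (V - {x}) (Suc j)
          (\<lambda>D. D \<inter> (A - {x}) \<noteq> {} \<or> has_edge adj D)) :: ('n, 'k) mpoly set)"
        by (rule less.hyps[OF lt, of _ "N - {x}"]) (use less.prems x in blast)+
      ultimately show "vertex_splittable (V - {x})
          (face_ideal (complements (V - {x}) (Suc j) ?P) :: ('n, 'k) mpoly set)" by simp
      show "vertex_splittable (V - {x})
          (face_ideal (complements (V - {x}) j (\<lambda>D. ?P (insert x D))) :: ('n, 'k) mpoly set)"
      proof (cases "x \<in> A")
        case True
        then have "complements (V - {x}) j (\<lambda>D. ?P (insert x D)) = complements (V - {x}) j (\<lambda>D. True)"
          by (intro complements_cong) blast
        then show ?thesis by (simp add: vertex_splittable_all_complements)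
      next
        case False
        let ?A = "A \<union> {y \<in> N - {x}. adj x y}"
        have nbr: "y \<in> N" if "y \<in> V - {x}" "adj x y" for y
          using that less.prems(4)[of y x] x(1) sym by (blast dest: sympD)
        have "complements (V - {x}) j (\<lambda>D. ?P (insert x D)) =
            complements (V - {x}) j (\<lambda>D. D \<inter> ?A \<noteq> {} \<or> has_edge adj D)"
        proof (rule complements_cong)
          fix D assume D: "D \<subseteq> V - {x}"
          have "has_edge adj (insert x D) \<longleftrightarrow> (\<exists>y\<in>D. adj x y) \<or> has_edge adj D"
            unfolding has_edge_def using sym irr by (blast dest: sympD irreflpD)
          then show "?P (insert x D) \<longleftrightarrow> D \<inter> ?A \<noteq> {} \<or> has_edge adj D"
            using D nbr False by blast
        qed
        moreover have "vertex_splittable (V - {x}) (face_ideal (complements (V - {x}) j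
            (\<lambda>D. D \<inter> ?A \<noteq> {} \<or> has_edge adj D)) :: ('n, 'k) mpoly set)"
        proof (rule less.hyps[OF lt, of _ "N - {x}"])
          show "reaches adj ?A (N - {x})" by (rule reaches_mono[OF x(3)]) blast
        qed (use less.prems False in blast)+
        ultimately show ?thesis by simp
      qed
    next
      fix D assume D: "D \<subseteq> V - {x}" "card D = j"
      obtain a where a: "a \<in> A - {x}" using x(2) by blast
      then have "a \<in> V - {x}" using less.prems by blast
      moreover have "j < card (V - {x})" using j(2) c by simp
      ultimately obtain D' where "D \<subseteq> D'" "D' \<subseteq> V - {x}" "card D' = Suc j" "a \<in> D'"
        using extend_by_element[OF D, of a] by blast
      then show "\<exists>D'. D \<subseteq> D' \<and> D' \<subseteq> V - {x} \<and> card D' = Suc j \<and> ?P D'"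
        using a by blast
    qed
  qed
qed

text \<open>
  The induction is the same, now removing a vertex \<open>x\<close> that is not a cut vertex.  A set with \<open>x\<close> contains
  an edge if the rest of it contains an edge or meets the neighbours of \<open>x\<close>, which is the condition of the
  previous lemma.  A neighbour of \<open>x\<close> has a further neighbour, since the graph without \<open>x\<close> is connected
  and has at least two vertices; this neighbour enlarges the sets.
\<close>

lemma vertex_splittable_complements_connected:
  fixes V :: "'n::finite set"
  assumes sym: "symp adj" and irr: "irreflp adj"
    and "N \<subseteq> V" "2 \<le> card N" "\<And>u v. u \<in> V \<Longrightarrow> v \<in> V \<Longrightarrow> adj u v \<Longrightarrow> u \<in> N" "connected_on adj N"
  shows "vertex_splittable V (face_ideal (complements V k (has_edge adj)) :: ('n, 'k::field) mpoly set)"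
  using assms(3-)
proof (induction "card V" arbitrary: V N k rule: less_induct)
  case less
  have insert: "has_edge adj (insert x D) \<longleftrightarrow> (\<exists>y\<in>D. adj x y) \<or> has_edge adj D" for x D
    unfolding has_edge_def using sym irr by (blast dest: sympD irreflpD)
  show ?case
  proof (cases "k = 0 \<or> card V \<le> k")
    case True
    then show ?thesis by (rule vertex_splittable_complements_trivial)
  next
    case False
    then obtain j where j: "k = Suc j" "Suc j < card V" by (metis not_le not0_implies_Suc)
    show ?thesis
    proof (cases "V = N")
      case False
      then obtain x where x: "x \<in> V" "x \<notin> N" using less.prems by blast
      have lt: "card (V - {x}) < card V" by (rule card_Diff1_less[OF finite x(1)])
      have c: "card (V - {x}) = card V - 1" using x(1) by simp
      have iso: "\<not> adj x y" if "y \<in> V" for y using that x less.prems(3) by blast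
      have IH: "vertex_splittable (V - {x})
          (face_ideal (complements (V - {x}) i (has_edge adj)) :: ('n, 'k) mpoly set)" for i
        by (rule less.hyps[OF lt, of N]) (use less.prems x in blast)+
      have insert': "has_edge adj (insert x D) \<longleftrightarrow> has_edge adj D" if "D \<subseteq> V - {x}" for D
        using that insert iso by blast
      show ?thesis
        unfolding j(1)
      proof (rule vertex_splittable_complements_split[OF x(1) j(2) IH])
        have "complements (V - {x}) j (\<lambda>D. has_edge adj (insert x D)) = complements (V - {x}) j (has_edge adj)"
          by (rule complements_cong) (rule insert')
        then show "vertex_splittable (V - {x})
            (face_ideal (complements (V - {x}) j (\<lambda>D. has_edge adj (insert x D))) :: ('n, 'k) mpoly set)"
          using IH by simp
        fix D assume D: "D \<subseteq> V - {x}" "card D = j" "has_edge adj (insert x D)"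
        then have "has_edge adj D" using insert' by blast
        moreover have "j < card (V - {x})" using j(2) c by simp
        from extend_by_one[OF D(1,2) this]
        obtain D' where "D \<subseteq> D'" "D' \<subseteq> V - {x}" "card D' = Suc j" by blast
        ultimately show "\<exists>D'. D \<subseteq> D' \<and> D' \<subseteq> V - {x} \<and> card D' = Suc j \<and> has_edge adj D'"
          unfolding has_edge_def by blast
      qed
    next
      case VN: True
      show ?thesis
      proof (cases "card V = 2")
        case True
        then have "k = 1" using j by simp
        have "\<not> has_edge adj D" if "card D = 1" for D
          using that irr unfolding has_edge_def by (auto simp: card_1_singleton_iff dest: irreflpD)
        then have "complements V k (has_edge adj) = {}" using \<open>k = 1\<close> by (auto simp: complements_def)
        then show ?thesis by (intro vertex_splittable_face_ideal_at_most_one[where A = "{}"]) auto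
      next
        case False
        then have card3: "3 \<le> card N" using less.prems(2) VN by simp
        then obtain a where a: "a \<in> N" by fastforce
        have "reaches adj {a} N" using less.prems(4) connected_on_iff_reaches[OF sym a] by simp
        then obtain x where x: "x \<in> N" "x \<noteq> a" "reaches adj {a} (N - {x})"
          using reaches_delete_vertex[of adj "{a}" N a] a card3 by auto
        have conn: "connected_on adj (N - {x})"
          using connected_on_iff_reaches[OF sym, of a "N - {x}"] a x by simp
        have lt: "card (V - {x}) < card V" using x(1) VN by (intro card_Diff1_less) auto
        have c: "card (V - {x}) = card V - 1" using x(1) VN by simp
        have xV: "x \<in> V" using x(1) VN by simp
        let ?A = "{y \<in> N - {x}. adj x y}"
        have ne: "?A \<noteq> {}"
        proof -
          have "{x} \<subset> N" using x a by blast
          then show ?thesis using connected_onD[OF less.prems(4), of "{x}"] by blast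
        qed
        show ?thesis
          unfolding j(1)
        proof (rule vertex_splittable_complements_split[OF xV j(2)])
          show "vertex_splittable (V - {x})
              (face_ideal (complements (V - {x}) (Suc j) (has_edge adj)) :: ('n, 'k) mpoly set)"
            by (rule less.hyps[OF lt, of "N - {x}"]) (use conn VN c card3 in auto)
          have "complements (V - {x}) j (\<lambda>D. has_edge adj (insert x D)) =
              complements (V - {x}) j (\<lambda>D. D \<inter> ?A \<noteq> {} \<or> has_edge adj D)"
            using VN by (intro complements_cong) (auto simp: insert)
          moreover have "vertex_splittable (V - {x})
              (face_ideal (complements (V - {x}) j (\<lambda>D. D \<inter> ?A \<noteq> {} \<or> has_edge adj D)) :: ('n, 'k) mpoly set)"
          proof (rule vertex_splittable_complements_reaches[OF sym irr, where N = "N - {x}"])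
            show "reaches adj ?A (N - {x})"
              by (rule connected_on_imp_reaches[OF conn]) (use ne in blast)
          qed (use ne VN in blast)+
          ultimately show "vertex_splittable (V - {x})
              (face_ideal (complements (V - {x}) j (\<lambda>D. has_edge adj (insert x D))) :: ('n, 'k) mpoly set)"
            by simp
          fix D assume D: "D \<subseteq> V - {x}" "card D = j" "has_edge adj (insert x D)"
          have lt': "j < card (V - {x})" using j(2) c by simp
          show "\<exists>D'. D \<subseteq> D' \<and> D' \<subseteq> V - {x} \<and> card D' = Suc j \<and> has_edge adj D'"
          proof (cases "has_edge adj D")
            case True
            then show ?thesis using extend_by_one[OF D(1,2) lt'] unfolding has_edge_def by blast
          next
            case False
            then obtain y where y: "y \<in> D" using D(3) insert by blast
            have "{y} \<noteq> N - {x}"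
            proof
              assume eq: "{y} = N - {x}"
              have "card (N - {x}) = 1" unfolding eq[symmetric] by simp
              then show False using card3 x(1) by simp
            qed
            then have "{y} \<subset> N - {x}" using y D(1) VN by blast
            then obtain z where z: "z \<in> N - {x}" "adj y z" using connected_onD[OF conn, of "{y}"] by blast
            then obtain D' where "D \<subseteq> D'" "D' \<subseteq> V - {x}" "card D' = Suc j" "z \<in> D'"
              using extend_by_element[OF D(1,2) lt', of z] VN by blast
            then show ?thesis using y z unfolding has_edge_def by blast
          qed
        qed
      qed
    qed
  qed
qed

section \<open>Ideals generated in degree two\<close>

text \<open>
  A chain on the sets \<open>W - {p}\<close> is a function of the vertex \<open>p\<close>.  After normalisation by the boundary
  \<open>\<omega>\<close> of the full set \<open>W\<close>, whose coefficients are signs, the coefficient of its boundary at \<open>W - {p, q}\<close> is,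
  up to sign, the difference of the values at \<open>p\<close> and \<open>q\<close>.  The relation between the signs needed for
  this is that \<open>\<omega>\<close> is a cycle.
\<close>

lemma sbd_codim_two_eq_0_iff:
  fixes \<theta> :: "'n::{finite,linorder} set \<Rightarrow> 'k::field"
  assumes \<theta>: "\<And>F. \<theta> F \<noteq> 0 \<Longrightarrow> F \<subseteq> W" and pq: "p \<in> W" "q \<in> W" "p \<noteq> q"
  defines "\<omega> \<equiv> sbd (\<lambda>F. if F = W then 1 else 0)"
  shows "sbd \<theta> (W - {p, q}) = 0 \<longleftrightarrow> \<theta> (W - {p}) * \<omega> (W - {p}) = \<theta> (W - {q}) * \<omega> (W - {q})"
proof -
  let ?G = "W - {p, q}"
  define \<epsilon> :: "'n \<Rightarrow> 'k" where "\<epsilon> v = (- 1) ^ card {w\<in>?G. w < v}" for v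
  have ins: "insert p ?G = W - {q}" "insert q ?G = W - {p}" using pq by blast+
  have two: "sbd \<eta> ?G = \<epsilon> p * \<eta> (W - {q}) + \<epsilon> q * \<eta> (W - {p})"
    if \<eta>: "\<And>F. \<eta> F \<noteq> 0 \<Longrightarrow> F \<subseteq> W" for \<eta> :: "'n set \<Rightarrow> 'k"
  proof -
    have "sbd \<eta> ?G = (\<Sum>v\<in>{p, q}. \<epsilon> v * \<eta> (insert v ?G))"
      unfolding sbd_def \<epsilon>_def
    proof (rule sum.mono_neutral_right)
      show "\<forall>v\<in>- ?G - {p, q}. (- 1) ^ card {w \<in> ?G. w < v} * \<eta> (insert v ?G) = 0"
      proof
        fix v assume "v \<in> - ?G - {p, q}"
        then have "\<not> insert v ?G \<subseteq> W" by blast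
        then show "(- 1) ^ card {w \<in> ?G. w < v} * \<eta> (insert v ?G) = 0" using \<eta> by auto
      qed
    qed auto
    then show ?thesis using pq(3) by (simp add: ins)
  qed
  have \<omega>: "F \<subseteq> W" if "\<omega> F \<noteq> 0" for F
    using that unfolding \<omega>_def by (rule sbd_nonzeroE) (auto split: if_splits)
  have sq: "\<omega> (W - {v}) * \<omega> (W - {v}) = 1" if "v \<in> W" for v
  proof -
    have "\<omega> (W - {v}) = (- 1) ^ card {w\<in>W - {v}. w < v} * (if insert v (W - {v}) = W then 1 else 0)"
      unfolding \<omega>_def using that by (intro sbd_single_term) auto
    then have "\<omega> (W - {v}) = (- 1) ^ card {w\<in>W - {v}. w < v}" using that by (simp add: insert_absorb)
    then show ?thesis by (simp flip: power_mult_distrib)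
  qed
  have \<epsilon>2: "\<epsilon> v * \<epsilon> v = 1" for v unfolding \<epsilon>_def by (simp flip: power_mult_distrib)
  have "sbd \<omega> ?G = 0" unfolding \<omega>_def by (simp add: sbd_sbd)
  then have rel: "\<epsilon> p * \<omega> (W - {q}) = - (\<epsilon> q * \<omega> (W - {p}))"
    using two[of \<omega>] \<omega> by (simp add: eq_neg_iff_add_eq_0)
  have "sbd \<theta> ?G = \<epsilon> p * (\<omega> (W - {q}) * \<omega> (W - {q})) * \<theta> (W - {q})
      + \<epsilon> q * (\<omega> (W - {p}) * \<omega> (W - {p})) * \<theta> (W - {p})"
    using two[of \<theta>] \<theta> by (simp add: sq pq)
  also have "\<dots> = (\<epsilon> p * \<omega> (W - {q})) * (\<theta> (W - {q}) * \<omega> (W - {q}))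
      + (\<epsilon> q * \<omega> (W - {p})) * (\<theta> (W - {p}) * \<omega> (W - {p}))"
    by (simp add: mult_ac)
  also have "\<dots> = (\<epsilon> q * \<omega> (W - {p})) * (\<theta> (W - {p}) * \<omega> (W - {p}) - \<theta> (W - {q}) * \<omega> (W - {q}))"
    unfolding rel by (simp add: algebra_simps)
  finally have "sbd \<theta> ?G = (\<epsilon> q * \<omega> (W - {p})) * (\<theta> (W - {p}) * \<omega> (W - {p}) - \<theta> (W - {q}) * \<omega> (W - {q}))" .
  moreover have "\<epsilon> q * \<omega> (W - {p}) \<noteq> 0" using \<epsilon>2[of q] sq[OF pq(1)] by auto
  ultimately show ?thesis by simp
qed

definition non_edge :: "'n set set \<Rightarrow> 'n \<Rightarrow> 'n \<Rightarrow> bool" where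
  "non_edge \<G> u v \<longleftrightarrow> u \<noteq> v \<and> {u, v} \<notin> \<G>"

lemma symp_non_edge: "symp (non_edge \<G>)"
  by (rule sympI) (auto simp: non_edge_def insert_commute)

lemma irreflp_non_edge: "irreflp (non_edge \<G>)"
  by (rule irreflpI) (simp add: non_edge_def)

text \<open>
  In the graph of the non-edges, \<open>a\<close>, \<open>s\<close>, a path through \<open>B\<close> and \<open>t\<close> form a cycle.  The dual complex
  computes the cohomology of the clique complex of this graph.  The indicator function of the edge
  \<open>{s, a}\<close> is a cocycle, because this edge lies in no triangle.  If it were the coboundary of a function
  \<open>f\<close> on the vertices, then \<open>f\<close> would agree along the rest of the cycle from \<open>s\<close> through \<open>B\<close> and
  \<open>t\<close> to \<open>a\<close> and yet differ at \<open>s\<close> and \<open>a\<close>.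
\<close>

lemma not_exact_if_cycle:
  fixes \<G> :: "'n::{finite,linorder} set set"
  assumes u: "uniform 2 \<G>"
    and st: "{s, t} \<in> \<G>" and as: "non_edge \<G> a s" and at: "non_edge \<G> a t"
    and B: "\<And>b. b \<in> B \<Longrightarrow> {a, b} \<in> \<G>" "connected_on (non_edge \<G>) B"
    and sB: "b \<in> B" "non_edge \<G> s b" and tB: "b' \<in> B" "non_edge \<G> t b'"
  shows "\<exists>W i. i + 2 < card W \<and> \<not> exact_at TYPE('k::field) (dual_complex \<G> W) i"
proof -
  define W where "W = insert a (insert s (insert t B))"
  have "card {s, t} = 2" "\<And>b. b \<in> B \<Longrightarrow> card {a, b} = 2" using st B(1) u unfolding uniform_def by blast+
  then have ne: "s \<noteq> t" "a \<noteq> s" "a \<noteq> t" "a \<notin> B" using as at by (fastforce simp: non_edge_def)+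
  have "s \<notin> B" "t \<notin> B" using as at B(1) by (auto simp: non_edge_def)
  have "card {a, s, t} = 3" using ne by simp
  moreover have "card {a, s, t} < card W"
    unfolding W_def using ne \<open>s \<notin> B\<close> \<open>t \<notin> B\<close> sB(1) by (intro psubset_card_mono) auto
  ultimately have cW: "4 \<le> card W" by simp
  define i where "i = card W - 3"
  let ?F0 = "W - {s, a}"
  have cF0: "card ?F0 = Suc (Suc i) - 1"
  proof -
    have "card ?F0 = card W - card {s, a}" by (rule card_Diff_subset) (auto simp: W_def)
    then show ?thesis using ne cW by (simp add: i_def)
  qed
  \<comment> \<open>Its boundary is supported on complements of triples \<open>{s, a, v}\<close>, and such a triple contains an edge.\<close>
  define c :: "'n set \<Rightarrow> 'k" where "c F = (if F = ?F0 then 1 else 0)" for F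
  let ?\<phi> = "sbd c"
  have \<phi>: "?\<phi> \<in> face_chains (dual_complex \<G> W) i"
    unfolding face_chains_def
  proof (intro CollectI allI impI)
    fix G assume "?\<phi> G \<noteq> 0"
    then obtain v where v: "v \<notin> G" "c (insert v G) \<noteq> 0" by (rule sbd_nonzeroE)
    then have vG: "insert v G = ?F0" by (auto simp: c_def split: if_splits)
    then have "card G = i" using cF0 v(1) by (metis card_insert_disjoint diff_Suc_1 finite nat.inject)
    have vW: "v \<in> W - {s, a}" using vG by blast
    have "{s, v} \<in> \<G> \<or> {a, v} \<in> \<G>" using vW st B(1) unfolding W_def by blast
    moreover have "{s, v} \<subseteq> W - G" "{a, v} \<subseteq> W - G" using vG v(1) vW by (auto simp: W_def)
    moreover have "G \<subseteq> W" using vG by blast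
    ultimately show "G \<in> dual_complex \<G> W \<and> card G = i"
      using \<open>card G = i\<close> unfolding dual_complex_def by blast
  qed
  have "\<not> exact_at TYPE('k) (dual_complex \<G> W) i"
  proof
    assume "exact_at TYPE('k) (dual_complex \<G> W) i"
    then obtain \<psi> where \<psi>: "\<psi> \<in> face_chains (dual_complex \<G> W) (Suc i)" "sbd \<psi> = ?\<phi>"
      using \<phi> sbd_sbd[of c] unfolding exact_at_def by blast
    have cW': "c \<in> face_chains (Pow W) (Suc i)" using cF0 by (auto simp: face_chains_def c_def)
    have "\<psi> \<in> face_chains (Pow W) (Suc i)"
      using \<psi>(1) by (auto simp: face_chains_def dual_complex_def)
    then have "c - \<psi> \<in> face_chains (Pow W) (Suc i)" using cW' by (intro face_chains_diff)
    moreover have "sbd (c - \<psi>) = 0" using \<psi>(2) by (simp add: sbd_diff)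
    moreover have "exact_at TYPE('k) (Pow W) (Suc i)"
      by (rule exact_at_cone[where m = a]) (auto simp: down_closed_def W_def)
    ultimately obtain \<theta> where \<theta>: "\<theta> \<in> face_chains (Pow W) (Suc (Suc i))" "sbd \<theta> = c - \<psi>"
      unfolding exact_at_def by blast
    have \<theta>W: "\<And>F. \<theta> F \<noteq> 0 \<Longrightarrow> F \<subseteq> W" using \<theta>(1) by (auto simp: face_chains_def)
    define f where "f p = \<theta> (W - {p}) * sbd (\<lambda>F. if F = W then 1 else 0) (W - {p})" for p
    have f_iff: "(c - \<psi>) (W - {p, q}) = 0 \<longleftrightarrow> f p = f q" if "p \<in> W" "q \<in> W" "p \<noteq> q" for p q
      unfolding f_def \<theta>(2)[symmetric] by (rule sbd_codim_two_eq_0_iff[OF \<theta>W that])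
    have \<psi>0: "\<psi> (W - {p, q}) = 0" if "p \<in> W" "q \<in> W" "non_edge \<G> p q" for p q
    proof (rule ccontr)
      assume "\<psi> (W - {p, q}) \<noteq> 0"
      then obtain A where A: "A \<in> \<G>" "A \<subseteq> W - (W - {p, q})"
        using \<psi>(1) by (auto simp: face_chains_def dual_complex_def)
      then have "A \<subseteq> {p, q}" by blast
      moreover have "card A = 2" using A u by (simp add: uniform_def)
      ultimately have "A = {p, q}"
        using that(3) by (intro card_subset_eq) (auto simp: non_edge_def)
      then show False using that(3) A by (simp add: non_edge_def)
    qed
    have eq: "f p = f q" if "p \<in> W" "q \<in> W" "non_edge \<G> p q" "{p, q} \<noteq> {s, a}" for p q
    proof -
      have "W - {p, q} \<noteq> ?F0" using that by (auto simp: W_def)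
      then have "(c - \<psi>) (W - {p, q}) = 0" using \<psi>0[OF that(1-3)] by (simp add: c_def)
      then show ?thesis using f_iff that(1-3) by (simp add: non_edge_def)
    qed
    have fB: "f v = f b" if "v \<in> B" for v
    proof (rule ccontr)
      let ?X = "{v \<in> B. f v = f b}"
      assume "f v \<noteq> f b"
      then have "?X \<noteq> {}" "?X \<subset> B" using sB(1) that by blast+
      from connected_onD[OF B(2) this]
      obtain x y where xy: "x \<in> ?X" "y \<in> B - ?X" "non_edge \<G> x y" by blast
      then have "f x = f y" using ne by (intro eq) (auto simp: W_def)
      then show False using xy by auto
    qed
    have "f s = f b" by (rule eq) (use sB ne in \<open>auto simp: W_def\<close>)
    moreover have "f t = f b'" by (rule eq) (use tB ne \<open>t \<notin> B\<close> in \<open>auto simp: W_def doubleton_eq_iff\<close>)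
    moreover have "f a = f t" by (rule eq) (use at ne in \<open>auto simp: W_def doubleton_eq_iff\<close>)
    ultimately have "f s = f a" using fB[OF tB(1)] by simp
    then have "(c - \<psi>) (W - {s, a}) = 0" using f_iff[of s a] ne by (simp add: W_def)
    moreover have "\<psi> (W - {s, a}) = 0" using as by (intro \<psi>0) (auto simp: W_def non_edge_def insert_commute)
    ultimately show False by (simp add: c_def)
  qed
  moreover have "i + 2 < card W" using cW by (simp add: i_def)
  ultimately show ?thesis by blast
qed

definition simplicial :: "('n \<Rightarrow> 'n \<Rightarrow> bool) \<Rightarrow> 'n set \<Rightarrow> 'n \<Rightarrow> bool" where
  "simplicial adj V x \<longleftrightarrow> (\<forall>u\<in>V. \<forall>v\<in>V. adj x u \<longrightarrow> adj x v \<longrightarrow> u \<noteq> v \<longrightarrow> adj u v)"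

lemma connected_on_insert:
  assumes "connected_on adj C" "symp adj" "c \<in> C" "adj c y"
  shows "connected_on adj (insert y C)"
  unfolding connected_on_def
proof (intro allI impI)
  fix X assume X: "X \<noteq> {}" "X \<subset> insert y C"
  have yc: "adj y c" using assms by (blast dest: sympD)
  show "\<exists>u\<in>X. \<exists>v\<in>insert y C - X. adj u v"
  proof (cases "C \<subseteq> X")
    case True
    then have "y \<notin> X" using X(2) by blast
    then show ?thesis using True assms(3,4) by blast
  next
    case CX: False
    show ?thesis
    proof (cases "X \<inter> C = {}")
      case True
      then have "y \<in> X" "c \<notin> X" using X assms(3) by blast+
      then show ?thesis using yc assms(3) by blast
    next
      case False
      then have "X \<inter> C \<subset> C" using CX by blast
      from connected_onD[OF assms(1) False this] show ?thesis by blast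
    qed
  qed
qed

text \<open>
  Dirac's argument on chordal graphs.  Let \<open>C\<close> be a component of the non-neighbours of \<open>a\<close>, and \<open>S\<close> the set of the
  neighbours of \<open>a\<close> that are adjacent to \<open>C\<close>.  By the condition on cycles \<open>S\<close> is a clique.  Induction
  for \<open>C \<union> S\<close> provides a simplicial vertex of this set in \<open>C\<close>, which is simplicial in \<open>V\<close> because all
  neighbours of \<open>C\<close> lie in \<open>C \<union> S\<close>.
\<close>

lemma ex_simplicial:
  fixes V :: "'n::finite set"
  assumes sym: "symp adj" and irr: "irreflp adj"
    and no_cycle: "\<And>a s t B b b'. adj a s \<Longrightarrow> adj a t \<Longrightarrow> s \<noteq> t \<Longrightarrow> connected_on adj B \<Longrightarrow>
      (\<And>b. b \<in> B \<Longrightarrow> b \<noteq> a \<and> \<not> adj a b) \<Longrightarrow> b \<in> B \<Longrightarrow> adj s b \<Longrightarrow> b' \<in> B \<Longrightarrow> adj t b' \<Longrightarrow> adj s t"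
    and "a \<in> V" "u \<in> V" "u \<noteq> a" "\<not> adj a u"
  shows "\<exists>x\<in>V. x \<noteq> a \<and> \<not> adj a x \<and> simplicial adj V x"
  using assms(4-)
proof (induction "card V" arbitrary: V a u rule: less_induct)
  case less
  have sym': "adj x y \<Longrightarrow> adj y x" for x y using sym by (rule sympD)
  define M where "M = {v \<in> V. v \<noteq> a \<and> \<not> adj a v}"
  \<comment> \<open>A maximal connected set of non-neighbours of \<open>a\<close> is a component.\<close>
  define \<C> where "\<C> = {C. u \<in> C \<and> C \<subseteq> M \<and> connected_on adj C}"
  have "{u} \<in> \<C>" using less.prems unfolding \<C>_def M_def connected_on_def by blast
  then have "\<C> \<noteq> {}" by blast
  then obtain C where C: "C \<in> \<C>" "\<And>C'. C' \<in> \<C> \<Longrightarrow> C \<subseteq> C' \<Longrightarrow> C = C'"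
    using finite_has_maximal[of \<C>] by auto
  then have C': "u \<in> C" "C \<subseteq> M" "connected_on adj C" by (auto simp: \<C>_def)
  define S where "S = {s \<in> V. adj a s \<and> (\<exists>c\<in>C. adj s c)}"
  have nbr: "w \<in> C \<union> S" if w: "c \<in> C" "w \<in> V" "adj c w" for c w
  proof (cases "adj a w")
    case True
    then show ?thesis using w sym' unfolding S_def by blast
  next
    case False
    have "w \<noteq> a" using w C'(2) sym' unfolding M_def by blast
    then have "w \<in> M" using False w(2) unfolding M_def by blast
    moreover have "connected_on adj (insert w C)" using connected_on_insert[OF C'(3) sym w(1,3)] .
    ultimately have "insert w C \<in> \<C>" using C' unfolding \<C>_def by blast
    then have "C = insert w C" by (rule C(2)) blast
    then show ?thesis by blast
  qed
  have clique: "adj s t" if st: "s \<in> S" "t \<in> S" "s \<noteq> t" for s t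
  proof -
    obtain b b' where "b \<in> C" "adj s b" "b' \<in> C" "adj t b'" "adj a s" "adj a t"
      using st unfolding S_def by blast
    then show ?thesis using no_cycle[of a s t C b b'] st(3) C' unfolding M_def by blast
  qed
  let ?V = "C \<union> S"
  have VV: "?V \<subseteq> V" "a \<notin> ?V" using C'(2) irreflpD[OF irr] unfolding M_def S_def by blast+
  then have lt: "card ?V < card V" using less.prems(1) by (intro psubset_card_mono) auto
  have "\<exists>x\<in>C. simplicial adj ?V x"
  proof (cases "\<exists>s\<in>S. \<exists>w\<in>?V. w \<noteq> s \<and> \<not> adj s w")
    case True
    then obtain s w where s: "s \<in> S" "w \<in> ?V" "w \<noteq> s" "\<not> adj s w" by blast
    then obtain x where "x \<in> ?V" "x \<noteq> s" "\<not> adj s x" "simplicial adj ?V x"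
      using less.hyps[OF lt, of s w] by blast
    then show ?thesis using clique s(1) by blast
  next
    case S: False
    show ?thesis
    proof (cases "\<exists>c\<in>C. \<exists>w\<in>?V. w \<noteq> c \<and> \<not> adj c w")
      case True
      then obtain c w where c: "c \<in> C" "w \<in> ?V" "w \<noteq> c" "\<not> adj c w" by blast
      then obtain x where x: "x \<in> ?V" "x \<noteq> c" "\<not> adj c x" "simplicial adj ?V x"
        using less.hyps[OF lt, of c w] by blast
      have "x \<notin> S"
      proof
        assume "x \<in> S"
        then have "adj x c" using S c(1) x(2) by auto
        then have "adj c x" by (rule sym')
        then show False using x(3) by simp
      qed
      then have "x \<in> C" using x(1) by simp
      then show ?thesis using x(4) by blast
    next
      case False
      then have "adj v w" if "v \<in> ?V" "w \<in> ?V" "v \<noteq> w" for v w using S that by auto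
      then have "simplicial adj ?V u" unfolding simplicial_def by simp
      then show ?thesis using C'(1) by blast
    qed
  qed
  then obtain x where x: "x \<in> C" "simplicial adj ?V x" by blast
  have "simplicial adj V x"
    unfolding simplicial_def
  proof (intro ballI impI)
    fix v w assume "v \<in> V" "w \<in> V" "adj x v" "adj x w" "v \<noteq> w"
    then show "adj v w" using nbr[OF x(1)] x(2) unfolding simplicial_def by blast
  qed
  then show ?case using x(1) C'(2) unfolding M_def by blast
qed

text \<open>
  Exactness excludes the cycles above, so the graph of the non-edges has a simplicial vertex \<open>x\<close>.  Two
  non-neighbours of \<open>x\<close> in the graph with edge set \<open>\<G>\<close> do not form an edge; thus every edge that avoids \<open>x\<close>
  contains a neighbour of \<open>x\<close>, which is the containment needed to split at \<open>x\<close>.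
\<close>

lemma vertex_splittable_edge_ideal:
  fixes V :: "'n::{finite,linorder} set"
  assumes u: "uniform 2 \<G>"
    and ex: "\<And>W i. i + 2 < card W \<Longrightarrow> exact_at TYPE('k::field) (dual_complex \<G> W) i"
  shows "vertex_splittable V (face_ideal {A \<in> \<G>. A \<subseteq> V} :: ('n, 'k) mpoly set)"
proof (induction "card V" arbitrary: V rule: less_induct)
  case less
  let ?adj = "non_edge \<G>"
  have card2: "card A = 2" if "A \<in> \<G>" for A using u that by (simp add: uniform_def)
  show ?case
  proof (cases "{A \<in> \<G>. A \<subseteq> V} = {}")
    case True
    then show ?thesis by (intro vertex_splittable_face_ideal_at_most_one[where A = "{}"]) auto
  next
    case False
    then obtain A where A: "A \<in> \<G>" "A \<subseteq> V" by blast
    then obtain a v where av: "A = {a, v}" "a \<noteq> v" using card2[of A] by (auto simp: card_2_iff)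
    have "\<exists>x\<in>V. x \<noteq> a \<and> \<not> ?adj a x \<and> simplicial ?adj V x"
    proof (rule ex_simplicial[OF symp_non_edge irreflp_non_edge])
      show "a \<in> V" "v \<in> V" "v \<noteq> a" "\<not> ?adj a v" using A av by (auto simp: non_edge_def)
      fix a s t B b b'
      assume as: "?adj a s" and at: "?adj a t" and "s \<noteq> t" and B: "connected_on ?adj B"
        and aB: "\<And>b. b \<in> B \<Longrightarrow> b \<noteq> a \<and> \<not> ?adj a b"
        and b: "b \<in> B" "?adj s b" and b': "b' \<in> B" "?adj t b'"
      show "?adj s t"
      proof (rule ccontr)
        assume "\<not> ?adj s t"
        then have "{s, t} \<in> \<G>" using \<open>s \<noteq> t\<close> by (simp add: non_edge_def)
        moreover have "{a, c} \<in> \<G>" if "c \<in> B" for c using aB[OF that] by (auto simp: non_edge_def)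
        ultimately have "\<exists>W i. i + 2 < card W \<and> \<not> exact_at TYPE('k) (dual_complex \<G> W) i"
          using not_exact_if_cycle[OF u _ as at _ B b b'] by blast
        then show False using ex by blast
      qed
    qed
    then obtain x where x: "x \<in> V" "simplicial ?adj V x" by blast
    let ?Y = "{y \<in> V. {x, y} \<in> \<G>}" and ?B = "{A \<in> \<G>. A \<subseteq> V - {x}}"
    have xY: "x \<notin> ?Y" using card2[of "{x, x}"] by auto
    have "{A \<in> \<G>. A \<subseteq> V} = insert x ` (\<lambda>y. {y}) ` ?Y \<union> ?B"
    proof (intro set_eqI iffI)
      fix E assume E: "E \<in> {A \<in> \<G>. A \<subseteq> V}"
      show "E \<in> insert x ` (\<lambda>y. {y}) ` ?Y \<union> ?B"
      proof (cases "x \<in> E")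
        case True
        obtain p q where "E = {p, q}" using E card2[of E] by (auto simp: card_2_iff)
        then obtain y where "E = {x, y}" using True by auto
        then show ?thesis using E by blast
      qed (use E in blast)
    qed (use x(1) in auto)
    moreover have "vertex_splittable V (face_ideal (insert x ` (\<lambda>y. {y}) ` ?Y \<union> ?B) :: ('n, 'k) mpoly set)"
    proof (rule vertex_splittable_split_faces[where e = 1])
      show "vertex_splittable V (face_ideal ((\<lambda>y. {y}) ` ?Y) :: ('n, 'k) mpoly set)"
        by (rule vertex_splittable_variables) blast
      show "vertex_splittable (V - {x}) (face_ideal ?B :: ('n, 'k) mpoly set)"
        by (rule less.hyps) (rule card_Diff1_less[OF finite x(1)])
      show "uniform (Suc 1) ?B" using u by (simp add: uniform_def numeral_2_eq_2)
      show "\<exists>A\<in>(\<lambda>y. {y}) ` ?Y. A \<subseteq> B" if B: "B \<in> ?B" for B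
      proof -
        obtain p q where pq: "B = {p, q}" "p \<noteq> q" using B card2[of B] by (auto simp: card_2_iff)
        then have "p \<in> V - {x}" "q \<in> V - {x}" "\<not> ?adj p q" using B by (auto simp: non_edge_def)
        then have "\<not> (?adj x p \<and> ?adj x q)" using x(2) pq(2) unfolding simplicial_def by blast
        then have "p \<in> ?Y \<or> q \<in> ?Y"
          using \<open>p \<in> V - {x}\<close> \<open>q \<in> V - {x}\<close> by (auto simp: non_edge_def)
        then show ?thesis using pq(1) by auto
      qed
    qed (use x(1) xY in \<open>auto simp: uniform_def\<close>)
    ultimately show ?thesis by simp
  qed
qed

section \<open>Ideals generated by complements of edges\<close>

text \<open>
  In the multidegree that contains all variables, the dual complex is the graph of the complements of the
  generators, and exactness in position 1 is the vanishing of its reduced homology in dimension 0.  If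
  \<open>X\<close> is separated from the rest, the difference \<open>\<phi>\<close> of a vertex in \<open>X\<close> and one outside is the boundary of
  some \<open>\<psi>\<close>.  The part of \<open>\<psi>\<close> within \<open>X\<close> has as boundary the part of \<open>\<phi>\<close> within \<open>X\<close>, whose coefficients have
  sum 1, while the coefficients of a boundary have sum 0.
\<close>

lemma connected_if_exact:
  fixes \<G> :: "'n::{finite,linorder} set set"
  assumes u: "\<And>A. A \<in> \<G> \<Longrightarrow> card A + 2 = card (UNIV :: 'n set)"
    and ex: "exact_at TYPE('k::field) (dual_complex \<G> UNIV) 1"
  defines "adj \<equiv> \<lambda>u v. u \<noteq> v \<and> - {u, v} \<in> \<G>"
  shows "connected_on adj {u. \<exists>v. adj u v}"
  unfolding connected_on_def
proof (intro allI impI, rule ccontr)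
  let ?N = "{u. \<exists>v. adj u v}"
  let ?\<Gamma> = "dual_complex \<G> UNIV"
  have sym: "adj v u" if "adj u v" for u v using that unfolding adj_def by (auto simp: insert_commute)
  fix X assume X: "X \<noteq> {}" "X \<subset> ?N" and no: "\<not> (\<exists>u\<in>X. \<exists>v\<in>?N - X. adj u v)"
  then obtain p q where p: "p \<in> X" and q: "q \<in> ?N - X" by blast
  then have pq: "p \<noteq> q" "p \<in> ?N" "q \<in> ?N" using X(2) by auto
  define \<phi> :: "'n set \<Rightarrow> 'k" where "\<phi> F = (if F = {p} then 1 else if F = {q} then - 1 else 0)" for F
  have N\<Gamma>: "{v} \<in> ?\<Gamma>" if "v \<in> ?N" for v
  proof -
    obtain w where "adj v w" using \<open>v \<in> ?N\<close> by blast
    then have "- {v, w} \<in> \<G>" "- {v, w} \<subseteq> UNIV - {v}" by (auto simp: adj_def)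
    then show ?thesis unfolding dual_complex_def by blast
  qed
  have "\<phi> \<in> face_chains ?\<Gamma> 1" using N\<Gamma> pq by (auto simp: face_chains_def \<phi>_def)
  moreover have sum: "(\<Sum>v\<in>UNIV. \<phi> {v}) = 0"
  proof -
    have "(\<Sum>v\<in>UNIV. \<phi> {v}) = (\<Sum>v\<in>{p, q}. \<phi> {v})"
      by (rule sum.mono_neutral_right) (auto simp: \<phi>_def)
    then show ?thesis using pq(1) by (simp add: \<phi>_def)
  qed
  have "sbd \<phi> = 0"
  proof
    fix G show "sbd \<phi> G = 0 G"
    proof (cases "G = {}")
      case True
      then show ?thesis using sum by (simp add: sbd_def)
    next
      case False
      have "insert v G \<noteq> {p} \<and> insert v G \<noteq> {q}" if "v \<notin> G" for v using that False by auto
      then have "\<phi> (insert v G) = 0" if "v \<notin> G" for v using that unfolding \<phi>_def by presburger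
      then show ?thesis by (simp add: sbd_def)
    qed
  qed
  ultimately obtain \<psi> where \<psi>: "\<psi> \<in> face_chains ?\<Gamma> (Suc 1)" "sbd \<psi> = \<phi>"
    using ex unfolding exact_at_def by blast
  define \<psi>' where "\<psi>' F = (if F \<subseteq> X then \<psi> F else 0)" for F
  have edge: "adj v w" if vw: "\<psi> {v, w} \<noteq> 0" "v \<noteq> w" for v w
  proof -
    obtain A where A: "A \<in> \<G>" "A \<subseteq> - {v, w}"
      using \<psi>(1) vw by (auto simp: face_chains_def dual_complex_def Compl_eq_Diff_UNIV)
    have "card (- {v, w}) + 2 = card (UNIV :: 'n set)"
      using that(2) card_Diff_subset[of "{v, w}" UNIV] card_mono[of UNIV "{v, w}"]
      by (simp add: Compl_eq_Diff_UNIV)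
    then have "A = - {v, w}" using A u[OF A(1)] by (intro card_subset_eq) auto
    then show ?thesis using A(1) that(2) by (simp add: adj_def)
  qed
  have b: "sbd \<psi>' {v} = (if v \<in> X then \<phi> {v} else 0)" for v
  proof (cases "v \<in> X")
    case True
    have "\<psi>' (insert w {v}) = \<psi> (insert w {v})" if "w \<in> - {v}" for w
    proof (cases "w \<in> X")
      case False
      have "\<psi> {v, w} = 0"
      proof (rule ccontr)
        assume "\<psi> {v, w} \<noteq> 0"
        then have "adj v w" using that edge by blast
        then have "w \<in> ?N - X" using sym False by blast
        then show False using no True \<open>adj v w\<close> by blast
      qed
      then show ?thesis by (simp add: \<psi>'_def insert_commute)
    qed (use True in \<open>simp add: \<psi>'_def\<close>)
    then have "sbd \<psi>' {v} = sbd \<psi> {v}" unfolding sbd_def by (intro sum.cong) auto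
    then show ?thesis using \<psi>(2) True by simp
  next
    case False
    then show ?thesis by (simp add: sbd_def \<psi>'_def)
  qed
  have "sbd (sbd \<psi>') {} = (\<Sum>v\<in>UNIV. sbd \<psi>' {v})" by (simp add: sbd_def[of "sbd \<psi>'"])
  also have "\<dots> = (\<Sum>v\<in>{p}. sbd \<psi>' {v})"
    using q by (intro sum.mono_neutral_right) (auto simp: b \<phi>_def)
  also have "\<dots> = 1" using p by (simp add: b \<phi>_def)
  finally show False by (simp add: sbd_sbd)
qed

section \<open>Gradient ideals of an ideal with linear resolution\<close>

lemma shadows_eq_complements:
  fixes \<G> :: "'n::finite set set"
  assumes u: "uniform d \<G>" and l: "l \<le> d" and d: "d + c = card (UNIV :: 'n set)"
  shows "shadows d l \<G> = complements UNIV (c + l) (\<lambda>D. \<exists>D0. D0 \<subseteq> D \<and> - D0 \<in> \<G>)"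
proof -
  have card: "card (- B) + card B = card (UNIV :: 'n set)" for B :: "'n set"
    using card_Un_disjoint[of "- B" B] by (simp add: Compl_partition2)
  have *: "B \<in> shadows d l \<G> \<longleftrightarrow> card (- B) = c + l \<and> (\<exists>D0. D0 \<subseteq> - B \<and> - D0 \<in> \<G>)" for B
  proof -
    have "card B + l = d \<longleftrightarrow> card (- B) = c + l" using card[of B] d l by linarith
    moreover have "(\<exists>A\<in>\<G>. B \<subseteq> A) \<longleftrightarrow> (\<exists>D0. D0 \<subseteq> - B \<and> - D0 \<in> \<G>)"
      by (metis Compl_subset_Compl_iff double_compl)
    ultimately show ?thesis by (simp add: shadows_def)
  qed
  have **: "B \<in> complements UNIV (c + l) P \<longleftrightarrow> card (- B) = c + l \<and> P (- B)" for B :: "'n set" and P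
  proof
    assume "B \<in> complements UNIV (c + l) P"
    then show "card (- B) = c + l \<and> P (- B)"
      by (auto simp: complements_def Compl_eq_Diff_UNIV[symmetric])
  next
    assume "card (- B) = c + l \<and> P (- B)"
    then show "B \<in> complements UNIV (c + l) P"
      unfolding complements_def by (intro image_eqI[of _ _ "- B"]) auto
  qed
  show ?thesis by (rule set_eqI) (simp only: * **)
qed

text \<open>
  The last two gradient ideals are generated by variables or equal to the ring.  For \<open>d = 2\<close> the
  only other one is the ideal itself.  If the complements of the generators have
  \<open>c \<le> 2\<close> elements, then the complements of the generators of the gradient ideals are the sets of a given size
  that contain one of them: all sets if \<open>c = 0\<close>, the sets that meet a given one if \<open>c = 1\<close>, and the sets that contain an
  edge of a graph if \<open>c = 2\<close>.  This graph is connected by exactness.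
\<close>

lemma vertex_splittable_shadows:
  fixes \<G> :: "'n::{finite,linorder} set set"
  assumes u: "uniform d \<G>" and ne: "\<G> \<noteq> {}" and l: "l \<le> d"
    and lr: "has_linear_resolution (face_ideal \<G> :: ('n, 'k::field) mpoly set)"
    and d: "d \<le> 2 \<or> card (UNIV :: 'n set) \<le> d + 2"
  shows "vertex_splittable UNIV (face_ideal (shadows d l \<G>) :: ('n, 'k) mpoly set)"
proof -
  have ex: "exact_at TYPE('k) (dual_complex \<G> W) i" if "i + d < card W" for W i
    using lr that unfolding has_linear_resolution_face_ideal_iff[OF u ne] by blast
  obtain A0 where A0: "A0 \<in> \<G>" using ne by blast
  have "card A0 = d" using A0 u by (simp add: uniform_def)
  then have dn: "d \<le> card (UNIV :: 'n set)" by (metis card_mono finite subset_UNIV)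
  have "l = d \<or> Suc l = d \<or> d = 2 \<and> l = 0 \<or> card (UNIV :: 'n set) \<le> d + 2"
    using d l by arith
  then consider "l = d" | "Suc l = d" | "d = 2" "l = 0" | "card (UNIV :: 'n set) \<le> d + 2"
    by blast
  then show ?thesis
  proof cases
    case 1
    then have "shadows d l \<G> \<subseteq> {{}}" by (auto simp: shadows_def)
    then show ?thesis by (rule vertex_splittable_face_ideal_at_most_one) simp
  next
    case 2
    then have "card B = 1" if "B \<in> shadows d l \<G>" for B using that by (auto simp: shadows_def)
    then have "shadows d l \<G> = (\<lambda>y. {y}) ` {y. {y} \<in> shadows d l \<G>}"
      by (auto simp: card_1_singleton_iff image_iff)
    then show ?thesis by (metis vertex_splittable_variables subset_UNIV)
  next
    case 3
    then have "shadows d l \<G> = {A \<in> \<G>. A \<subseteq> UNIV}" using shadows_0 u by simp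
    then show ?thesis using vertex_splittable_edge_ideal[where V = UNIV and 'k = 'k, of \<G>] u ex 3 by simp
  next
    case 4
    define c where "c = card (UNIV :: 'n set) - d"
    have c: "d + c = card (UNIV :: 'n set)" "c \<le> 2" using 4 dn by (simp_all add: c_def)
    note shadows = shadows_eq_complements[OF u l c(1)]
    have card: "card (- A) = c" if "A \<in> \<G>" for A
    proof -
      have "card A = d" using u that by (simp add: uniform_def)
      then show ?thesis using c(1) card_Un_disjoint[of "- A" A] by (simp add: Compl_partition2)
    qed
    have cardD: "card D0 = c" if "- D0 \<in> \<G>" for D0 using card[OF that] by simp
    consider "c = 0" | "c = 1" | "c = 2" using c(2) by linarith
    then show ?thesis
    proof cases
      case 1
      then have "- {} \<in> \<G>" using card[OF A0] A0 by (metis card_0_eq double_compl finite)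
      then have "shadows d l \<G> = complements UNIV (c + l) (\<lambda>D. True)"
        unfolding shadows by (intro complements_cong) blast
      then show ?thesis by (simp add: vertex_splittable_all_complements)
    next
      case 2
      define N where "N = {v. - {v} \<in> \<G>}"
      have "N \<noteq> {}" using card[OF A0] A0 2 unfolding N_def by (metis card_1_singletonE double_compl empty_iff mem_Collect_eq One_nat_def)
      have "(\<exists>D0. D0 \<subseteq> D \<and> - D0 \<in> \<G>) \<longleftrightarrow> D \<inter> N \<noteq> {} \<or> has_edge (\<lambda>u v. False) D" for D
        using cardD 2 unfolding N_def has_edge_def
        by (auto simp: card_1_singleton_iff)
      then have "shadows d l \<G> = complements UNIV (c + l) (\<lambda>D. D \<inter> N \<noteq> {} \<or> has_edge (\<lambda>u v. False) D)"
        unfolding shadows by (intro complements_cong) blast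
      moreover have "vertex_splittable UNIV (face_ideal (complements UNIV (c + l)
          (\<lambda>D. D \<inter> N \<noteq> {} \<or> has_edge (\<lambda>u v. False) D)) :: ('n, 'k) mpoly set)"
        using \<open>N \<noteq> {}\<close> by (intro vertex_splittable_complements_reaches[where N = N])
          (auto simp: reaches_def symp_def irreflp_def)
      ultimately show ?thesis by simp
    next
      case 3
      define adj where "adj = (\<lambda>u v. u \<noteq> v \<and> - {u, v} \<in> \<G>)"
      let ?N = "{u. \<exists>v. adj u v}"
      have sym: "symp adj" by (auto simp: symp_def adj_def insert_commute)
      have irr: "irreflp adj" by (auto simp: irreflp_def adj_def)
      have "card A + 2 = card (UNIV :: 'n set)" if "A \<in> \<G>" for A
        using that u c(1) 3 by (simp add: uniform_def)
      moreover have "exact_at TYPE('k) (dual_complex \<G> UNIV) 1" using ex[of 1 UNIV] c(1) 3 by simp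
      ultimately have conn: "connected_on adj ?N" unfolding adj_def by (rule connected_if_exact)
      obtain u v where uv: "- A0 = {u, v}" "u \<noteq> v" using card[OF A0] 3 by (auto simp: card_2_iff)
      then have "adj u v" using A0 by (metis adj_def double_compl)
      then have "{u, v} \<subseteq> ?N" using sympD[OF sym] by blast
      then have "card {u, v} \<le> card ?N" by (intro card_mono) auto
      then have N2: "2 \<le> card ?N" using uv(2) by simp
      have "(\<exists>D0. D0 \<subseteq> D \<and> - D0 \<in> \<G>) \<longleftrightarrow> has_edge adj D" for D
      proof
        assume "\<exists>D0. D0 \<subseteq> D \<and> - D0 \<in> \<G>"
        then obtain D0 where D0: "D0 \<subseteq> D" "- D0 \<in> \<G>" by blast
        then obtain p q where "D0 = {p, q}" "p \<noteq> q" using cardD[OF D0(2)] 3 by (auto simp: card_2_iff)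
        then show "has_edge adj D" using D0 unfolding has_edge_def adj_def by blast
      next
        assume "has_edge adj D"
        then obtain p q where "p \<in> D" "q \<in> D" "- {p, q} \<in> \<G>" unfolding has_edge_def adj_def by blast
        then show "\<exists>D0. D0 \<subseteq> D \<and> - D0 \<in> \<G>" by (intro exI[of _ "{p, q}"]) simp
      qed
      then have "shadows d l \<G> = complements UNIV (c + l) (has_edge adj)"
        unfolding shadows by (intro complements_cong) blast
      moreover have "vertex_splittable UNIV (face_ideal (complements UNIV (c + l) (has_edge adj)) :: ('n, 'k) mpoly set)"
        by (rule vertex_splittable_complements_connected[OF sym irr _ N2 _ conn]) auto
      ultimately show ?thesis by simp
    qed
  qed
qed

theorem theorem4p2:
  fixes I :: "('n::{finite,linorder}, 'k::field) mpoly set"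
    and n d :: nat
  assumes n: "n = card (UNIV :: 'n set)"
    and char: "CHAR('k) = 0 \<or>
      (\<forall>l<d. monomial_ideal ((gradient_ideal ^^ l) I) \<longrightarrow>
         gradient_ideal ((gradient_ideal ^^ l) I) =
           ideal_gen {mon (u - Poly_Mapping.single v 1) | u v.
             u \<in> min_mons ((gradient_ideal ^^ l) I) \<and> v \<in> Poly_Mapping.keys u})"
    and nonzero: "I \<noteq> {0}"
    and squarefree: "squarefree_monomial_ideal I"
    and equigen: "equigenerated d I"
    and d: "int d \<in> {0, 1, 2, int n - 2, int n - 1, int n}"
  shows "(has_linear_resolution I \<longleftrightarrow> has_linear_quotients I) \<and>
    (has_linear_quotients I \<longleftrightarrow> vertex_splittable UNIV I) \<and>
    (vertex_splittable UNIV I \<longleftrightarrow> has_differential_linear_resolution I)"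
proof -
  obtain \<G> where u: "uniform d \<G>" and I: "I = face_ideal \<G>"
    using squarefree_monomial_idealE[OF squarefree equigen] .
  have ne: "\<G> \<noteq> {}" using nonzero unfolding I by (auto simp: face_ideal_def)
  have dn: "d \<le> 2 \<or> card (UNIV :: 'n set) \<le> d + 2" using d n by auto
  have power: "(gradient_ideal ^^ l) I = face_ideal (shadows d l \<G>)" if "l \<le> d" for l
    unfolding I by (rule gradient_power_face_ideal[OF u that])
  have cb: "has_linear_quotients J" if "vertex_splittable UNIV J" for J :: "('n, 'k) mpoly set"
    using vertex_splittable_imp_linear_quotients[OF that] by blast
  have ba: "has_linear_resolution I" if "has_linear_quotients I"
    using linear_quotients_imp_linear_resolution[OF u ne] that unfolding I by blast
  have vs: "vertex_splittable UNIV (face_ideal (shadows d l \<G>) :: ('n, 'k) mpoly set)"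
    if "has_linear_resolution I" "l \<le> d" for l
    using vertex_splittable_shadows[OF u ne that(2) _ dn] that(1) unfolding I by blast
  have ac: "vertex_splittable UNIV I" if "has_linear_resolution I"
    using vs[OF that, of 0] shadows_0[OF u] unfolding I by simp
  have \<alpha>: "alpha I = d" unfolding I by (rule alpha_face_ideal[OF u ne])
  have ad: "has_differential_linear_resolution I" if "has_linear_resolution I"
    unfolding has_differential_linear_resolution_def \<alpha>
  proof (intro allI impI)
    fix l assume l: "l \<le> d"
    obtain A where A: "A \<in> \<G>" using ne by blast
    then have "d - l \<le> card A" using u by (simp add: uniform_def)
    then obtain B where "B \<subseteq> A" "card B = d - l" by (meson obtain_subset_with_card_n)
    then have "shadows d l \<G> \<noteq> {}" using A l unfolding shadows_def by fastforce
    then show "has_linear_resolution ((gradient_ideal ^^ l) I)"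
      unfolding power[OF l]
      by (intro linear_quotients_imp_linear_resolution[OF uniform_shadows] cb vs that l)
  qed
  have da: "has_linear_resolution I" if "has_differential_linear_resolution I"
    using that unfolding has_differential_linear_resolution_def by (metis funpow_0 le0)
  show ?thesis using cb ba ac ad da by blast
qed

end
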